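(* Let $\mu_0=N(m_0,C_0)$ be a Gaussian measure on $\mathcal H$ with mean $m_0\in\mathcal H$ and (strictly positive, trace-class) covariance operator $C_0$, and let $\mu$ be given by $\frac{d\mu}{d\mu_0}(x)=\frac1{Z_\mu}\exp(-\Phi(x))$. Consider the following choices for a set $\mathcal A$ of probability measures: (1) $\mathcal A_1=\{\text{Gaussian measures on }\mathcal H\}$; (2) $\mathcal A_2=\{\text{Gaussian measures on }\mathcal H\text{ equivalent to }\mu_0\}$; (3) for a fixed covariance operator $\hat C$ (trace-class on $\mathcal H$), $\mathcal A_3=\{\text{Gaussian measures on }\mathcal H\text{ with covariance }\hat C\}$; (4) for a fixed mean $\hat m\in\mathcal H$, $\mathcal A_4=\{\text{Gaussian measures on }\mathcal H\text{ with mean }\hat m\}$. In each of these situations $i\in\{1,2,3,4\}$, as soon as there exists a single $\nu\in\mathcal A_i$ with $D_{\rm KL}(\nu\|\mu)<\infty$, there exists a minimiser of $\nu\mapsto D_{\rm KL}(\nu\|\mu)$ in $\mathcal A_i$. Furthermore, such a minimiser $\nu$ is necessarily equivalent to $\mu_0$ in the sense of measures.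
   Context: $\mathcal H$ is a separable Hilbert space with its Borel $\sigma$-algebra. A probability measure on $\mathcal H$ is Gaussian if its push-forward under every continuous linear functional is Gaussian on $\mathbb R$ (Dirac measures count as Gaussians with variance $0$). $N(m,C)$ denotes the Gaussian measure with mean $m\in\mathcal H$ and covariance operator $C$ (non-negative, symmetric, trace-class). $X\subseteq\mathcal H$ is a separable Banach space continuously embedded in $\mathcal H$, Borel measurable as a subset of $\mathcal H$, with $\mu_0(X)=1$; $\Phi:X\to\mathbb R$ is continuous in the topology of $X$, $\exp(-\Phi)$ is $\mu_0$-integrable, and $Z_\mu=\int\exp(-\Phi)\,d\mu_0$. For probability measures, $D_{\rm KL}(\nu\|\mu)=\int \log\big(\frac{d\nu}{d\mu}\big)\frac{d\nu}{d\mu}\,d\mu$ (with $0\log 0=0$) if $\nu\ll\mu$, and $D_{\rm KL}(\nu\|\mu)=+\infty$ otherwise. Two measures are equivalent if they are mutually absolutely continuous. *)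

theory Defs
  imports "HOL-Probability.Probability"
begin

section \<open>Covariance operators\<close>

text \<open>
  Separable real Hilbert spaces are rendered by the sort
  \<open>{real_inner, polish_space}\<close>: complete and second countable.
\<close>

definition orthonormal_basis :: "'h::real_inner set \<Rightarrow> bool" where
  "orthonormal_basis E \<longleftrightarrow>
     pairwise orthogonal E \<and> (\<forall>e\<in>E. norm e = 1) \<and> closure (span E) = UNIV"

text \<open>
  For a non-negative symmetric operator, being trace-class means that the trace
  \<open>\<Sum>e\<in>E. C e \<bullet> e\<close> is finite; this does not depend on the choice of
  the orthonormal basis.
\<close>

definition covariance_operator :: "('h::real_inner \<Rightarrow> 'h) \<Rightarrow> bool" where
  "covariance_operator C \<longleftrightarrow>
     bounded_linear C \<and>
     (\<forall>h k. C h \<bullet> k = h \<bullet> C k) \<and>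
     (\<forall>h. 0 \<le> C h \<bullet> h) \<and>
     (\<exists>E. orthonormal_basis E \<and> (\<lambda>e. C e \<bullet> e) summable_on E)"

definition strictly_positive :: "('h::real_inner \<Rightarrow> 'h) \<Rightarrow> bool" where
  "strictly_positive C \<longleftrightarrow> (\<forall>h. h \<noteq> 0 \<longrightarrow> 0 < C h \<bullet> h)"

section \<open>Gaussian measures\<close>

definition gaussian_real :: "real measure \<Rightarrow> bool" where
  "gaussian_real \<nu> \<longleftrightarrow>
     (\<exists>m. \<nu> = return borel m) \<or>
     (\<exists>m \<sigma>. 0 < \<sigma> \<and> \<nu> = density lborel (normal_density m \<sigma>))"

definition gaussian :: "'h::{real_inner, polish_space} measure \<Rightarrow> bool" where
  "gaussian \<nu> \<longleftrightarrow>
     prob_space \<nu> \<and> sets \<nu> = sets borel \<and>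
     (\<forall>f::'h \<Rightarrow> real. bounded_linear f \<longrightarrow> gaussian_real (distr \<nu> borel f))"

definition has_mean :: "'h::{real_inner, polish_space} measure \<Rightarrow> 'h \<Rightarrow> bool" where
  "has_mean \<nu> m \<longleftrightarrow>
     (\<forall>h. integrable \<nu> (\<lambda>x. x \<bullet> h) \<and> (LINT x|\<nu>. x \<bullet> h) = m \<bullet> h)"

definition has_covariance ::
  "'h::{real_inner, polish_space} measure \<Rightarrow> ('h \<Rightarrow> 'h) \<Rightarrow> bool" where
  "has_covariance \<nu> C \<longleftrightarrow>
     (\<exists>m. has_mean \<nu> m \<and>
       (\<forall>h k. integrable \<nu> (\<lambda>x. ((x - m) \<bullet> h) * ((x - m) \<bullet> k)) \<and>
              (LINT x|\<nu>. ((x - m) \<bullet> h) * ((x - m) \<bullet> k)) = C h \<bullet> k))"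

text \<open>\<open>is_normal \<mu> m C\<close> expresses \<open>\<mu> = N(m, C)\<close>.\<close>

definition is_normal ::
  "'h::{real_inner, polish_space} measure \<Rightarrow> 'h \<Rightarrow> ('h \<Rightarrow> 'h) \<Rightarrow> bool" where
  "is_normal \<mu> m C \<longleftrightarrow> gaussian \<mu> \<and> has_mean \<mu> m \<and> has_covariance \<mu> C"

section \<open>Equivalence of measures and the Kullback-Leibler divergence\<close>

definition equivalent_measures :: "'a measure \<Rightarrow> 'a measure \<Rightarrow> bool" where
  "equivalent_measures \<mu> \<nu> \<longleftrightarrow>
     absolutely_continuous \<mu> \<nu> \<and> absolutely_continuous \<nu> \<mu>"

text \<open>
  The library's \<open>KL_divergence\<close> is real-valued and hence cannot be infinite.
  Here the integral of \<open>\<rho> * ln \<rho>\<close> is taken as an extended real, as the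
  difference of the integrals of its positive and negative parts; the latter is
  finite for a probability measure \<open>\<mu>\<close> because \<open>t * ln t \<ge> - exp (- 1)\<close>.
  The convention \<open>0 * ln 0 = 0\<close> holds automatically. In the library,
  \<open>absolutely_continuous \<mu> \<nu>\<close> stands for \<open>\<nu> \<lless> \<mu>\<close>.
\<close>

definition KL :: "'a measure \<Rightarrow> 'a measure \<Rightarrow> ereal" where
  "KL \<nu> \<mu> =
     (if absolutely_continuous \<mu> \<nu> then
        let \<rho> = (\<lambda>x. enn2real (RN_deriv \<mu> \<nu> x)) in
          enn2ereal (\<integral>\<^sup>+x. ennreal (\<rho> x * ln (\<rho> x)) \<partial>\<mu>)
          - enn2ereal (\<integral>\<^sup>+x. ennreal (- (\<rho> x * ln (\<rho> x))) \<partial>\<mu>)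
      else \<infinity>)"

section \<open>Continuously embedded Banach spaces\<close>

text \<open>
  A subspace \<open>X\<close> with its own norm \<open>N\<close>, of which only the values on
  \<open>X\<close> matter. Since \<open>Metric_space\<close> asks for non-negativity and symmetry
  of the distance on the whole type, the distance is set to \<open>0\<close> off \<open>X\<close>.
\<close>

definition norm_metric :: "'h::real_vector set \<Rightarrow> ('h \<Rightarrow> real) \<Rightarrow> 'h \<Rightarrow> 'h \<Rightarrow> real" where
  "norm_metric X N x y = (if x \<in> X \<and> y \<in> X then N (x - y) else 0)"

abbreviation norm_topology :: "'h::real_vector set \<Rightarrow> ('h \<Rightarrow> real) \<Rightarrow> 'h topology" where
  "norm_topology X N \<equiv> Metric_space.mtopology X (norm_metric X N)"

definition is_norm_on :: "'h::real_vector set \<Rightarrow> ('h \<Rightarrow> real) \<Rightarrow> bool" where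
  "is_norm_on X N \<longleftrightarrow>
     subspace X \<and>
     (\<forall>x\<in>X. 0 \<le> N x \<and> (N x = 0 \<longleftrightarrow> x = 0)) \<and>
     (\<forall>x\<in>X. \<forall>c. N (c *\<^sub>R x) = \<bar>c\<bar> * N x) \<and>
     (\<forall>x\<in>X. \<forall>y\<in>X. N (x + y) \<le> N x + N y)"

lemma Metric_space_norm_metric:
  assumes "is_norm_on X N"
  shows "Metric_space X (norm_metric X N)"
proof
  have sub: "subspace X" and nn: "\<And>x. x \<in> X \<Longrightarrow> 0 \<le> N x"
    and z: "\<And>x. x \<in> X \<Longrightarrow> N x = 0 \<longleftrightarrow> x = 0"
    and sc: "\<And>x c. x \<in> X \<Longrightarrow> N (c *\<^sub>R x) = \<bar>c\<bar> * N x"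
    and tri: "\<And>x y. x \<in> X \<Longrightarrow> y \<in> X \<Longrightarrow> N (x + y) \<le> N x + N y"
    using assms by (auto simp: is_norm_on_def)
  fix x y
  show "0 \<le> norm_metric X N x y"
    using nn subspace_diff[OF sub] by (simp add: norm_metric_def)
  show "norm_metric X N x y = norm_metric X N y x"
    using sc[of "x - y" "-1"] subspace_diff[OF sub, of x y] by (simp add: norm_metric_def)
  {
    assume "x \<in> X" "y \<in> X"
    then show "norm_metric X N x y = 0 \<longleftrightarrow> x = y"
      using z subspace_diff[OF sub, of x y] by (simp add: norm_metric_def)
  }
  fix w
  assume "x \<in> X" "y \<in> X" "w \<in> X"
  then show "norm_metric X N x w \<le> norm_metric X N x y + norm_metric X N y w"
    using tri[of "x - y" "y - w"] subspace_diff[OF sub] by (simp add: norm_metric_def)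
qed

definition separable_Banach_embedded ::
  "'h::real_normed_vector set \<Rightarrow> ('h \<Rightarrow> real) \<Rightarrow> bool" where
  "separable_Banach_embedded X N \<longleftrightarrow>
     is_norm_on X N \<and>
     Metric_space.mcomplete X (norm_metric X N) \<and>
     separable_space (norm_topology X N) \<and>
     continuous_map (norm_topology X N) euclidean (\<lambda>x. x)"

end

theory Submission
  imports Defs
begin

text \<open>
  Relative entropy bounds give uniform absolute continuity with respect to \<open>\<mu>\<close>, hence a minimising
  sequence has a subsequence that converges on every Borel set, and the divergence is lower
  semicontinuous for this convergence. Setwise limits of Gaussian measures are Gaussian, with
  convergent variances and (along subsequences) means, so each of the classes (1), (3), (4) is closed.

  Class (2) and the last claim rest on the Feldman--Hajek dichotomy: a Gaussian \<open>\<nu>\<close> that is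
  absolutely continuous with respect to \<open>\<mu>\<^sub>0\<close> is equivalent to it. If \<open>\<rho>\<close> is the density of \<open>\<nu>\<close>, the variances
  of \<open>\<nu>\<close> dominate those of \<open>\<mu>\<^sub>0\<close> up to a constant, so \<open>\<nu>\<close> shifted by an element of the range of \<open>C\<^sub>0\<close>
  is absolutely continuous with respect to \<open>\<nu>\<close>. Hence \<open>{\<rho> > 0}\<close> is invariant under these shifts up to
  null sets, and a zero-one law gives it full \<open>\<mu>\<^sub>0\<close>-measure.
\<close>

section \<open>One-dimensional Gaussian measures\<close>

text \<open>Setwise rather than weak convergence is the natural mode here: bounded entropy yields it
  without any tightness argument, and integrals of bounded Borel functions, such as the logarithm of
  a truncated density, pass to the limit. All Gaussian computations are reduced to one linear
  functional at a time. Laws on the Hilbert space are identified by characteristic functionals,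
  limits by characteristic functions on the line. The obstacle is that equivalence to
  \<open>\<mu>\<^sub>0\<close> does not pass to setwise limits by itself: of a limit only absolute
  continuity is known, so equivalence has to be recovered from absolute continuity and Gaussianity.
  Two covariances need not be simultaneously diagonalisable, so nothing is expanded in coordinates;
  a comparison of variances direction by direction takes that place. Shifts are taken in the range
  of \<open>C\<^sub>0\<close> because for them the density of the shifted
  \<open>\<mu>\<^sub>0\<close> is the explicit exponential in \<open>tilt\<close>.\<close>

lemma finite_measure_char_unique:
  fixes M N :: "real measure"
  assumes fM: "finite_measure M" and fN: "finite_measure N"
    and sM: "sets M = sets borel" and sN: "sets N = sets borel"
    and eq: "\<And>t. char M t = char N t"
  shows "M = N"
proof -
  interpret M: finite_measure M by fact
  interpret N: finite_measure N by fact
  note [measurable_cong] = sM sN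
  have spM: "space M = UNIV" and spN: "space N = UNIV"
    using sets_eq_imp_space_eq[OF sM] sets_eq_imp_space_eq[OF sN] by auto
  define c where "c = measure M UNIV"
  have c: "measure N UNIV = c"
    using eq[of 0] by (simp add: char_def c_def spM spN)
  show ?thesis
  proof (cases "c = 0")
    case True
    have "emeasure M A = emeasure N A" if "A \<in> sets M" for A
    proof -
      have "emeasure M A \<le> emeasure M UNIV" "emeasure N A \<le> emeasure N UNIV"
        using emeasure_space[of M A] emeasure_space[of N A] spM spN by simp_all
      moreover have "emeasure M UNIV = 0" "emeasure N UNIV = 0"
        using True c by (simp_all add: M.emeasure_eq_measure N.emeasure_eq_measure c_def)
      ultimately show ?thesis by simp
    qed
    then show ?thesis using sM sN by (intro measure_eqI) auto
  next
    case False
    then have cpos: "c > 0" unfolding c_def by (simp add: zero_less_measure_iff)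
    \<comment> \<open>Levy's theorem is about probability measures. The characteristic function at 0
      has shown that both total masses equal \<open>c\<close>, so one factor normalises
      both.\<close>
    let ?d = "\<lambda>M. density M (\<lambda>_. ennreal (1 / c))"
    have d: "real_distribution (?d L) \<and> (\<forall>t. char (?d L) t = char L t / c)"
      if L: "finite_measure L" "sets L = sets borel" "measure L UNIV = c" for L :: "real measure"
    proof -
      interpret L: finite_measure L by fact
      note [measurable_cong] = L(2)
      have sp: "space L = UNIV" using sets_eq_imp_space_eq[OF L(2)] by auto
      have "emeasure (?d L) (space (?d L)) = ennreal (1 / c) * ennreal c"
        using L(3) by (simp add: emeasure_density sp L.emeasure_eq_measure)
      also have "\<dots> = 1" using cpos by (simp flip: ennreal_mult)
      finally have "prob_space (?d L)" by (rule prob_spaceI)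
      moreover have "char (?d L) t = char L t / c" for t
        unfolding char_def using cpos
        by (subst integral_density) (auto simp: scaleR_conv_of_real)
      ultimately show ?thesis
        using L(2) by (auto simp: real_distribution_def real_distribution_axioms_def)
    qed
    have "?d M = ?d N"
      using d[OF fM sM] d[OF fN sN c] eq by (intro Levy_uniqueness ext) (auto simp: c_def)
    then have d_eq: "emeasure (?d M) A = emeasure (?d N) A" for A by simp
    have e: "ennreal (1 / c) * emeasure M A = ennreal (1 / c) * emeasure N A" if "A \<in> sets borel" for A
      using that sM sN d_eq[of A] by (simp add: emeasure_density_const)
    have "emeasure M A = emeasure N A" if "A \<in> sets M" for A
    proof -
      have "1 / c * measure M A = 1 / c * measure N A"
        using e[of A] that sM cpos
        by (simp add: M.emeasure_eq_measure N.emeasure_eq_measure flip: ennreal_mult)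
      then show ?thesis using cpos by (simp add: M.emeasure_eq_measure N.emeasure_eq_measure)
    qed
    then show ?thesis using sM sN by (intro measure_eqI) auto
  qed
qed

text \<open>The weight \<open>g\<close> carries information about further coordinates: uniqueness on
  the line is applied to the law of \<open>Y\<close> under an unnormalised measure, hence the
  version for finite measures.\<close>

lemma weighted_distr_unique:
  fixes Y :: "'a \<Rightarrow> real" and Y' :: "'b \<Rightarrow> real" and g :: "'a \<Rightarrow> real" and g' :: "'b \<Rightarrow> real"
  assumes [measurable]: "Y \<in> borel_measurable M" "Y' \<in> borel_measurable M'"
    and g: "integrable M g" "\<And>x. 0 \<le> g x" and g': "integrable M' g'" "\<And>x. 0 \<le> g' x"
    and eq: "\<And>t. (CLINT x|M. complex_of_real (g x) * iexp (t * Y x)) =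
                  (CLINT x|M'. complex_of_real (g' x) * iexp (t * Y' x))"
  shows "distr (density M g) borel Y = distr (density M' g') borel Y'"
proof (rule finite_measure_char_unique)
  have [measurable]: "g \<in> borel_measurable M" "g' \<in> borel_measurable M'" using g g' by auto
  have "emeasure (density M g) (space (density M g)) \<noteq> \<infinity>"
    using integrableD(2)[OF g(1)] g(2) by (simp add: emeasure_density nn_integral_eq_integral cong: nn_integral_cong)
  moreover have "emeasure (density M' g') (space (density M' g')) \<noteq> \<infinity>"
    using integrableD(2)[OF g'(1)] g'(2) by (simp add: emeasure_density nn_integral_eq_integral cong: nn_integral_cong)
  ultimately have "finite_measure (density M g)" "finite_measure (density M' g')"
    by (auto intro!: finite_measureI)
  then show "finite_measure (distr (density M g) borel Y)" "finite_measure (distr (density M' g') borel Y')"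
    by (simp_all add: finite_measure.finite_measure_distr)
  show "char (distr (density M g) borel Y) t = char (distr (density M' g') borel Y') t" for t
    using eq[of t] g(2) g'(2) unfolding char_def
    by (simp add: integral_distr integral_density scaleR_conv_of_real)
qed auto

lemma normal_distr_std:
  assumes "0 < \<sigma>"
  shows "density lborel (normal_density m \<sigma>) = distr std_normal_distribution borel (\<lambda>x. m + \<sigma> * x)"
proof -
  interpret real_distribution std_normal_distribution by (rule real_dist_normal_dist)
  have "distributed std_normal_distribution lborel (\<lambda>x. x) std_normal_density"
    by (simp add: distributed_def distr_id2)
  from normal_density_affine[OF this, of \<sigma> m] assms
  have "distributed std_normal_distribution lborel (\<lambda>x. m + \<sigma> * x) (normal_density m \<sigma>)" by simp
  then have "distr std_normal_distribution lborel (\<lambda>x. m + \<sigma> * x) = density lborel (normal_density m \<sigma>)"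
    by (simp add: distributed_def)
  then show ?thesis by (metis (no_types, lifting) distr_cong sets_lborel)
qed

lemma char_normal:
  assumes "0 < \<sigma>"
  shows "char (density lborel (normal_density m \<sigma>)) t = exp (\<i> * (t * m) - \<sigma>\<^sup>2 * t\<^sup>2 / 2)"
proof -
  have "char (density lborel (normal_density m \<sigma>)) t = (CLINT x|std_normal_distribution. iexp (t * (m + \<sigma> * x)))"
    unfolding normal_distr_std[OF assms] char_def by (subst integral_distr) auto
  also have "\<dots> = (CLINT x|std_normal_distribution. iexp (t * m) * iexp ((t * \<sigma>) * x))"
    by (simp add: algebra_simps exp_add)
  also have "\<dots> = iexp (t * m) * char std_normal_distribution (t * \<sigma>)"
    unfolding char_def by simp
  also have "char std_normal_distribution (t * \<sigma>) = exp (- complex_of_real (\<sigma>\<^sup>2 * t\<^sup>2 / 2))"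
    by (simp add: char_std_normal_distribution exp_of_real[symmetric] power_mult_distrib mult.commute)
  also have "iexp (t * m) * exp (- complex_of_real (\<sigma>\<^sup>2 * t\<^sup>2 / 2)) = exp (\<i> * (t * m) - \<sigma>\<^sup>2 * t\<^sup>2 / 2)"
    unfolding exp_add[symmetric] by simp
  finally show ?thesis .
qed

lemma gaussian_realI:
  assumes "real_distribution \<kappa>" "0 \<le> v" and eq: "\<And>t. char \<kappa> t = exp (\<i> * (t * m) - v * t\<^sup>2 / 2)"
  shows "gaussian_real \<kappa>"
proof (cases "v = 0")
  case True
  interpret r: prob_space "return borel m" by (rule prob_space_return) auto
  have "\<kappa> = return borel m"
    using assms True
    by (intro Levy_uniqueness ext)
       (auto simp: char_def integral_return real_distribution_def real_distribution_axioms_def r.prob_space_axioms)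
  then show ?thesis by (auto simp: gaussian_real_def)
next
  case False
  then have v: "0 < sqrt v" using assms(2) by simp
  have "\<kappa> = density lborel (normal_density m (sqrt v))"
    using assms v prob_space_normal_density[OF v]
    by (intro Levy_uniqueness ext)
       (auto simp: char_normal real_distribution_def real_distribution_axioms_def simp flip: of_real_power)
  then show ?thesis using v unfolding gaussian_real_def by blast
qed

lemma normal_moments:
  fixes m :: real
  assumes "0 < \<sigma>"
  defines "\<kappa> \<equiv> density lborel (normal_density m \<sigma>)"
  shows "integrable \<kappa> (\<lambda>x. x)" "(LINT x|\<kappa>. x) = m" "integrable \<kappa> (\<lambda>x. (x - m)\<^sup>2)" "(LINT x|\<kappa>. (x - m)\<^sup>2) = \<sigma>\<^sup>2"
proof -
  show "integrable \<kappa> (\<lambda>x. x)" "(LINT x|\<kappa>. x) = m"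
    unfolding \<kappa>_def using integrable_normal_moment_nz_1[OF assms(1)] integral_normal_moment_nz_1[OF assms(1)]
    by (auto simp: integrable_density integral_density)
  have "has_bochner_integral lborel (\<lambda>x. normal_density m \<sigma> x * (x - m)^(2 * 1)) (fact (2*1) / ((2 / \<sigma>\<^sup>2)^1 * fact 1))"
    by (rule normal_moment_even) fact
  then have "has_bochner_integral lborel (\<lambda>x. normal_density m \<sigma> x * (x - m)\<^sup>2) (\<sigma>\<^sup>2)"
    using assms by (simp)
  then show "integrable \<kappa> (\<lambda>x. (x - m)\<^sup>2)" "(LINT x|\<kappa>. (x - m)\<^sup>2) = \<sigma>\<^sup>2"
    unfolding \<kappa>_def 
    by (auto simp: integrable_density integral_density has_bochner_integral_iff)
qed

text \<open>Takes the mean and variance of the measure itself as parameters, so that point masses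
  and normal densities share one formula for the characteristic function.\<close>

lemma gaussian_real_moments:
  assumes "gaussian_real \<kappa>"
  defines "m \<equiv> (LINT x|\<kappa>. x)" and "v \<equiv> (LINT x|\<kappa>. (x - (LINT x|\<kappa>. x))\<^sup>2)"
  shows "real_distribution \<kappa>" "integrable \<kappa> (\<lambda>x. x)" "integrable \<kappa> (\<lambda>x. x\<^sup>2)"
    "0 \<le> v" "char \<kappa> t = exp (\<i> * (t * m) - v * t\<^sup>2 / 2)"
    "v = 0 \<Longrightarrow> \<kappa> = return borel m"
    "v > 0 \<Longrightarrow> \<kappa> = density lborel (normal_density m (sqrt v))"
proof -
  consider m' where "\<kappa> = return borel m'" | m' \<sigma> where "0 < \<sigma>" "\<kappa> = density lborel (normal_density m' \<sigma>)"
    using assms by (auto simp: gaussian_real_def)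
  then have "real_distribution \<kappa> \<and> integrable \<kappa> (\<lambda>x. x) \<and> integrable \<kappa> (\<lambda>x. x\<^sup>2) \<and>
     0 \<le> v \<and> char \<kappa> t = exp (\<i> * (t * m) - v * t\<^sup>2 / 2) \<and> (v = 0 \<longrightarrow> \<kappa> = return borel m) \<and>
     (v > 0 \<longrightarrow> \<kappa> = density lborel (normal_density m (sqrt v)))"
  proof cases
    case 1
    interpret r: prob_space "return borel m'" by (rule prob_space_return) auto
    have i: "integrable (return borel m') f" if "f \<in> borel_measurable borel" for f :: "real \<Rightarrow> real"
      using that by (simp add: integrable_iff_bounded nn_integral_return)
    have "m = m'" "v = 0" unfolding m_def v_def 1 by (auto simp: integral_return)
    moreover have "real_distribution \<kappa>"
      using r.prob_space_axioms by (simp add: real_distribution_def real_distribution_axioms_def 1)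
    moreover have "char \<kappa> t = iexp (t * m')"
      unfolding 1 char_def by (rule integral_return) auto
    moreover have "integrable \<kappa> (\<lambda>x. x)" "integrable \<kappa> (\<lambda>x. x\<^sup>2)"
      unfolding 1 by (rule i, simp)+
    ultimately show ?thesis by (simp add: 1)
  next
    case 2
    note mm = normal_moments[OF 2(1), of m', folded 2(2)]
    interpret p: prob_space \<kappa> unfolding 2 using 2(1) by (rule prob_space_normal_density)
    have m: "m = m'" and v: "v = \<sigma>\<^sup>2" unfolding m_def v_def using mm by auto
    have "integrable \<kappa> (\<lambda>x. (x - m')\<^sup>2 + (2 * m' * x - m'\<^sup>2))"
      using mm by (intro Bochner_Integration.integrable_add Bochner_Integration.integrable_diff integrable_mult_right) auto
    then have "integrable \<kappa> (\<lambda>x. x\<^sup>2)" by (simp add: power2_eq_square algebra_simps)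
    moreover have "real_distribution \<kappa>"
      using p.prob_space_axioms by (simp add: real_distribution_def real_distribution_axioms_def 2)
    moreover have "char \<kappa> t = exp (\<i> * (t * m) - v * t\<^sup>2 / 2)"
      using char_normal[OF 2(1), of m' t] unfolding m v 2 .
    moreover have "\<kappa> = density lborel (normal_density m (sqrt v))" "v \<noteq> 0"
      using 2 m v by simp_all
    ultimately show ?thesis using mm(1) v by simp
  qed
  then show "real_distribution \<kappa>" "integrable \<kappa> (\<lambda>x. x)" "integrable \<kappa> (\<lambda>x. x\<^sup>2)"
    "0 \<le> v" "char \<kappa> t = exp (\<i> * (t * m) - v * t\<^sup>2 / 2)"
    "v = 0 \<Longrightarrow> \<kappa> = return borel m"
    "v > 0 \<Longrightarrow> \<kappa> = density lborel (normal_density m (sqrt v))" by auto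
qed

section \<open>Characteristic functionals\<close>

text \<open>The weights \<open>2 + cos (W x)\<close> and \<open>2 + sin (W x)\<close> are positive,
  hence define finite measures, and together with the constant they recover the exponential of
  \<open>W\<close>. Euler's formulas involve only the frequencies -1, 0 and 1 of
  \<open>W\<close>.\<close>

lemma trig_weight_expand:
  fixes Y W g :: "'a \<Rightarrow> real"
  assumes "finite_measure M" and [measurable]: "Y \<in> borel_measurable M" "W \<in> borel_measurable M" "g \<in> borel_measurable M"
    and g: "\<And>x. 0 \<le> g x" "\<And>x. g x \<le> 1"
  defines "I \<equiv> \<lambda>t s. (CLINT x|M. complex_of_real (g x) * iexp (t * Y x + s * W x))"
  shows "(CLINT x|M. complex_of_real (g x * (2 + cos (W x))) * iexp (t * Y x)) = 2 * I t 0 + (I t 1 + I t (-1)) / 2"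
    and "(CLINT x|M. complex_of_real (g x * (2 + sin (W x))) * iexp (t * Y x)) = 2 * I t 0 + (- \<i> / 2) * (I t 1 - I t (-1))"
    and "(CLINT x|M. complex_of_real (g x) * iexp (t * Y x)) = I t 0"
proof -
  interpret finite_measure M by fact
  have i: "integrable M (\<lambda>x. complex_of_real (g x) * iexp (t * Y x + s * W x))" for s
    using g by (intro integrable_const_bound[of _ 1] AE_I2) (auto simp: norm_mult)
  have "(CLINT x|M. complex_of_real (g x * (2 + cos (W x))) * iexp (t * Y x)) =
    (CLINT x|M. 2 * (complex_of_real (g x) * iexp (t * Y x + 0 * W x)) + 
      ((complex_of_real (g x) * iexp (t * Y x + 1 * W x)) + complex_of_real (g x) * iexp (t * Y x + (-1) * W x)) / 2)"
    by (intro Bochner_Integration.integral_cong refl)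
       (simp add: complex_eq_iff Re_exp Im_exp cos_add cos_diff sin_add sin_diff field_simps)
  also have "\<dots> = 2 * I t 0 + (I t 1 + I t (-1)) / 2"
    unfolding I_def using i[of 0] i[of 1] i[of "-1"] by simp
  finally show "(CLINT x|M. complex_of_real (g x * (2 + cos (W x))) * iexp (t * Y x)) = 2 * I t 0 + (I t 1 + I t (-1)) / 2" .
  have "(CLINT x|M. complex_of_real (g x * (2 + sin (W x))) * iexp (t * Y x)) =
    (CLINT x|M. 2 * (complex_of_real (g x) * iexp (t * Y x + 0 * W x)) + 
      (- \<i> / 2) * ((complex_of_real (g x) * iexp (t * Y x + 1 * W x)) - complex_of_real (g x) * iexp (t * Y x + (-1) * W x)))"
    by (intro Bochner_Integration.integral_cong refl)
       (simp add: complex_eq_iff Re_exp Im_exp cos_add cos_diff sin_add sin_diff field_simps)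
  also have "\<dots> = 2 * I t 0 + (- \<i> / 2) * (I t 1 - I t (-1))"
    unfolding I_def using i[of 0] i[of 1] i[of "-1"] by simp
  finally show "(CLINT x|M. complex_of_real (g x * (2 + sin (W x))) * iexp (t * Y x)) = 2 * I t 0 + (- \<i> / 2) * (I t 1 - I t (-1))" .
  show "(CLINT x|M. complex_of_real (g x) * iexp (t * Y x)) = I t 0"
    unfolding I_def by simp
qed

lemma integral_weighted_distr:
  fixes Y g :: "'a \<Rightarrow> real" and u :: "real \<Rightarrow> complex"
  assumes [measurable]: "Y \<in> borel_measurable M" "g \<in> borel_measurable M" "u \<in> borel_measurable borel"
    and g: "\<And>x. 0 \<le> g x"
  shows "(CLINT y|distr (density M g) borel Y. u y) = (CLINT x|M. complex_of_real (g x) * u (Y x))"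
  using g by (simp add: integral_distr integral_density scaleR_conv_of_real)

text \<open>One-dimensional uniqueness under each of the three positive weights upgrades
  exponentials of \<open>Y\<close> to arbitrary Borel functions \<open>u\<close> of
  \<open>Y\<close>, while the exponential of \<open>W\<close> survives. Its survival allows the
  procedure to be repeated for the next coordinate.\<close>

lemma joint_char_determines:
  fixes Y W g :: "'a \<Rightarrow> real" and Y' W' g' :: "'b \<Rightarrow> real" and u :: "real \<Rightarrow> complex"
  assumes fM: "finite_measure M" and fN: "finite_measure N"
    and mM[measurable]: "Y \<in> borel_measurable M" "W \<in> borel_measurable M" "g \<in> borel_measurable M"
    and mN[measurable]: "Y' \<in> borel_measurable N" "W' \<in> borel_measurable N" "g' \<in> borel_measurable N"
    and g: "\<And>x. 0 \<le> g x" "\<And>x. g x \<le> 1" and g': "\<And>x. 0 \<le> g' x" "\<And>x. g' x \<le> 1"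
    and eq: "\<And>t s. s \<in> {-1, 0, 1} \<Longrightarrow> 
      (CLINT x|M. complex_of_real (g x) * iexp (t * Y x + s * W x)) =
      (CLINT x|N. complex_of_real (g' x) * iexp (t * Y' x + s * W' x))"
    and [measurable]: "u \<in> borel_measurable borel"
    and u: "integrable M (\<lambda>x. u (Y x))" "integrable N (\<lambda>x. u (Y' x))"
  shows "(CLINT x|M. complex_of_real (g x) * (u (Y x) * iexp (W x))) =
    (CLINT x|N. complex_of_real (g' x) * (u (Y' x) * iexp (W' x)))"
proof -
  interpret M: finite_measure M by fact
  interpret N: finite_measure N by fact
  have iM: "integrable M (\<lambda>x. w x * u (Y x))"
    if "w \<in> borel_measurable M" "\<And>x. norm (w x) \<le> 3" for w :: "'a \<Rightarrow> complex"
    using that(1) by (intro Bochner_Integration.integrable_bound[OF integrable_scaleR_right[OF u(1), of 3]])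
      (auto simp: norm_mult intro!: mult_right_mono that(2))
  have iN: "integrable N (\<lambda>x. w x * u (Y' x))"
    if "w \<in> borel_measurable N" "\<And>x. norm (w x) \<le> 3" for w :: "'b \<Rightarrow> complex"
    using that(1) by (intro Bochner_Integration.integrable_bound[OF integrable_scaleR_right[OF u(2), of 3]])
      (auto simp: norm_mult intro!: mult_right_mono that(2))
  have b: "\<bar>a * (2 + c)\<bar> \<le> 3" "0 \<le> a * (2 + c)" "\<bar>a * c\<bar> \<le> 3" "\<bar>a\<bar> \<le> 3" if "0 \<le> a" "a \<le> 1" "-1 \<le> c" "c \<le> 1" for a c :: real
  proof -
    show "0 \<le> a * (2 + c)" using that by simp
    have "a * (2 + c) \<le> 1 * 3" using that by (intro mult_mono) auto
    then show "\<bar>a * (2 + c)\<bar> \<le> 3" using \<open>0 \<le> a * (2 + c)\<close> by simp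
    have "\<bar>a\<bar> * \<bar>c\<bar> \<le> 1 * 1" using that by (intro mult_mono) auto
    then show "\<bar>a * c\<bar> \<le> 3" by (simp add: abs_mult)
    show "\<bar>a\<bar> \<le> 3" using that by simp
  qed
  have gb: "\<bar>g x * (2 + cos (W x))\<bar> \<le> 3" "0 \<le> g x * (2 + cos (W x))"
      "\<bar>g x * (2 + sin (W x))\<bar> \<le> 3" "0 \<le> g x * (2 + sin (W x))" "\<bar>g x\<bar> \<le> 3" for x
    by (rule b[where c = 0] b; simp add: g)+
  have gb': "\<bar>g' x * (2 + cos (W' x))\<bar> \<le> 3" "0 \<le> g' x * (2 + cos (W' x))"
      "\<bar>g' x * (2 + sin (W' x))\<bar> \<le> 3" "0 \<le> g' x * (2 + sin (W' x))" "\<bar>g' x\<bar> \<le> 3" for x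
    by (rule b[where c = 0] b; simp add: g')+
  have A: "(CLINT x|M. complex_of_real (w x) * u (Y x)) = (CLINT x|N. complex_of_real (w' x) * u (Y' x))"
    if [measurable]: "w \<in> borel_measurable M" "w' \<in> borel_measurable N"
      and w: "\<And>x. 0 \<le> w x" "\<And>x. \<bar>w x\<bar> \<le> 3" "\<And>x. 0 \<le> w' x" "\<And>x. \<bar>w' x\<bar> \<le> 3"
      and e: "\<And>t. (CLINT x|M. complex_of_real (w x) * iexp (t * Y x)) = (CLINT x|N. complex_of_real (w' x) * iexp (t * Y' x))" for w w'
  proof -
    have "distr (density M w) borel Y = distr (density N w') borel Y'"
      using w by (intro weighted_distr_unique e M.integrable_const_bound[of _ 3] N.integrable_const_bound[of _ 3]) auto
    then show ?thesis
      using integral_weighted_distr[of Y M w u] integral_weighted_distr[of Y' N w' u] w by simp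
  qed
  note ex = trig_weight_expand[OF fM mM g] trig_weight_expand[OF fN mN g']
  have A0: "(CLINT x|M. complex_of_real (g x) * u (Y x)) = (CLINT x|N. complex_of_real (g' x) * u (Y' x))"
  proof (rule A)
    show "(CLINT x|M. complex_of_real (g x) * iexp (t * Y x)) = (CLINT x|N. complex_of_real (g' x) * iexp (t * Y' x))" for t
      unfolding ex using eq[of 0 t] by simp
  qed (use g g' order_trans[OF g(2), of 3] order_trans[OF g'(2), of 3] in simp_all)
  have Ac: "(CLINT x|M. complex_of_real (g x * (2 + cos (W x))) * u (Y x)) = (CLINT x|N. complex_of_real (g' x * (2 + cos (W' x))) * u (Y' x))"
  proof (rule A[OF _ _ gb(2) gb(1) gb'(2) gb'(1)])
    show "(CLINT x|M. complex_of_real (g x * (2 + cos (W x))) * iexp (t * Y x)) = (CLINT x|N. complex_of_real (g' x * (2 + cos (W' x))) * iexp (t * Y' x))" for t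
      unfolding ex using eq[of 0 t] eq[of 1 t] eq[of "-1" t] by simp
  qed measurable
  have As: "(CLINT x|M. complex_of_real (g x * (2 + sin (W x))) * u (Y x)) = (CLINT x|N. complex_of_real (g' x * (2 + sin (W' x))) * u (Y' x))"
  proof (rule A[OF _ _ gb(4) gb(3) gb'(4) gb'(3)])
    show "(CLINT x|M. complex_of_real (g x * (2 + sin (W x))) * iexp (t * Y x)) = (CLINT x|N. complex_of_real (g' x * (2 + sin (W' x))) * iexp (t * Y' x))" for t
      unfolding ex using eq[of 0 t] eq[of 1 t] eq[of "-1" t] by simp
  qed measurable
  \<comment> \<open>Here exp(iW) is written as (2 + cos W) + i (2 + sin W) - (2 + 2i), a combination
    of the three weights already treated.\<close>
  have m: "(CLINT x|M. complex_of_real (g x) * (u (Y x) * iexp (W x))) =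
     (CLINT x|M. complex_of_real (g x * (2 + cos (W x))) * u (Y x)) 
     + \<i> * (CLINT x|M. complex_of_real (g x * (2 + sin (W x))) * u (Y x)) 
     - (2 + 2 * \<i>) * (CLINT x|M. complex_of_real (g x) * u (Y x))"
  proof -
    have [simp]: "integrable M (\<lambda>x. complex_of_real (g x * (2 + cos (W x))) * u (Y x))"
      "integrable M (\<lambda>x. complex_of_real (g x * (2 + sin (W x))) * u (Y x))"
      "integrable M (\<lambda>x. complex_of_real (g x) * u (Y x))"
      by (rule iM, measurable, simp only: norm_of_real gb)+
    have "(CLINT x|M. complex_of_real (g x) * (u (Y x) * iexp (W x))) =
      (CLINT x|M. complex_of_real (g x * (2 + cos (W x))) * u (Y x) 
     + \<i> * (complex_of_real (g x * (2 + sin (W x))) * u (Y x))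
     - (2 + 2 * \<i>) * (complex_of_real (g x) * u (Y x)))"
      by (intro Bochner_Integration.integral_cong refl)
       (simp add: complex_eq_iff Re_exp Im_exp algebra_simps)
    then show ?thesis by (simp del: of_real_mult of_real_add)
  qed
  have n: "(CLINT x|N. complex_of_real (g' x) * (u (Y' x) * iexp (W' x))) =
     (CLINT x|N. complex_of_real (g' x * (2 + cos (W' x))) * u (Y' x)) 
     + \<i> * (CLINT x|N. complex_of_real (g' x * (2 + sin (W' x))) * u (Y' x)) 
     - (2 + 2 * \<i>) * (CLINT x|N. complex_of_real (g' x) * u (Y' x))"
  proof -
    have [simp]: "integrable N (\<lambda>x. complex_of_real (g' x * (2 + cos (W' x))) * u (Y' x))"
      "integrable N (\<lambda>x. complex_of_real (g' x * (2 + sin (W' x))) * u (Y' x))"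
      "integrable N (\<lambda>x. complex_of_real (g' x) * u (Y' x))"
      by (rule iN, measurable, simp only: norm_of_real gb')+
    have "(CLINT x|N. complex_of_real (g' x) * (u (Y' x) * iexp (W' x))) =
      (CLINT x|N. complex_of_real (g' x * (2 + cos (W' x))) * u (Y' x) 
     + \<i> * (complex_of_real (g' x * (2 + sin (W' x))) * u (Y' x))
     - (2 + 2 * \<i>) * (complex_of_real (g' x) * u (Y' x)))"
      by (intro Bochner_Integration.integral_cong refl)
       (simp add: complex_eq_iff Re_exp Im_exp algebra_simps)
    then show ?thesis by (simp del: of_real_mult of_real_add)
  qed
  show ?thesis unfolding m n A0 Ac As ..
qed

section \<open>Cylinder sets, the Borel sigma-algebra and uniqueness of laws\<close>

definition cylinder :: "('h::{real_inner, polish_space} \<times> real set) list \<Rightarrow> 'h set" where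
  "cylinder l = {x. \<forall>(h, A)\<in>set l. x \<bullet> h \<in> A}"

lemma cylinder_simps: "cylinder [] = UNIV" "cylinder ((h, A) # l) = (\<lambda>x. x \<bullet> h) -` A \<inter> cylinder l"
  "cylinder (l @ l') = cylinder l \<inter> cylinder l'"
  by (auto simp: cylinder_def)

lemma cylinder_borel: "(\<And>h A. (h, A) \<in> set l \<Longrightarrow> A \<in> sets borel) \<Longrightarrow> cylinder l \<in> sets borel"
proof (induction l)
  case (Cons a l)
  obtain h A where a: "a = (h, A)" by (cases a)
  have [measurable]: "A \<in> sets borel" using Cons.prems[of h A] a by simp
  have "(\<lambda>x. x \<bullet> h) -` A \<inter> space borel \<in> sets borel"
    by measurable
  then show ?case using Cons by (auto simp: a cylinder_simps)
qed (simp add: cylinder_simps)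

text \<open>A closed ball is the intersection of the half-spaces containing it. A dense set of
  normals suffices: the normals strictly separating a given outside point from the ball form a
  nonempty open set.\<close>

lemma cball_inner_dense:
  fixes d :: "'h::real_inner"
  assumes D: "\<And>U. open U \<Longrightarrow> U \<noteq> {} \<Longrightarrow> \<exists>h\<in>D. h \<in> U" and r: "0 \<le> r"
  shows "cball d r = (\<Inter>h\<in>D. {x. x \<bullet> h \<le> d \<bullet> h + r * norm h})"
proof (intro equalityI subsetI)
  fix x assume "x \<in> cball d r"
  then have "norm (x - d) \<le> r" by (simp add: dist_norm norm_minus_commute)
  then have "(x - d) \<bullet> h \<le> r * norm h" for h
    using norm_cauchy_schwarz[of "x - d" h] mult_right_mono[of "norm (x - d)" r "norm h"] by simp
  then show "x \<in> (\<Inter>h\<in>D. {x. x \<bullet> h \<le> d \<bullet> h + r * norm h})" by (simp add: inner_diff_left algebra_simps)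
next
  fix x assume x: "x \<in> (\<Inter>h\<in>D. {x. x \<bullet> h \<le> d \<bullet> h + r * norm h})"
  show "x \<in> cball d r"
  proof (rule ccontr)
    let ?y = "x - d" and ?U = "{h. r * norm h < (x - d) \<bullet> h}"
    assume "x \<notin> cball d r"
    then have "r < norm ?y" by (simp add: dist_norm norm_minus_commute)
    then have "r * norm ?y < norm ?y * norm ?y" using r by (intro mult_strict_right_mono) auto
    then have "?y \<in> ?U" by (simp add: power2_eq_square flip: power2_norm_eq_inner)
    moreover have "open ?U" by (intro open_Collect_less continuous_intros)
    ultimately obtain h where "h \<in> D" "h \<in> ?U" using D by blast
    then show False using x by (auto simp: inner_diff_left algebra_simps)
  qed
qed

text \<open>Half-spaces with normals in a countable dense set give the closed balls, and countably
  many closed balls exhaust each open set.\<close>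

lemma borel_eq_sigma_cylinder:
  "sets (borel :: 'h::{real_inner, polish_space} measure) =
     sigma_sets UNIV {cylinder l | l. \<forall>(h, A)\<in>set l. A \<in> sets borel}"
    (is "_ = sigma_sets UNIV ?G")
proof
  let ?M = "sigma UNIV ?G"
  have M: "sets ?M = sigma_sets UNIV ?G" by simp
  obtain D :: "'h set" where D: "countable D" "\<And>U. open U \<Longrightarrow> U \<noteq> {} \<Longrightarrow> \<exists>h\<in>D. h \<in> U"
    using countable_dense_exists by blast
  have D_ne: "D \<noteq> {}" using D(2)[of UNIV] by auto
  have hs: "{x. x \<bullet> h \<le> c} \<in> sets ?M" for h c
  proof -
    have "{x. x \<bullet> h \<le> c} = cylinder [(h, {..c})]" by (auto simp: cylinder_simps)
    then show ?thesis unfolding M by (intro sigma_sets.Basic) auto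
  qed
  have cb: "cball d r \<in> sets ?M" if "0 \<le> r" for d r
  proof -
    have "cball d r = (\<Inter>h\<in>D. {x. x \<bullet> h \<le> d \<bullet> h + r * norm h})"
      by (rule cball_inner_dense) (fact D(2), fact that)
    also have "\<dots> \<in> sets ?M"
      by (intro sets.countable_INT' D(1) D_ne) (use hs in blast)
    finally show ?thesis .
  qed
  have "U \<in> sets ?M" if U: "open U" for U
  proof -
    let ?I = "{(d, r). d \<in> D \<and> r \<in> \<rat> \<and> 0 \<le> r \<and> cball d r \<subseteq> U}"
    have "?I \<subseteq> D \<times> \<rat>" by auto
    then have c: "countable ?I" by (rule countable_subset) (intro countable_SIGMA D(1) countable_rat)
    have "U = (\<Union>(d, r)\<in>?I. cball d r)"
    proof (intro equalityI subsetI)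
      fix x assume "x \<in> U"
      then obtain e where e: "0 < e" "ball x e \<subseteq> U" using U by (auto simp: open_contains_ball)
      \<comment> \<open>A radius above e/4 makes the ball about a point \<open>d\<close> within e/4
        of \<open>x\<close> contain \<open>x\<close>; a radius below e/2 keeps that ball inside
        \<open>ball x e\<close>.\<close>
      obtain r where r: "r \<in> \<rat>" "e / 4 < r" "r < e / 2" using Rats_dense_in_real[of "e/4" "e/2"] e by auto
      obtain d where d: "d \<in> D" "d \<in> ball x (e / 4)" using D(2)[of "ball x (e / 4)"] e by auto
      have "cball d r \<subseteq> ball x e"
      proof
        fix y assume "y \<in> cball d r"
        then show "y \<in> ball x e" using dist_triangle[of x y d] d r by simp
      qed
      then show "x \<in> (\<Union>(d, r)\<in>?I. cball d r)"
        using d r e by (intro UN_I[of "(d, r)"]) (auto simp: dist_commute)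
    qed auto
    also have "\<dots> \<in> sets ?M" by (rule sets.countable_UN'[OF c]) (use cb in fast)
    finally show ?thesis .
  qed
  then have "sigma_sets (space ?M) (Collect open) \<subseteq> sets ?M"
    by (intro sets.sigma_sets_subset subsetI) simp
  moreover have "sets (borel :: 'h measure) = sigma_sets UNIV (Collect open)"
    by (simp add: borel_def)
  ultimately show "sets (borel :: 'h measure) \<subseteq> sigma_sets UNIV ?G"
    unfolding M[symmetric] by simp
  have "?G \<subseteq> sets borel"
    by (auto intro: cylinder_borel)
  then show "sigma_sets UNIV ?G \<subseteq> sets borel"
    using sets.sigma_sets_subset[of ?G borel] by simp
qed

definition char_functional :: "'h::real_inner measure \<Rightarrow> 'h \<Rightarrow> complex" where
  "char_functional M h = (CLINT x|M. iexp (x \<bullet> h))"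

text \<open>Coordinates are fixed one at a time, so that one-dimensional uniqueness suffices.\<close>

theorem char_functional_unique:
  fixes M N :: "'h::{real_inner, polish_space} measure"
  assumes fM: "finite_measure M" and fN: "finite_measure N"
    and sM: "sets M = sets borel" and sN: "sets N = sets borel"
    and eq: "\<And>h. char_functional M h = char_functional N h"
  shows "M = N"
proof -
  interpret M: finite_measure M by fact
  interpret N: finite_measure N by fact
  note [measurable_cong] = sM sN
  have spM: "space M = UNIV" and spN: "space N = UNIV"
    using sets_eq_imp_space_eq[OF sM] sets_eq_imp_space_eq[OF sN] by auto
  have cyl: "(CLINT x|M. complex_of_real (indicator (cylinder l) x) * iexp (x \<bullet> k)) =
         (CLINT x|N. complex_of_real (indicator (cylinder l) x) * iexp (x \<bullet> k))"
    if "\<forall>(h, A)\<in>set l. A \<in> sets borel" for l k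
    using that
  proof (induction l arbitrary: k)
    case Nil
    then show ?case using eq[of k] by (simp add: char_functional_def cylinder_simps)
  next
    case (Cons a l)
    obtain h A where a: "a = (h, A)" by (cases a)
    have [measurable]: "A \<in> sets borel" using Cons a by simp
    have [measurable]: "cylinder l \<in> sets borel" using Cons by (auto intro!: cylinder_borel)
    have *: "complex_of_real (indicator (cylinder l) x) * (indicator A (x \<bullet> h) * iexp (x \<bullet> k)) = 
       complex_of_real (indicator (cylinder (a # l)) x) * iexp (x \<bullet> k)" for x
      by (auto simp: a cylinder_simps indicator_def)
    have "(CLINT x|M. complex_of_real (indicator (cylinder l) x) * (indicator A (x \<bullet> h) * iexp (x \<bullet> k))) =
         (CLINT x|N. complex_of_real (indicator (cylinder l) x) * (indicator A (x \<bullet> h) * iexp (x \<bullet> k)))"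
    \<comment> \<open>The newest constraint acts as the test function \<open>u\<close>, the older
      ones stay in the weight. The two functionals merge into the direction
      \<open>t *\<^sub>R h + s *\<^sub>R k\<close>, at which the induction hypothesis is available
      because \<open>k\<close> is arbitrary.\<close>
    proof (rule joint_char_determines[OF fM fN])
      show "(CLINT x|M. complex_of_real (indicator (cylinder l) x) * iexp (t * (x \<bullet> h) + s * (x \<bullet> k))) =
           (CLINT x|N. complex_of_real (indicator (cylinder l) x) * iexp (t * (x \<bullet> h) + s * (x \<bullet> k)))" for s t
        using Cons.IH[of "t *\<^sub>R h + s *\<^sub>R k"] Cons.prems by (simp add: inner_add_right)
      show "integrable M (\<lambda>x. indicator A (x \<bullet> h) :: complex)"
        by (intro M.integrable_const_bound[of _ 1]) (auto simp: indicator_def)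
      show "integrable N (\<lambda>x. indicator A (x \<bullet> h) :: complex)"
        by (intro N.integrable_const_bound[of _ 1]) (auto simp: indicator_def)
    qed auto
    then show ?case unfolding * .
  qed
  show ?thesis
  proof (rule measure_eqI_generator_eq)
    let ?G = "{cylinder l | l. \<forall>(h::'h, A)\<in>set l. A \<in> sets borel}"
    show "Int_stable ?G"
    proof (rule Int_stableI)
      fix a b assume "a \<in> ?G" "b \<in> ?G"
      then obtain l l' where l: "a = cylinder l" "\<forall>(h, A)\<in>set l. A \<in> sets borel" "b = cylinder l'" "\<forall>(h, A)\<in>set l'. A \<in> sets borel"
        by blast
      show "a \<inter> b \<in> ?G" 
        unfolding l cylinder_simps(3)[symmetric] by (rule CollectI, rule exI[of _ "l @ l'"]) (use l in auto)
    qed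
    show "sets M = sigma_sets UNIV ?G" "sets N = sigma_sets UNIV ?G"
      unfolding sM sN by (rule borel_eq_sigma_cylinder)+
    show "emeasure M X = emeasure N X" if X: "X \<in> ?G" for X
    proof -
      obtain l where l: "X = cylinder l" "\<forall>(h, A)\<in>set l. A \<in> sets borel" using X by blast
      have [measurable]: "X \<in> sets borel" unfolding l by (intro cylinder_borel) (use l in auto)
      have "complex_of_real (measure M X) = complex_of_real (measure N X)"
        using cyl[OF l(2), of 0] by (simp flip: l(1) add: spM spN)
      then show ?thesis by (simp add: M.emeasure_eq_measure N.emeasure_eq_measure)
    qed
    show "range (\<lambda>_::nat. UNIV) \<subseteq> ?G"
    proof -
      have "(UNIV :: 'h set) = cylinder []" by (simp add: cylinder_simps)
      then show ?thesis by force
    qed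
    show "emeasure M UNIV \<noteq> \<infinity>" by simp
  qed auto
qed

section \<open>Gaussian measures on Hilbert space\<close>

locale psd_form =
  fixes b :: "'a::real_vector \<Rightarrow> 'a \<Rightarrow> real"
  assumes sym: "b x y = b y x"
    and add: "b (x + y) z = b x z + b y z"
    and scale: "b (c *\<^sub>R x) z = c * b x z"
    and nonneg: "0 \<le> b x x"
begin

lemma add2: "b z (x + y) = b z x + b z y"
  using add[of x y z] by (simp add: sym)

lemma scale2: "b z (c *\<^sub>R x) = c * b z x"
  using scale[of c x z] by (simp add: sym)

lemma expand: "b (x + t *\<^sub>R y) (x + t *\<^sub>R y) = b x x + 2 * t * b x y + t\<^sup>2 * b y y"
  by (simp add: add add2 scale scale2 sym[of y x] power2_eq_square algebra_simps)

lemma cauchy_schwarz: "(b x y)\<^sup>2 \<le> b x x * b y y"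
proof (cases "b y y = 0")
  case True
  have "b x y = 0"
  proof (rule ccontr)
    assume "b x y \<noteq> 0"
    \<comment> \<open>With this multiple of \<open>y\<close> the form takes the value -1.\<close>
    with nonneg[of "x + (- (b x x + 1) / (2 * b x y)) *\<^sub>R y"] show False
      unfolding expand True by (simp add: field_simps)
  qed
  then show ?thesis using nonneg[of x] nonneg[of y] by simp
next
  case False
  then have "0 < b y y" using nonneg[of y] by simp
  moreover have "0 \<le> b x x + 2 * (- b x y / b y y) * b x y + (- b x y / b y y)\<^sup>2 * b y y"
    using nonneg[of "x + (- b x y / b y y) *\<^sub>R y"] unfolding expand .
  ultimately show ?thesis by (simp add: field_simps power2_eq_square)
qed

lemma null: "b y y = 0 \<Longrightarrow> b x y = 0"
  using cauchy_schwarz[of x y] by simp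

text \<open>Take a near-minimiser of \<open>k \<mapsto> b k k / 2 - l k\<close>.\<close>

lemma approximate_representation:
  assumes l_add: "\<And>x y. l (x + y) = l x + l y" and l_scale: "\<And>c x. l (c *\<^sub>R x) = c * l x"
    and bound: "\<And>x. (l x)\<^sup>2 \<le> c * b x x" and c: "0 \<le> c" and e: "0 < e"
  shows "\<exists>k. b k k \<le> 4 * c + 2 * e \<and> (\<forall>y. (b k y - l y)\<^sup>2 \<le> e * b y y)"
proof -
  define J where "J k = b k k / 2 - l k" for k
  \<comment> \<open>The arithmetic-geometric mean inequality applied to
    \<open>sqrt (c * b k k)\<close>. With d = 1 it bounds \<open>J\<close> from below and, at the
    near-minimiser, bounds \<open>b k k\<close>.\<close>
  have lb: "l k \<le> c / d + d * b k k / 4" if "0 < d" for k d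
  proof (rule power2_le_imp_le)
    have "0 \<le> (c / d - d * b k k / 4)\<^sup>2" by simp
    then have "c * b k k \<le> (c / d + d * b k k / 4)\<^sup>2"
      using that by (simp add: power2_eq_square field_simps)
    then show "(l k)\<^sup>2 \<le> (c / d + d * b k k / 4)\<^sup>2" using bound[of k] by linarith
    show "0 \<le> c / d + d * b k k / 4" using c nonneg[of k] that by simp
  qed
  have "J k \<ge> - c" for k
    using lb[of 1 k] nonneg[of k] unfolding J_def by simp
  then have bdd: "bdd_below (range J)" by (auto intro!: bdd_belowI)
  have "\<exists>x\<in>range J. x < Inf (range J) + e / 2"
    using cInf_lessD[of "range J" "Inf (range J) + e / 2"] e by auto
  then obtain k where k: "J k < Inf (range J) + e / 2" by auto
  have min: "J k - e / 2 < J y" for y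
    using cINF_lower[OF bdd, of y] k by simp
  have "l 0 = 0" using l_scale[of 0 0] by simp
  moreover have "b 0 0 = 0" using scale[of 0 0 0] by simp
  ultimately have "b k k / 2 - l k - e / 2 < 0" using min[of 0] by (simp add: J_def)
  then have "b k k \<le> 4 * c + 2 * e" using lb[of 1 k] by simp
  moreover have "(b k y - l y)\<^sup>2 \<le> e * b y y" for y
  proof -
    \<comment> \<open>Moving the near-minimiser by \<open>t *\<^sub>R y\<close> lowers
      \<open>J\<close> by less than e/2. The sharpest consequence comes from the vertex t = -d / b y
      y of this quadratic.\<close>
    have quad: "0 \<le> e / 2 + t * (b k y - l y) + t\<^sup>2 * b y y / 2" for t
      using min[of "k + t *\<^sub>R y"] by (simp add: J_def expand l_add l_scale field_simps)
    show ?thesis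
    proof (cases "b y y = 0")
      case True
      then show ?thesis using null[OF True, of k] bound[of y] by simp
    next
      case False
      then have "0 < b y y" using nonneg[of y] by simp
      moreover define d where "d = b k y - l y"
      ultimately have "e / 2 + (- d / b y y) * d + (- d / b y y)\<^sup>2 * b y y / 2 = e / 2 - d\<^sup>2 / (2 * b y y)"
        by (simp add: field_simps power2_eq_square)
      then have "d\<^sup>2 / (2 * b y y) \<le> e / 2" using quad[of "- d / b y y"] by (simp add: d_def)
      then show ?thesis using \<open>0 < b y y\<close> by (simp add: d_def field_simps)
    qed
  qed
  ultimately show ?thesis by blast
qed

end

lemma psd_form_inner: "psd_form (inner :: 'a::real_inner \<Rightarrow> 'a \<Rightarrow> real)"
  by standard (simp_all add: inner_commute inner_add_right)

text \<open>Approximate representers with error 1/(n+1) form a Cauchy sequence: their differences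
  are small when tested against themselves. Completeness supplies the vector.\<close>

lemma riesz_representation:
  fixes l :: "'a::{real_inner, complete_space} \<Rightarrow> real"
  assumes l_add: "\<And>x y. l (x + y) = l x + l y" and l_scale: "\<And>c x. l (c *\<^sub>R x) = c * l x"
    and bound: "\<And>x. \<bar>l x\<bar> \<le> c * norm x"
  shows "\<exists>m. \<forall>x. l x = m \<bullet> x"
proof -
  interpret psd_form "inner :: 'a \<Rightarrow> _" by (rule psd_form_inner)
  have b2: "(l x)\<^sup>2 \<le> c\<^sup>2 * (x \<bullet> x)" for x
    using power_mono[OF bound[of x], of 2] by (simp add: power_mult_distrib power2_norm_eq_inner)
  have "\<exists>k. \<forall>y. (k \<bullet> y - l y)\<^sup>2 \<le> (1 / real (Suc n))\<^sup>2 * (y \<bullet> y)" for n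
    using approximate_representation[of l "c\<^sup>2" "(1 / real (Suc n))\<^sup>2"] l_add l_scale b2 by auto
  then obtain k where "\<And>n y. (k n \<bullet> y - l y)\<^sup>2 \<le> (1 / real (Suc n))\<^sup>2 * (y \<bullet> y)" by metis
  then have "(k n \<bullet> y - l y)\<^sup>2 \<le> (norm y / real (Suc n))\<^sup>2" for n y
    by (simp add: power_divide power2_norm_eq_inner)
  from abs_le_square_iff[THEN iffD2, OF this]
  have k: "\<bar>k n \<bullet> y - l y\<bar> \<le> norm y / real (Suc n)" for n y by simp
  have kd: "norm (k n - k m) \<le> 1 / real (Suc n) + 1 / real (Suc m)" for n m
  proof (cases "k n = k m")
    case False
    let ?y = "k n - k m"
    have "norm ?y * norm ?y = (k n \<bullet> ?y - l ?y) - (k m \<bullet> ?y - l ?y)"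
      by (simp add: inner_diff_left flip: power2_eq_square power2_norm_eq_inner)
         (simp add: power2_norm_eq_inner inner_diff_left)
    also have "\<dots> \<le> norm ?y * (1 / real (Suc n) + 1 / real (Suc m))"
      using k[of n ?y] k[of m ?y] by (simp add: distrib_left)
    finally show ?thesis using False by (simp add: mult_le_cancel_left)
  qed simp
  have "Cauchy k"
  proof (rule metric_CauchyI)
    fix e :: real assume e: "0 < e"
    then obtain N where N: "1 / real (Suc N) < e / 2" using nat_approx_posE[of "e/2"] by auto
    have "dist (k n) (k m) < e" if "N \<le> n" "N \<le> m" for n m
    proof -
      have "1 / real (Suc n) \<le> 1 / real (Suc N)" "1 / real (Suc m) \<le> 1 / real (Suc N)"
        using that by (auto simp: frac_le)
      then show ?thesis using kd[of n m] N unfolding dist_norm by linarith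
    qed
    then show "\<exists>M. \<forall>m\<ge>M. \<forall>n\<ge>M. dist (k m) (k n) < e" by blast
  qed
  then obtain m where m: "k \<longlonglongrightarrow> m" using Cauchy_convergent convergent_def by blast
  have "l y = m \<bullet> y" for y
  proof (rule LIMSEQ_unique)
    show "(\<lambda>n. k n \<bullet> y) \<longlonglongrightarrow> m \<bullet> y" using m by (intro tendsto_intros)
    have "(\<lambda>n. norm y * (1 / real (Suc n))) \<longlonglongrightarrow> norm y * 0"
      by (intro tendsto_mult tendsto_const LIMSEQ_inverse_real_of_nat[unfolded inverse_eq_divide])
    then have "(\<lambda>n. norm y / real (Suc n)) \<longlonglongrightarrow> 0" by simp
    then have "(\<lambda>n. k n \<bullet> y - l y) \<longlonglongrightarrow> 0"
      by (rule Lim_null_comparison[rotated]) (use k in auto)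
    then show "(\<lambda>n. k n \<bullet> y) \<longlonglongrightarrow> l y" using LIM_zero_iff by blast
  qed
  then show ?thesis by blast
qed

section \<open>Means, covariances and exponential tilts\<close>

definition gmean :: "'h::real_inner measure \<Rightarrow> 'h \<Rightarrow> real" where
  "gmean \<nu> h = (LINT x|\<nu>. x \<bullet> h)"

text \<open>Mean and covariance are kept as forms, not as a vector and an operator:
  \<open>gaussian\<close> speaks only of single functionals, and the existence of a mean vector is a
  separate question, treated in \<open>has_mean_if_bounded_covariance\<close>.\<close>

definition gcov :: "'h::real_inner measure \<Rightarrow> 'h \<Rightarrow> 'h \<Rightarrow> real" where
  "gcov \<nu> h k = (LINT x|\<nu>. (x \<bullet> h - gmean \<nu> h) * (x \<bullet> k - gmean \<nu> k))"

text \<open>The Cameron-Martin density in the direction \<open>k\<close>, normalised by the Laplace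
  transform of the Gaussian functional.\<close>

definition tilt :: "'h::real_inner measure \<Rightarrow> 'h \<Rightarrow> 'h measure" where
  "tilt \<nu> k = density \<nu> (\<lambda>x. ennreal (exp (x \<bullet> k - gmean \<nu> k - gcov \<nu> k k / 2)))"

lemma gaussian_real_exp:
  assumes "gaussian_real \<kappa>"
  defines "m \<equiv> (LINT x|\<kappa>. x)" and "v \<equiv> (LINT x|\<kappa>. (x - (LINT x|\<kappa>. x))\<^sup>2)"
  shows "integrable \<kappa> (\<lambda>y. exp (s * y))"
    and "(CLINT y|\<kappa>. complex_of_real (exp (s * y)) * iexp (t * y)) =
      complex_of_real (exp (s * m + s\<^sup>2 * v / 2)) * exp (\<i> * (t * (m + s * v)) - v * t\<^sup>2 / 2)"
proof -
  note gm = gaussian_real_moments[OF assms(1), folded v_def, folded m_def]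
  have "integrable \<kappa> (\<lambda>y. exp (s * y)) \<and> (CLINT y|\<kappa>. complex_of_real (exp (s * y)) * iexp (t * y)) =
      complex_of_real (exp (s * m + s\<^sup>2 * v / 2)) * exp (\<i> * (t * (m + s * v)) - v * t\<^sup>2 / 2)"
  proof (cases "v = 0")
    case True
    have "(CLINT y|\<kappa>. complex_of_real (exp (s * y)) * iexp (t * y)) = complex_of_real (exp (s * m)) * iexp (t * m)"
      unfolding gm(6)[OF True] by (rule integral_return) auto
    then show ?thesis using True
      by (auto simp: gm(6) integrable_iff_bounded nn_integral_return)
  next
    case False
    then have v: "0 < v" "0 < sqrt v" using gm(4) by auto
    have kap: "\<kappa> = density lborel (normal_density m (sqrt v))" using gm(7)[OF v(1)] .
    \<comment> \<open>Completing the square: the exponential weight moves the mean by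
      \<open>s * v\<close>, keeps the variance and produces the Laplace transform as a
      factor.\<close>
    have e: "normal_density m (sqrt v) y * exp (s * y) = exp (s * m + s\<^sup>2 * v / 2) * normal_density (m + s * v) (sqrt v) y" for y
    proof -
      have "- (y - m)\<^sup>2 / (2 * v) + s * y = (s * m + s\<^sup>2 * v / 2) - (y - (m + s * v))\<^sup>2 / (2 * v)"
        using v by (simp add: field_simps power2_eq_square)
      then have "exp (- (y - m)\<^sup>2 / (2 * v)) * exp (s * y) = exp (s * m + s\<^sup>2 * v / 2) * exp (- (y - (m + s * v))\<^sup>2 / (2 * v))"
        by (simp flip: exp_add)
      then show ?thesis using v unfolding normal_density_def by simp
    qed
    have int: "integrable \<kappa> (\<lambda>y. exp (s * y))"
      unfolding kap using v by (subst integrable_density) (auto simp: e)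
    have "(CLINT y|\<kappa>. complex_of_real (exp (s * y)) * iexp (t * y)) = 
       (CLINT y|lborel. complex_of_real (normal_density m (sqrt v) y * exp (s * y)) * iexp (t * y))"
      unfolding kap by (subst integral_density) (auto simp: scaleR_conv_of_real mult.assoc)
    also have "\<dots> = (CLINT y|lborel. complex_of_real (exp (s * m + s\<^sup>2 * v / 2)) * 
         (complex_of_real (normal_density (m + s * v) (sqrt v) y) * iexp (t * y)))"
      unfolding e by (simp add: mult.assoc)
    also have "\<dots> = complex_of_real (exp (s * m + s\<^sup>2 * v / 2)) * 
         (CLINT y|lborel. complex_of_real (normal_density (m + s * v) (sqrt v) y) * iexp (t * y))"
      by simp
    also have "(CLINT y|lborel. complex_of_real (normal_density (m + s * v) (sqrt v) y) * iexp (t * y)) =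
       char (density lborel (normal_density (m + s * v) (sqrt v))) t"
      unfolding char_def by (subst integral_density) (auto simp: scaleR_conv_of_real)
    also have "\<dots> = exp (\<i> * (t * (m + s * v)) - v * t\<^sup>2 / 2)"
      using char_normal[OF v(2), of "m + s * v" t] v by simp
    finally show ?thesis using int by blast
  qed
  then show "integrable \<kappa> (\<lambda>y. exp (s * y))"
    and "(CLINT y|\<kappa>. complex_of_real (exp (s * y)) * iexp (t * y)) =
      complex_of_real (exp (s * m + s\<^sup>2 * v / 2)) * exp (\<i> * (t * (m + s * v)) - v * t\<^sup>2 / 2)" by auto
qed

locale gaussian_measure = prob_space \<nu> for \<nu> :: "'h::{real_inner, polish_space} measure" +
  assumes gaussian: "gaussian \<nu>"
begin

lemma sets_eq [measurable_cong, simp]: "sets \<nu> = sets borel"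
  using gaussian by (simp add: gaussian_def)

lemma space_eq [simp]: "space \<nu> = UNIV"
  using sets_eq_imp_space_eq[OF sets_eq] by simp

definition marginal :: "'h \<Rightarrow> real measure" where
  "marginal h = distr \<nu> borel (\<lambda>x. x \<bullet> h)"

lemma gaussian_marginal: "gaussian_real (marginal h)"
  using gaussian bounded_linear_inner_left[of h] unfolding gaussian_def marginal_def by blast

lemma marginal_mean: "(LINT y|marginal h. y) = gmean \<nu> h"
  unfolding marginal_def gmean_def by (subst integral_distr) auto

lemma marginal_var: "(LINT y|marginal h. (y - (LINT y|marginal h. y))\<^sup>2) = gcov \<nu> h h"
  unfolding marginal_mean unfolding marginal_def gcov_def by (subst integral_distr) (auto simp: power2_eq_square)

lemmas marginal = gaussian_real_moments[OF gaussian_marginal, unfolded marginal_var, unfolded marginal_mean]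

lemma integrable_inner: "integrable \<nu> (\<lambda>x. x \<bullet> h)"
  using marginal(2)[of h] unfolding marginal_def by (subst (asm) integrable_distr_eq) auto

lemma integrable_inner_square: "integrable \<nu> (\<lambda>x. (x \<bullet> h)\<^sup>2)"
  using marginal(3)[of h] unfolding marginal_def by (subst (asm) integrable_distr_eq) auto

lemma integrable_inner_mult: "integrable \<nu> (\<lambda>x. (x \<bullet> h) * (x \<bullet> k))"
proof -
  have e: "(x \<bullet> h) * (x \<bullet> k) = ((x \<bullet> (h + k))\<^sup>2 - (x \<bullet> h)\<^sup>2 - (x \<bullet> k)\<^sup>2) / 2" for x :: 'h
    by (simp add: inner_add_right power2_eq_square algebra_simps)
  show ?thesis unfolding e
    by (intro integrable_divide_zero Bochner_Integration.integrable_diff integrable_inner_square)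
qed

lemma integrable_centered: "integrable \<nu> (\<lambda>x. (x \<bullet> h - a) * (x \<bullet> k - c))"
  using integrable_inner_mult[of h k] integrable_inner[of h] integrable_inner[of k]
  by (simp add: algebra_simps)

lemma gmean_add: "gmean \<nu> (h + k) = gmean \<nu> h + gmean \<nu> k"
  unfolding gmean_def using integrable_inner by (simp add: inner_add_right)

lemma gmean_scale: "gmean \<nu> (c *\<^sub>R h) = c * gmean \<nu> h"
  unfolding gmean_def by simp

sublocale psd_form "gcov \<nu>"
proof
  fix x y z :: 'h and c :: real
  show "gcov \<nu> x y = gcov \<nu> y x" unfolding gcov_def by (simp add: mult.commute)
  show "0 \<le> gcov \<nu> x x" unfolding gcov_def by (intro Bochner_Integration.integral_nonneg) auto
  have "gcov \<nu> (x + y) z = (LINT w|\<nu>. (w \<bullet> x - gmean \<nu> x) * (w \<bullet> z - gmean \<nu> z) + (w \<bullet> y - gmean \<nu> y) * (w \<bullet> z - gmean \<nu> z))"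
    unfolding gcov_def by (intro Bochner_Integration.integral_cong) (auto simp: gmean_add inner_add_right algebra_simps)
  also have "\<dots> = gcov \<nu> x z + gcov \<nu> y z"
    unfolding gcov_def by (intro Bochner_Integration.integral_add integrable_centered)
  finally show "gcov \<nu> (x + y) z = gcov \<nu> x z + gcov \<nu> y z" .
  have "gcov \<nu> (c *\<^sub>R x) z = (LINT w|\<nu>. c * ((w \<bullet> x - gmean \<nu> x) * (w \<bullet> z - gmean \<nu> z)))"
    unfolding gcov_def by (intro Bochner_Integration.integral_cong) (auto simp: gmean_scale algebra_simps)
  then show "gcov \<nu> (c *\<^sub>R x) z = c * gcov \<nu> x z" unfolding gcov_def by simp
qed

lemma char_functional_eq: "char_functional \<nu> h = exp (\<i> * gmean \<nu> h - gcov \<nu> h h / 2)"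
proof -
  have "char_functional \<nu> h = char (marginal h) 1"
    unfolding char_functional_def char_def marginal_def by (subst integral_distr) auto
  then show ?thesis using marginal(5)[of h 1] by simp
qed

lemma integrable_exp_inner: "integrable \<nu> (\<lambda>x. exp (s * (x \<bullet> h)))"
  using gaussian_real_exp(1)[OF gaussian_marginal[of h], where s = s] unfolding marginal_def by (subst (asm) integrable_distr_eq) auto

lemma exp_iexp_inner: "(CLINT x|\<nu>. complex_of_real (exp (s * (x \<bullet> h))) * iexp (t * (x \<bullet> h))) =
  complex_of_real (exp (s * gmean \<nu> h + s\<^sup>2 * gcov \<nu> h h / 2)) * exp (\<i> * (t * (gmean \<nu> h + s * gcov \<nu> h h)) - gcov \<nu> h h * t\<^sup>2 / 2)"
  using gaussian_real_exp(2)[OF gaussian_marginal[of h], where s = s and t = t, unfolded marginal_var, unfolded marginal_mean]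
  unfolding marginal_def by (subst (asm) integral_distr) auto

lemma exp_inner: "(LINT x|\<nu>. exp (s * (x \<bullet> h))) = exp (s * gmean \<nu> h + s\<^sup>2 * gcov \<nu> h h / 2)"
proof -
  have "complex_of_real (LINT x|\<nu>. exp (s * (x \<bullet> h))) = complex_of_real (exp (s * gmean \<nu> h + s\<^sup>2 * gcov \<nu> h h / 2))"
    using exp_iexp_inner[of s h 0] by (simp flip: integral_complex_of_real)
  then show ?thesis by (simp only: of_real_eq_iff)
qed

lemma tilt_square: 
  "(LINT x|\<nu>. (exp (x \<bullet> k - gmean \<nu> k - gcov \<nu> k k / 2))\<^sup>2) = exp (gcov \<nu> k k)"
  "integrable \<nu> (\<lambda>x. (exp (x \<bullet> k - gmean \<nu> k - gcov \<nu> k k / 2))\<^sup>2)"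
proof -
  have e: "(exp (x \<bullet> k - gmean \<nu> k - gcov \<nu> k k / 2))\<^sup>2 = exp (2 * (x \<bullet> k)) * exp (- 2 * gmean \<nu> k - gcov \<nu> k k)" for x
    by (simp add: power2_eq_square flip: exp_add)
  show "integrable \<nu> (\<lambda>x. (exp (x \<bullet> k - gmean \<nu> k - gcov \<nu> k k / 2))\<^sup>2)"
    unfolding e using integrable_exp_inner[of 2 k] by simp
  show "(LINT x|\<nu>. (exp (x \<bullet> k - gmean \<nu> k - gcov \<nu> k k / 2))\<^sup>2) = exp (gcov \<nu> k k)"
    unfolding e by (subst integral_mult_left_zero, subst exp_inner) (simp flip: exp_add)
qed

lemma sets_tilt [measurable_cong, simp]: "sets (tilt \<nu> k) = sets borel"
  by (simp add: tilt_def)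

lemma prob_space_tilt: "prob_space (tilt \<nu> k)"
proof (rule prob_spaceI)
  have e: "exp (x \<bullet> k - gmean \<nu> k - gcov \<nu> k k / 2) = exp (1 * (x \<bullet> k)) * exp (- gmean \<nu> k - gcov \<nu> k k / 2)" for x
    by (simp flip: exp_add)
  have "integrable \<nu> (\<lambda>x. exp (x \<bullet> k - gmean \<nu> k - gcov \<nu> k k / 2))"
    unfolding e using integrable_exp_inner[of 1 k] by simp
  moreover have "(LINT x|\<nu>. exp (x \<bullet> k - gmean \<nu> k - gcov \<nu> k k / 2)) = 1"
    unfolding e by (subst integral_mult_left_zero, subst exp_inner) (simp flip: exp_add)
  ultimately show "emeasure (tilt \<nu> k) (space (tilt \<nu> k)) = 1"
    by (simp add: tilt_def emeasure_density nn_integral_eq_integral)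
qed

lemma joint_char_uncorrelated:
  assumes "gcov \<nu> k w = 0"
  shows "char_functional \<nu> (t *\<^sub>R k + s *\<^sub>R w) = char_functional \<nu> (t *\<^sub>R k) * char_functional \<nu> (s *\<^sub>R w)"
  using assms sym[of w k]
  by (simp add: char_functional_eq gmean_add add add2 scale scale2 diff_divide_distrib add_divide_distrib algebra_simps flip: exp_add)

text \<open>Uncorrelated functionals are compared with independent copies on \<open>\<nu> \<Otimes>\<^sub>M \<nu>\<close>.\<close>

lemma uncorrelated_product:
  fixes u :: "real \<Rightarrow> complex"
  assumes kw: "gcov \<nu> k w = 0" and [measurable]: "u \<in> borel_measurable borel"
    and u: "integrable \<nu> (\<lambda>x. u (x \<bullet> k))"
  shows "(CLINT x|\<nu>. u (x \<bullet> k) * iexp (x \<bullet> w)) = (CLINT x|\<nu>. u (x \<bullet> k)) * char_functional \<nu> w"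
proof -
  interpret P: pair_prob_space \<nu> \<nu> ..
  have P: "integrable (\<nu> \<Otimes>\<^sub>M \<nu>) (\<lambda>p. f (fst p \<bullet> k))" if "f \<in> borel_measurable borel" "integrable \<nu> (\<lambda>x. f (x \<bullet> k))" for f :: "real \<Rightarrow> complex"
  proof -
    have "integrable (distr (\<nu> \<Otimes>\<^sub>M \<nu>) \<nu> fst) (\<lambda>x. f (x \<bullet> k))" unfolding distr_pair_fst by fact
    then show ?thesis using that(1) by (subst (asm) integrable_distr_eq) auto
  qed
  have F: "(CLINT p|\<nu> \<Otimes>\<^sub>M \<nu>. f (fst p \<bullet> k) * iexp (s * (snd p \<bullet> w))) =
     (CLINT x|\<nu>. f (x \<bullet> k)) * char_functional \<nu> (s *\<^sub>R w)"
    if [measurable]: "f \<in> borel_measurable borel" and f: "integrable \<nu> (\<lambda>x. f (x \<bullet> k))" for f :: "real \<Rightarrow> complex" and s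
  proof -
    have "integrable (\<nu> \<Otimes>\<^sub>M \<nu>) (\<lambda>p. f (fst p \<bullet> k) * iexp (s * (snd p \<bullet> w)))"
      by (rule Bochner_Integration.integrable_bound[OF P[OF that]]) (auto simp: norm_mult)
    from P.integral_fst'[OF this] show ?thesis by (simp add: char_functional_def)
  qed
  have "(CLINT x|\<nu>. complex_of_real 1 * (u (x \<bullet> k) * iexp (x \<bullet> w))) =
     (CLINT p|\<nu> \<Otimes>\<^sub>M \<nu>. complex_of_real 1 * (u (fst p \<bullet> k) * iexp (snd p \<bullet> w)))"
  proof (rule joint_char_determines)
    fix t s :: real
    have it: "integrable \<nu> (\<lambda>x. iexp (t * (x \<bullet> k)))"
      by (intro integrable_const_bound[of _ 1]) auto
    have "(CLINT p|\<nu> \<Otimes>\<^sub>M \<nu>. complex_of_real 1 * iexp (t * (fst p \<bullet> k) + s * (snd p \<bullet> w))) =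
      (CLINT p|\<nu> \<Otimes>\<^sub>M \<nu>. iexp (t * (fst p \<bullet> k)) * iexp (s * (snd p \<bullet> w)))"
      by (simp add: exp_add distrib_left)
    also have "\<dots> = char_functional \<nu> (t *\<^sub>R k) * char_functional \<nu> (s *\<^sub>R w)"
      using F[of "\<lambda>y. iexp (t * y)" s] it by (simp add: char_functional_def)
    also have "\<dots> = char_functional \<nu> (t *\<^sub>R k + s *\<^sub>R w)" using joint_char_uncorrelated[OF kw] by simp
    finally show "(CLINT x|\<nu>. complex_of_real 1 * iexp (t * (x \<bullet> k) + s * (x \<bullet> w))) =
      (CLINT p|\<nu> \<Otimes>\<^sub>M \<nu>. complex_of_real 1 * iexp (t * (fst p \<bullet> k) + s * (snd p \<bullet> w)))"
      by (simp add: char_functional_def inner_add_right)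
  qed (use u P[of u] in \<open>auto intro: finite_measure_axioms P.finite_measure_axioms\<close>)
  also have "\<dots> = (CLINT x|\<nu>. u (x \<bullet> k)) * char_functional \<nu> w"
    using F[of u 1] u by simp
  finally show ?thesis by simp
qed

text \<open>Splitting \<open>h\<close> into a multiple of \<open>k\<close> and a part
  \<open>w\<close> uncorrelated with \<open>k\<close> makes the integral factor; the factor in
  \<open>k\<close> is a one-dimensional exponential integral. The outcome says that tilting adds
  \<open>gcov \<nu> k\<close> to the mean and leaves the covariance alone.\<close>

lemma char_functional_tilt:
  "char_functional (tilt \<nu> k) h = exp (\<i> * (gmean \<nu> h + gcov \<nu> k h) - gcov \<nu> h h / 2)"
proof -
  define a where "a = gcov \<nu> k h / gcov \<nu> k k"
  define w where "w = h - a *\<^sub>R k"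
  have h: "h = w + a *\<^sub>R k" by (simp add: w_def)
  \<comment> \<open>If \<open>gcov \<nu> k k\<close> is zero, then \<open>a\<close> is 0 by the
    convention for division, and the right-hand side vanishes by \<open>null\<close>.\<close>
  have a: "a * gcov \<nu> k k = gcov \<nu> k h"
    using null[of k h] by (auto simp: a_def sym)
  have kw: "gcov \<nu> k w = 0"
    using add2[of k w "a *\<^sub>R k"] a by (simp add: scale2 flip: h)
  let ?u = "\<lambda>y. complex_of_real (exp (1 * y)) * iexp (a * y)"
  have u: "integrable \<nu> (\<lambda>x. ?u (x \<bullet> k))"
    by (rule Bochner_Integration.integrable_bound[OF integrable_exp_inner[of 1 k]]) (auto simp: norm_mult)
  have "char_functional (tilt \<nu> k) h = 
     (CLINT x|\<nu>. complex_of_real (exp (x \<bullet> k - gmean \<nu> k - gcov \<nu> k k / 2)) * iexp (x \<bullet> h))"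
    unfolding char_functional_def tilt_def by (subst integral_density) (auto simp: scaleR_conv_of_real)
  also have "\<dots> = (CLINT x|\<nu>. complex_of_real (exp (- gmean \<nu> k - gcov \<nu> k k / 2)) * (?u (x \<bullet> k) * iexp (x \<bullet> w)))"
    by (intro Bochner_Integration.integral_cong refl)
       (simp add: h inner_add_right exp_of_real[symmetric] algebra_simps flip: exp_add)
  also have "\<dots> = complex_of_real (exp (- gmean \<nu> k - gcov \<nu> k k / 2)) * (CLINT x|\<nu>. ?u (x \<bullet> k) * iexp (x \<bullet> w))"
    by simp
  also have "(CLINT x|\<nu>. ?u (x \<bullet> k) * iexp (x \<bullet> w)) = (CLINT x|\<nu>. ?u (x \<bullet> k)) * char_functional \<nu> w"
    by (rule uncorrelated_product[OF kw _ u]) measurable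
  also have "complex_of_real (exp (- gmean \<nu> k - gcov \<nu> k k / 2)) * \<dots> =
    exp (\<i> * (gmean \<nu> h + gcov \<nu> k h) - gcov \<nu> h h / 2)"
  proof -
    have "gmean \<nu> h = gmean \<nu> w + a * gmean \<nu> k" unfolding h by (simp only: gmean_add gmean_scale)
    moreover have "gcov \<nu> h h = gcov \<nu> w w + a\<^sup>2 * gcov \<nu> k k"
      unfolding h expand using kw sym[of w k] by simp
    ultimately show ?thesis
      unfolding exp_iexp_inner char_functional_eq unfolding exp_of_real[symmetric] exp_add[symmetric]
      by (intro arg_cong[where f = exp]) (simp add: field_simps flip: a)
  qed
  finally show ?thesis .
qed

end

section \<open>Setwise convergence\<close>

definition setwise_conv :: "(nat \<Rightarrow> 'a measure) \<Rightarrow> 'a measure \<Rightarrow> bool" where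
  "setwise_conv N M \<longleftrightarrow> (\<forall>A\<in>sets M. (\<lambda>n. measure (N n) A) \<longlonglongrightarrow> measure M A)"

definition uniformly_ac :: "'a measure \<Rightarrow> (nat \<Rightarrow> 'a measure) \<Rightarrow> bool" where
  "uniformly_ac M N \<longleftrightarrow>
     (\<forall>e>0. \<exists>d>0. \<forall>A\<in>sets M. measure M A < d \<longrightarrow> (\<forall>n. measure (N n) A < e))"

lemma setwise_conv_distr_weak_conv:
  fixes f :: "'a \<Rightarrow> real"
  assumes conv: "setwise_conv N M" and sets: "\<And>n. sets (N n) = sets M" and f[measurable]: "f \<in> borel_measurable M"
  shows "weak_conv_m (\<lambda>n. distr (N n) borel f) (distr M borel f)"
proof -
  have [measurable]: "f \<in> borel_measurable (N n)" for n
    unfolding measurable_cong_sets[OF sets[of n] refl] by (rule f)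
  have sp: "space (N n) = space M" for n using sets_eq_imp_space_eq[OF sets] .
  show ?thesis
    using conv unfolding weak_conv_m_def weak_conv_def cdf_def setwise_conv_def
    by (auto simp: measure_distr sp)
qed

text \<open>Pushing forward along \<open>f\<close> gives weak convergence on the line. There the
  identity clipped to [-B, B] is a bounded continuous test function, and it agrees with the identity
  on the values of \<open>f\<close>.\<close>

lemma setwise_conv_bounded_integral:
  fixes f :: "'a \<Rightarrow> real"
  assumes conv: "setwise_conv N M" and sets: "\<And>n. sets (N n) = sets M"
    and M: "prob_space M" and N: "\<And>n. prob_space (N n)"
    and f[measurable]: "f \<in> borel_measurable M" and b: "\<And>x. \<bar>f x\<bar> \<le> B"
  shows "(\<lambda>n. LINT x|N n. f x) \<longlonglongrightarrow> (LINT x|M. f x)"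
proof -
  have fN[measurable]: "f \<in> borel_measurable (N n)" for n
    unfolding measurable_cong_sets[OF sets[of n] refl] by (rule f)
  define g where "g y = max (- B) (min B y)" for y :: real
  have gf: "g (f x) = f x" for x using b[of x] by (auto simp: g_def max_def min_def abs_le_iff)
  have "0 \<le> B" using b[of undefined] by simp
  have [measurable]: "g \<in> borel_measurable borel" unfolding g_def by measurable
  have rd: "real_distribution (distr M borel f)" "real_distribution (distr (N n) borel f)" for n
    using prob_space.prob_space_distr[OF M f] prob_space.prob_space_distr[OF N fN]
    by (auto simp: real_distribution_def real_distribution_axioms_def)
  have "(\<lambda>n. LINT y|distr (N n) borel f. g y) \<longlonglongrightarrow> (LINT y|distr M borel f. g y)"
  proof (rule weak_conv_imp_integral_bdd_continuous_conv[OF rd(2) rd(1) setwise_conv_distr_weak_conv[OF conv sets f]])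
    show "isCont g y" for y unfolding g_def by (intro continuous_intros)
    show "norm (g y) \<le> B" for y unfolding g_def using \<open>0 \<le> B\<close> by auto
  qed
  then show ?thesis by (simp add: integral_distr gf)
qed

lemma setwise_conv_char:
  fixes f :: "'a \<Rightarrow> real"
  assumes conv: "setwise_conv N M" and sets: "\<And>n. sets (N n) = sets M"
    and M: "prob_space M" and N: "\<And>n. prob_space (N n)"
    and f[measurable]: "f \<in> borel_measurable M"
  shows "(\<lambda>n. char (distr (N n) borel f) t) \<longlonglongrightarrow> char (distr M borel f) t"
proof -
  have fN[measurable]: "f \<in> borel_measurable (N n)" for n
    unfolding measurable_cong_sets[OF sets[of n] refl] by (rule f)
  have rd: "real_distribution (distr M borel f)" "real_distribution (distr (N n) borel f)" for n
    using prob_space.prob_space_distr[OF M f] prob_space.prob_space_distr[OF N fN]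
    by (auto simp: real_distribution_def real_distribution_axioms_def)
  show ?thesis by (rule levy_continuity1[OF rd(2) rd(1) setwise_conv_distr_weak_conv[OF conv sets f]])
qed

text \<open>Finite unions from a countable base do it, for all finite measures at once: outer
  regularity replaces \<open>A\<close> by an open set, and continuity from below replaces that by a
  finite union.\<close>

lemma countable_dense_in_measure:
  "\<exists>\<F> :: 'a::polish_space set set. countable \<F> \<and> \<F> \<noteq> {} \<and> \<F> \<subseteq> sets borel \<and>
     (\<forall>M. finite_measure M \<longrightarrow> sets M = sets borel \<longrightarrow>
       (\<forall>A\<in>sets borel. \<forall>e>0. \<exists>V\<in>\<F>. measure M ((A - V) \<union> (V - A)) < e))"
proof -
  obtain B :: "'a set set" where B: "countable B" "topological_basis B"
    using ex_countable_basis by blast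
  let ?F = "Union ` {F. finite F \<and> F \<subseteq> B}"
  have open_F: "open V" if "V \<in> ?F" for V
    using that topological_basis_open[OF B(2)] by (auto intro!: open_Union)
  have approx: "\<exists>V\<in>?F. measure M ((A - V) \<union> (V - A)) < e"
    if M: "finite_measure M" "sets M = sets borel" and A: "A \<in> sets borel" and e: "0 < e" for M A e
  proof -
    interpret finite_measure M by fact
    note [measurable_cong] = M(2) 
    note [measurable] = A
    have "emeasure M A < emeasure M A + ennreal (e / 2)"
      using e by (simp add: emeasure_eq_measure ennreal_less_iff flip: ennreal_plus)
    then have "(INF U \<in> {U. A \<subseteq> U \<and> open U}. emeasure M U) < emeasure M A + ennreal (e / 2)"
      using outer_regular[OF M(2) _ A] by simp
    then obtain U where U: "A \<subseteq> U" "open U" "emeasure M U < emeasure M A + ennreal (e / 2)"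
      by (auto simp: INF_less_iff)
    then have mU: "measure M U < measure M A + e / 2"
      using e by (simp add: emeasure_eq_measure ennreal_less_iff flip: ennreal_plus)
    have [measurable]: "U \<in> sets borel" using U by simp
    obtain B' where B': "B' \<subseteq> B" "\<Union>B' = U" using B(2) U(2) unfolding topological_basis_def by blast
    \<comment> \<open>Inserting the empty set keeps the enumerated set nonempty even if
      \<open>B'\<close> is empty.\<close>
    have cB': "countable (insert {} B')" using countable_subset[OF B'(1) B(1)] by simp
    define f where "f = from_nat_into (insert {} B')"
    have rf: "range f = insert {} B'" unfolding f_def using cB' by (intro range_from_nat_into) auto
    define V where "V n = \<Union>(f ` {..n} \<inter> B')" for n
    have VF: "V n \<in> ?F" for n unfolding V_def using B'(1) by blast
    have Vb[measurable]: "V n \<in> sets borel" for n using open_F[OF VF] by simp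
    have "(\<Union>n. V n) = U"
    proof (intro equalityI subsetI)
      fix x assume "x \<in> U"
      then obtain b where "x \<in> b" "b \<in> B'" using B' by blast
      moreover obtain n where "b = f n" using rf \<open>b \<in> B'\<close> by blast
      ultimately show "x \<in> (\<Union>n. V n)" unfolding V_def by blast
    qed (use B' in \<open>auto simp: V_def\<close>)
    moreover have "incseq V" unfolding V_def incseq_def by (fastforce)
    ultimately have "(\<lambda>n. measure M (V n)) \<longlonglongrightarrow> measure M U"
      using finite_Lim_measure_incseq[of V] Vb by (simp add: M(2) image_subset_iff)
    then have "eventually (\<lambda>n. measure M U - e / 2 < measure M (V n)) sequentially"
      by (rule order_tendstoD) (use e in simp)
    then obtain n where n: "measure M U - e / 2 < measure M (V n)"
      by (auto simp: eventually_sequentially)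
    have VU: "V n \<subseteq> U" using \<open>(\<Union>n. V n) = U\<close> by blast
    have "measure M ((A - V n) \<union> (V n - A)) \<le> measure M ((U - V n) \<union> (U - A))"
      using U VU by (intro finite_measure_mono) auto
    also have "\<dots> \<le> measure M (U - V n) + measure M (U - A)"
      by (rule measure_Un_le) auto
    also have "\<dots> < e"
      using n mU VU U by (simp add: finite_measure_Diff M(2))
    finally show ?thesis by (rule bexI) (rule VF)
  qed
  have "countable ?F" by (intro countable_image countable_Collect_finite_subset B)
  moreover have "?F \<noteq> {}" by blast
  moreover have "?F \<subseteq> sets borel" using open_F by auto
  ultimately show ?thesis using approx by (intro exI[of _ ?F]) simp
qed

lemma diagonal_convergent:
  fixes a :: "nat \<Rightarrow> nat \<Rightarrow> real"
  assumes "\<And>n m. \<bar>a n m\<bar> \<le> B"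
  shows "\<exists>r. strict_mono r \<and> (\<forall>m. convergent (\<lambda>n. a (r n) m))"
proof -
  let ?P = "\<lambda>m s. convergent (\<lambda>n. a (s n) m)"
  interpret nat: subseqs ?P
  proof
    fix m and s :: "nat \<Rightarrow> nat" assume s: "strict_mono s"
    have "\<And>k. a (s k) m \<in> {-B..B}"
      using assms by (simp add: abs_le_iff minus_le_iff)
    then have "\<exists>l s'. strict_mono s' \<and> ((\<lambda>k. a (s k) m) \<circ> s') \<longlonglongrightarrow> l"
      using compact_Icc compact_imp_seq_compact seq_compactE by metis
    then show "\<exists>s'. strict_mono s' \<and> ?P m (s \<circ> s')"
      by (auto simp: o_def convergent_def)
  qed
  have "?P m nat.diagseq" for m
  proof -
    \<comment> \<open>Only the tail of the diagonal from index \<open>Suc m\<close> is a subsequence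
      of a sequence along which coordinate \<open>m\<close> converges; the initial segment is
      restored afterwards.\<close>
    have "?P m (nat.diagseq \<circ> ((+) (Suc m)))"
    proof (rule nat.diagseq_holds)
      show "?P m (s \<circ> r)" if "strict_mono r" "?P m s" for m and r s :: "nat \<Rightarrow> nat"
        using convergent_subseq_convergent[OF that(2,1)] by (simp add: o_def)
    qed
    then show ?thesis
      using convergent_ignore_initial_segment[of "\<lambda>n. a (nat.diagseq n) m" "Suc m"]
      by (simp add: o_def add.commute)
  qed
  then show ?thesis using nat.subseq_diagseq by blast
qed

text \<open>Diagonal extraction gives convergence on a countable family dense in
  \<open>M\<close>-measure. Uniform absolute continuity makes a small symmetric difference small for
  all \<open>N n\<close> simultaneously, which extends convergence to every Borel set. The same
  property, inherited by the limit set function, provides countable additivity and absolute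
  continuity.\<close>

theorem setwise_compact:
  fixes M :: "'a::polish_space measure" and N :: "nat \<Rightarrow> 'a measure"
  assumes M: "prob_space M" "sets M = sets borel"
    and N: "\<And>n. prob_space (N n)" "\<And>n. sets (N n) = sets borel"
    and uac: "uniformly_ac M N"
  shows "\<exists>r L. strict_mono r \<and> prob_space L \<and> sets L = sets borel \<and>
     absolutely_continuous M L \<and> setwise_conv (\<lambda>n. N (r n)) L"
proof -
  interpret M: prob_space M by fact
  interpret N: prob_space "N n" for n by fact
  note [measurable_cong] = M(2) N(2)
  have spM: "space M = UNIV" and spN: "space (N n) = UNIV" for n
    using sets_eq_imp_space_eq[OF M(2)] sets_eq_imp_space_eq[OF N(2)] by auto
  obtain \<F> :: "'a set set" where F: "countable \<F>" "\<F> \<noteq> {}" "\<F> \<subseteq> sets borel"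
    and dense: "\<And>A e. A \<in> sets borel \<Longrightarrow> 0 < e \<Longrightarrow> \<exists>V\<in>\<F>. measure M ((A - V) \<union> (V - A)) < e"
    using countable_dense_in_measure[where 'a = 'a] M M.finite_measure_axioms by metis
  define V where "V = from_nat_into \<F>"
  have rV: "range V = \<F>" unfolding V_def using F by (intro range_from_nat_into) auto
  have "\<bar>measure (N n) (V m)\<bar> \<le> 1" for n m by simp
  from diagonal_convergent[of "\<lambda>n m. measure (N n) (V m)", OF this]
  obtain r where r: "strict_mono r" and rc: "\<And>m. convergent (\<lambda>n. measure (N (r n)) (V m))" by blast
  have diff: "\<bar>measure (N n) A - measure (N n) W\<bar> \<le> measure (N n) ((A - W) \<union> (W - A))"
    if [measurable]: "A \<in> sets borel" "W \<in> sets borel" for n A W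
  proof -
    have "measure (N n) A \<le> measure (N n) (W \<union> ((A - W) \<union> (W - A)))"
      "measure (N n) W \<le> measure (N n) (A \<union> ((A - W) \<union> (W - A)))"
      by (intro N.finite_measure_mono; auto)+
    moreover have "measure (N n) (W \<union> ((A - W) \<union> (W - A))) \<le> measure (N n) W + measure (N n) ((A - W) \<union> (W - A))"
      "measure (N n) (A \<union> ((A - W) \<union> (W - A))) \<le> measure (N n) A + measure (N n) ((A - W) \<union> (W - A))"
      by (intro measure_Un_le; auto)+
    ultimately show ?thesis by linarith
  qed
  have "convergent (\<lambda>n. measure (N (r n)) A)" if A: "A \<in> sets borel" for A
  proof (rule Cauchy_convergent, rule metric_CauchyI)
    fix e :: real assume e: "0 < e"
    then obtain d where d: "0 < d" "\<And>A n. A \<in> sets borel \<Longrightarrow> measure M A < d \<Longrightarrow> measure (N n) A < e / 3"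
      using uac[unfolded uniformly_ac_def, rule_format, of "e / 3"] by (auto simp: M(2))
    obtain W where W: "W \<in> \<F>" "measure M ((A - W) \<union> (W - A)) < d" using dense[OF A d(1)] by blast
    have Wb: "W \<in> sets borel" using W F by blast
    have c: "\<bar>measure (N n) A - measure (N n) W\<bar> < e / 3" for n
      using diff[OF A Wb, of n] d(2)[OF _ W(2), of n] A Wb by simp
    obtain m where m: "W = V m" using W rV by blast
    have "Cauchy (\<lambda>n. measure (N (r n)) W)" using rc[of m] convergent_Cauchy unfolding m by blast
    then obtain K where K: "\<And>i j. K \<le> i \<Longrightarrow> K \<le> j \<Longrightarrow> dist (measure (N (r i)) W) (measure (N (r j)) W) < e / 3"
      using e unfolding Cauchy_def by (meson divide_pos_pos zero_less_numeral)
    show "\<exists>K. \<forall>i\<ge>K. \<forall>j\<ge>K. dist (measure (N (r i)) A) (measure (N (r j)) A) < e"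
    proof (intro exI[of _ K] allI impI)
      fix i j assume "K \<le> i" "K \<le> j"
      from K[OF this] show "dist (measure (N (r i)) A) (measure (N (r j)) A) < e"
        using c[of "r i"] c[of "r j"] unfolding dist_real_def by linarith
    qed
  qed
  then obtain l where l: "\<And>A. A \<in> sets borel \<Longrightarrow> (\<lambda>n. measure (N (r n)) A) \<longlonglongrightarrow> l A"
    unfolding convergent_def by metis
  have l_nn: "0 \<le> l A" if "A \<in> sets borel" for A
    using LIMSEQ_le_const[OF l[OF that]] by simp
  \<comment> \<open>Strict inequalities weaken in the limit, so continuity at the empty set is later
    obtained from e/2.\<close>
  have l_uac: "\<exists>d>0. \<forall>A\<in>sets borel. measure M A < d \<longrightarrow> l A \<le> e" if e: "0 < e" for e
  proof -
    obtain d where d: "0 < d" "\<And>A n. A \<in> sets borel \<Longrightarrow> measure M A < d \<Longrightarrow> measure (N n) A < e"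
      using uac[unfolded uniformly_ac_def, rule_format, OF e] by (auto simp: M(2))
    have "l A \<le> e" if "A \<in> sets borel" "measure M A < d" for A
      using LIMSEQ_le_const2[OF l[OF that(1)], of e] d(2)[OF that] by (auto intro: less_imp_le)
    then show ?thesis using d(1) by blast
  qed
  have l_add: "l (A \<union> B) = l A + l B" if "A \<in> sets borel" "B \<in> sets borel" "A \<inter> B = {}" for A B
  proof (rule LIMSEQ_unique)
    show "(\<lambda>n. measure (N (r n)) (A \<union> B)) \<longlonglongrightarrow> l (A \<union> B)" using that by (intro l) auto
    show "(\<lambda>n. measure (N (r n)) (A \<union> B)) \<longlonglongrightarrow> l A + l B"
      using that tendsto_add[OF l[OF that(1)] l[OF that(2)]]
      by (subst N.finite_measure_Union) (auto simp: N(2))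
  qed
  have l0: "l {} = 0" using LIMSEQ_unique[OF l[of "{}"], of 0] by simp
  have lU: "l UNIV = 1"
    using LIMSEQ_unique[OF l[of UNIV], of 1] N.prob_space by (simp add: spN)
  define L where "L = measure_of UNIV (sets borel) (\<lambda>A. ennreal (l A))"
  have sL: "sets L = sets borel" unfolding L_def
    using sets.sets_measure_of_eq[of borel] by simp
  have eL: "emeasure L A = ennreal (l A)" if A: "A \<in> sets borel" for A
  proof (rule emeasure_measure_of[OF L_def])
    show "positive (sets L) (\<lambda>A. ennreal (l A))" using l0 by (simp add: positive_def)
    show "countably_additive (sets L) (\<lambda>A. ennreal (l A))"
    \<comment> \<open>For a finitely additive set function it is enough to examine sequences
      decreasing to the empty set; their \<open>M\<close>-measures tend to 0, so
      \<open>l_uac\<close> applies.\<close>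
    proof (rule sets.empty_continuous_imp_countably_additive)
      show "positive (sets L) (\<lambda>A. ennreal (l A))" using l0 by (simp add: positive_def)
      show "additive (sets L) (\<lambda>A. ennreal (l A))"
        unfolding sL additive_def using l_add l_nn by (auto simp flip: ennreal_plus)
      fix S :: "nat \<Rightarrow> 'a set" assume S: "range S \<subseteq> sets L" "decseq S" "(\<Inter>i. S i) = {}"
      then have Sb: "S i \<in> sets borel" for i using sL by blast
      have "(\<lambda>i. measure M (S i)) \<longlonglongrightarrow> measure M (\<Inter>i. S i)"
        using Sb S by (intro M.finite_Lim_measure_decseq) (auto simp: M(2))
      then have mS: "(\<lambda>i. measure M (S i)) \<longlonglongrightarrow> 0" using S(3) by simp
      have "(\<lambda>i. l (S i)) \<longlonglongrightarrow> 0"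
      proof (rule order_tendstoI)
        fix e :: real assume "0 < e"
        then obtain d where d: "0 < d" "\<forall>A\<in>sets borel. measure M A < d \<longrightarrow> l A \<le> e / 2"
          using l_uac[of "e / 2"] by auto
        have "eventually (\<lambda>i. measure M (S i) < d) sequentially" using order_tendstoD(2)[OF mS d(1)] .
        then show "eventually (\<lambda>i. l (S i) < e) sequentially"
          by eventually_elim (use d(2) Sb \<open>0 < e\<close> in force)
      next
        fix a :: real assume "a < 0"
        then have "a < l (S i)" for i using l_nn[OF Sb[of i]] by linarith
        then show "eventually (\<lambda>i. a < l (S i)) sequentially" by simp
      qed
      then show "(\<lambda>i. ennreal (l (S i))) \<longlonglongrightarrow> 0" using tendsto_ennrealI by fastforce
    qed auto
  qed (use A sL in auto)
  have mL: "measure L A = l A" if "A \<in> sets borel" for A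
    using eL[OF that] l_nn[OF that] by (simp add: measure_def)
  have spL: "space L = UNIV" using sets_eq_imp_space_eq[OF sL] by simp
  have "prob_space L" by (rule prob_spaceI) (simp add: eL lU spL)
  moreover have "absolutely_continuous M L"
    unfolding absolutely_continuous_def
  proof
    fix A assume "A \<in> null_sets M"
    then have A: "A \<in> sets borel" "measure M A = 0" by (auto simp: null_sets_def measure_def M(2))
    have "l A \<le> 0"
    proof (rule field_le_epsilon)
      fix e :: real assume "0 < e"
      then obtain d where "0 < d" "\<forall>A\<in>sets borel. measure M A < d \<longrightarrow> l A \<le> e" using l_uac by blast
      then show "l A \<le> 0 + e" using A by simp
    qed
    then show "A \<in> null_sets L" using A eL by (auto simp: null_sets_def sL ennreal_eq_0_iff)
  qed
  moreover have "setwise_conv (\<lambda>n. N (r n)) L"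
    unfolding setwise_conv_def sL using l mL by simp
  ultimately show ?thesis using r sL by blast
qed

section \<open>Relative entropy\<close>

text \<open>The terms - t + 1 integrate to zero against probability densities and make the integrand
  nonnegative, so that entropy becomes an \<open>ennreal\<close> integral without differences of
  infinities. At t = 0 the value is 1.\<close>

definition ent :: "real \<Rightarrow> real" where
  "ent t = t * ln t - t + 1"

text \<open>The left side is the tangent at \<open>s\<close> to the convex function
  \<open>ent\<close>. Being affine in the density \<open>t\<close>, it is stable under setwise
  limits once \<open>s\<close> is fixed.\<close>

lemma ent_ge:
  assumes "0 \<le> t" "0 < s"
  shows "t * ln s - s + 1 \<le> ent t"
proof (cases "t = 0")
  case False
  then have t: "0 < t" using assms by simp
  have "ln (s / t) \<le> s / t - 1" using t assms by (intro ln_le_minus_one) simp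
  then have "t * (ln s - ln t) \<le> t * (s / t - 1)"
    using t assms by (simp add: ln_div)
  then show ?thesis using t by (simp add: ent_def algebra_simps)
qed (use assms in \<open>simp add: ent_def\<close>)

lemma ent_nonneg: "0 \<le> t \<Longrightarrow> 0 \<le> ent t"
  using ent_ge[of t 1] by simp

lemma borel_measurable_ent [measurable]: "ent \<in> borel_measurable borel"
  unfolding ent_def by measurable

definition Ent :: "'a measure \<Rightarrow> 'a measure \<Rightarrow> ennreal" where
  "Ent \<nu> \<mu> = (\<integral>\<^sup>+x. ennreal (ent (enn2real (RN_deriv \<mu> \<nu> x))) \<partial>\<mu>)"

locale ac_prob = M: prob_space \<mu> + N: prob_space \<nu> for \<mu> \<nu> :: "'a measure" +
  assumes sets_eq: "sets \<nu> = sets \<mu>" and ac: "absolutely_continuous \<mu> \<nu>"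
begin

definition \<rho> :: "'a \<Rightarrow> real" where "\<rho> x = enn2real (RN_deriv \<mu> \<nu> x)"

lemma rho_measurable [measurable]: "\<rho> \<in> borel_measurable \<mu>"
  unfolding \<rho>_def by measurable

lemma rho_nonneg: "0 \<le> \<rho> x"
  by (simp add: \<rho>_def)

lemma density_rho: "density \<mu> (\<lambda>x. ennreal (\<rho> x)) = \<nu>"
proof -
  have "AE x in \<mu>. RN_deriv \<mu> \<nu> x \<noteq> \<infinity>"
    by (rule M.RN_deriv_finite[OF N.sigma_finite_measure_axioms ac sets_eq])
  then have "AE x in \<mu>. ennreal (\<rho> x) = RN_deriv \<mu> \<nu> x"
    by eventually_elim (simp add: \<rho>_def less_top)
  then have "density \<mu> (\<lambda>x. ennreal (\<rho> x)) = density \<mu> (RN_deriv \<mu> \<nu>)"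
    by (intro density_cong) auto
  then show ?thesis using M.density_RN_deriv[OF ac sets_eq] by simp
qed

lemma space_eq: "space \<nu> = space \<mu>"
  by (rule sets_eq_imp_space_eq[OF sets_eq])

lemma nn_integral_rho: "(\<integral>\<^sup>+x. ennreal (\<rho> x) \<partial>\<mu>) = 1"
  using N.emeasure_space_1 unfolding space_eq
  by (subst (asm) density_rho[symmetric]) (simp add: emeasure_density cong: nn_integral_cong)

lemma integrable_rho: "integrable \<mu> \<rho>"
  using nn_integral_rho by (simp add: integrable_iff_bounded rho_nonneg)

lemma integral_density_rho: 
  "f \<in> borel_measurable \<mu> \<Longrightarrow> (LINT x|\<nu>. f x) = (LINT x|\<mu>. \<rho> x * f x)" for f :: "'a \<Rightarrow> real"
  by (subst density_rho[symmetric], subst integral_density) (auto simp: rho_nonneg)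

lemma integrable_rho_mult:
  fixes f :: "'a \<Rightarrow> real"
  assumes [measurable]: "f \<in> borel_measurable \<mu>" and "\<And>x. \<bar>f x\<bar> \<le> B"
  shows "integrable \<mu> (\<lambda>x. \<rho> x * f x)"
  by (rule Bochner_Integration.integrable_bound[OF integrable_mult_right[OF integrable_rho, of B]])
     (auto simp: abs_mult rho_nonneg mult.commute intro!: mult_right_mono order_trans[OF assms(2) abs_ge_self])

lemma Ent_eq: "Ent \<nu> \<mu> = (\<integral>\<^sup>+x. ennreal (ent (\<rho> x)) \<partial>\<mu>)"
  by (simp add: Ent_def \<rho>_def)

text \<open>The negative part of \<rho> ln \<rho> is at most 1, so its integral is finite and may be
  subtracted. Moving it to the other side gives a pointwise identity between nonnegative terms, in
  which \<rho> and 1 have equal integrals and cancel.\<close>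

lemma KL_eq_Ent: "KL \<nu> \<mu> = enn2ereal (Ent \<nu> \<mu>)"
proof -
  let ?p = "\<lambda>x. ennreal (\<rho> x * ln (\<rho> x))" and ?n = "\<lambda>x. ennreal (- (\<rho> x * ln (\<rho> x)))"
  let ?P = "\<integral>\<^sup>+x. ?p x \<partial>\<mu>" and ?N = "\<integral>\<^sup>+x. ?n x \<partial>\<mu>"
  have KL: "KL \<nu> \<mu> = enn2ereal ?P - enn2ereal ?N"
    using ac by (simp add: KL_def \<rho>_def)
  have n_le: "- (\<rho> x * ln (\<rho> x)) \<le> 1" for x
    using ent_nonneg[OF rho_nonneg[of x]] rho_nonneg[of x] by (simp add: ent_def)
  have "?N \<le> (\<integral>\<^sup>+x. 1 \<partial>\<mu>)"
    using n_le by (intro nn_integral_mono) (simp add: ennreal_le_1)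
  then have N: "?N \<noteq> \<top>" by (auto simp: M.emeasure_space_1 top_unique)
  have pw: "ennreal (ent (\<rho> x)) + (?n x + ennreal (\<rho> x)) = ?p x + 1" for x
  proof (cases "0 \<le> \<rho> x * ln (\<rho> x)")
    case True
    have "ennreal (ent (\<rho> x)) + ennreal (\<rho> x) = ennreal (ent (\<rho> x) + \<rho> x)"
      by (intro ennreal_plus[symmetric] ent_nonneg rho_nonneg)
    also have "\<dots> = ennreal (\<rho> x * ln (\<rho> x) + 1)" by (simp add: ent_def)
    also have "\<dots> = ?p x + 1" using True by (subst ennreal_plus) auto
    finally show ?thesis using True by (simp add: ennreal_neg)
  next
    case False
    have "ennreal (ent (\<rho> x)) + (?n x + ennreal (\<rho> x)) = ennreal (ent (\<rho> x) + (- (\<rho> x * ln (\<rho> x)) + \<rho> x))"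
    proof -
      have nn: "0 \<le> - (\<rho> x * ln (\<rho> x))" using False by simp
      have "?n x + ennreal (\<rho> x) = ennreal (- (\<rho> x * ln (\<rho> x)) + \<rho> x)"
        by (rule ennreal_plus[symmetric, OF nn rho_nonneg])
      moreover have "ennreal (ent (\<rho> x)) + ennreal (- (\<rho> x * ln (\<rho> x)) + \<rho> x) =
          ennreal (ent (\<rho> x) + (- (\<rho> x * ln (\<rho> x)) + \<rho> x))"
        by (rule ennreal_plus[symmetric, OF ent_nonneg[OF rho_nonneg] add_nonneg_nonneg[OF nn rho_nonneg]])
      ultimately show ?thesis by simp
    qed
    also have "\<dots> = 1" by (simp add: ent_def)
    finally show ?thesis using False by (simp add: ennreal_neg)
  qed
  have "(\<integral>\<^sup>+x. ennreal (ent (\<rho> x)) + (?n x + ennreal (\<rho> x)) \<partial>\<mu>) = (\<integral>\<^sup>+x. ?p x + 1 \<partial>\<mu>)"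
    by (simp only: pw)
  then have "Ent \<nu> \<mu> + (?N + 1) = ?P + 1"
    by (simp add: nn_integral_add nn_integral_rho Ent_eq M.emeasure_space_1)
  then have "1 + (Ent \<nu> \<mu> + ?N) = 1 + ?P" by (simp add: ac_simps)
  then have "Ent \<nu> \<mu> + ?N = ?P"
    unfolding ennreal_add_left_cancel by simp
  then have "enn2ereal ?P = enn2ereal (Ent \<nu> \<mu>) + enn2ereal ?N"
    by (simp flip: plus_ennreal.rep_eq)
  moreover obtain r where "enn2ereal ?N = ereal r" using N by (cases ?N) auto
  ultimately show ?thesis unfolding KL
    by (cases "enn2ereal (Ent \<nu> \<mu>)") auto
qed

text \<open>Integrates the tangent inequality \<open>ent_ge\<close> over \<open>A\<close> and uses
  \<open>ent_nonneg\<close> off \<open>A\<close>. The free parameter \<open>s\<close> trades the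
  entropy bound against the \<mu>-measure of \<open>A\<close>.\<close>

lemma measure_ln_le:
  assumes A: "A \<in> sets \<mu>" and s: "1 < s" and K: "Ent \<nu> \<mu> \<le> ennreal K" "0 \<le> K"
  shows "measure \<nu> A * ln s \<le> K + (s - 1) * measure \<mu> A"
proof -
  have "ennreal (\<rho> x * ln s * indicator A x) \<le> ennreal (ent (\<rho> x)) + ennreal ((s - 1) * indicator A x)" for x
  proof -
    have "\<rho> x * ln s * indicator A x \<le> ent (\<rho> x) + (s - 1) * indicator A x"
      using ent_ge[OF rho_nonneg[of x], of s] ent_nonneg[OF rho_nonneg[of x]] s by (auto simp: indicator_def)
    then show ?thesis using s ent_nonneg[OF rho_nonneg[of x]] by (simp flip: ennreal_plus)
  qed
  then have "(\<integral>\<^sup>+x. ennreal (\<rho> x * ln s * indicator A x) \<partial>\<mu>) \<le> (\<integral>\<^sup>+x. ennreal (ent (\<rho> x)) + ennreal ((s - 1) * indicator A x) \<partial>\<mu>)"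
    by (intro nn_integral_mono)
  also have "\<dots> = Ent \<nu> \<mu> + (\<integral>\<^sup>+x. ennreal (s - 1) * indicator A x \<partial>\<mu>)"
    using A s by (subst nn_integral_add) (auto simp: Ent_eq ennreal_mult ennreal_indicator)
  also have "\<dots> \<le> ennreal K + ennreal ((s - 1) * measure \<mu> A)"
    using K A s by (intro add_mono) (auto simp: nn_integral_cmult_indicator M.emeasure_eq_measure ennreal_mult)
  also have "\<dots> = ennreal (K + (s - 1) * measure \<mu> A)" using K s by (simp add: ennreal_plus)
  also have "(\<integral>\<^sup>+x. ennreal (\<rho> x * ln s * indicator A x) \<partial>\<mu>) = (\<integral>\<^sup>+x. ennreal (ln s) * (ennreal (\<rho> x) * indicator A x) \<partial>\<mu>)"
    using s by (intro nn_integral_cong) (auto simp: indicator_def rho_nonneg mult.commute simp flip: ennreal_mult)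
  also have "\<dots> = ennreal (ln s) * emeasure \<nu> A"
    using A by (subst (2) density_rho[symmetric]) (simp add: emeasure_density nn_integral_cmult)
  also have "\<dots> = ennreal (measure \<nu> A * ln s)"
    using s by (simp add: N.emeasure_eq_measure mult.commute flip: ennreal_mult)
  finally show ?thesis using K s by (subst (asm) ennreal_le_iff) auto
qed

end

lemma uniformly_ac_if_bounded_Ent:
  assumes ac: "\<And>n. ac_prob M (N n)" and K: "\<And>n. Ent (N n) M \<le> ennreal K" "0 \<le> K"
  shows "uniformly_ac M N"
  unfolding uniformly_ac_def
proof (intro allI impI)
  fix e :: real assume e: "0 < e"
  \<comment> \<open>Chosen so that \<open>e * ln s\<close> is 2 (K + 1). The threshold 1/(s - 1)
    keeps the term with \<open>measure M A\<close> below 1, so \<open>measure (N n) A * ln s\<close>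
    stays below K + 1.\<close>
  define s where "s = exp (2 * (K + 1) / e)"
  have s: "1 < s" unfolding s_def using K e by simp
  have ls: "ln s = 2 * (K + 1) / e" by (simp add: s_def)
  have "measure (N n) A < e" if A: "A \<in> sets M" "measure M A < 1 / (s - 1)" for A n
  proof -
    interpret ac_prob M "N n" by (rule ac)
    have "measure (N n) A * ln s \<le> K + (s - 1) * measure M A"
      by (rule measure_ln_le[OF A(1) s K])
    also have "\<dots> < K + 1" using A(2) s by (simp add: field_simps)
    also have "\<dots> \<le> e * ln s" using e K by (simp add: ls)
    finally show ?thesis using s by (simp add: mult_less_cancel_right)
  qed
  then show "\<exists>d>0. \<forall>A\<in>sets M. measure M A < d \<longrightarrow> (\<forall>n. measure (N n) A < e)"
    using s by (intro exI[of _ "1 / (s - 1)"]) auto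
qed

text \<open>\<open>t ln s - s + 1 \<le> ent t\<close> for every \<open>s\<close>; take \<open>s\<close> a truncation of the limit density.\<close>

theorem Ent_lower_semicontinuous:
  assumes ac: "\<And>n. ac_prob M (N n)" and acL: "ac_prob M L"
    and conv: "setwise_conv N L"
    and K: "eventually (\<lambda>n. Ent (N n) M \<le> ennreal K) sequentially" "0 \<le> K"
  shows "Ent L M \<le> ennreal K"
proof -
  interpret L: ac_prob M L by fact
  \<comment> \<open>Truncation on both sides: bounds away from 0 and from infinity keep
    \<open>ln (s k x)\<close> bounded, as passing to the setwise limit requires.\<close>
  define s where "s k x = max (1 / real (Suc k)) (min (real (Suc k)) (L.\<rho> x))" for k x
  have [measurable]: "s k \<in> borel_measurable M" for k unfolding s_def by measurable
  have s_pos: "0 < s k x" for k x unfolding s_def by (rule less_le_trans[OF _ max.cobounded1]) simp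
  have k1: "1 / real (Suc k) \<le> real (Suc k)" for k
    by (rule order_trans[of _ 1]) auto
  have s_le: "s k x \<le> real (Suc k)" "1 / real (Suc k) \<le> s k x" for k x
    unfolding s_def using k1[of k] by auto
  have lns: "\<bar>ln (s k x)\<bar> \<le> ln (real (Suc k))" for k x
  proof -
    have "ln (s k x) \<le> ln (real (Suc k))" using s_le[of k x] s_pos[of k x] by simp
    moreover have "ln (1 / real (Suc k)) \<le> ln (s k x)" using s_le(2)[of k x] s_pos[of k x] by (subst ln_le_cancel_iff) auto
    ultimately show ?thesis by (simp add: ln_div abs_le_iff)
  qed
  have s_abs: "\<bar>s k x\<bar> \<le> real (Suc k)" for k x using s_le[of k x] s_pos[of k x] by simp
  have int_s: "integrable M (s k)" for k
    using s_abs by (intro L.M.integrable_const_bound[of _ "real (Suc k)"]) auto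
  define g where "g k x = L.\<rho> x * ln (s k x) - s k x + 1" for k x
  have [measurable]: "g k \<in> borel_measurable M" for k unfolding g_def by measurable
  \<comment> \<open>Fatou's lemma will be applied to \<open>g k\<close>. It equals (\<rho> - s) ln s
    + ent s, and truncating at a number at least 1 and at its reciprocal gives both factors of the
    product the same sign.\<close>
  have g_nonneg: "0 \<le> g k x" for k x
  proof -
    have "0 \<le> (L.\<rho> x - s k x) * ln (s k x)"
    proof (cases "real (Suc k) < L.\<rho> x")
      case True
      then have "s k x = real (Suc k)" unfolding s_def using k1[of k] by (auto simp: max_def min_def)
      then show ?thesis using True by simp
    next
      case False
      show ?thesis
      proof (cases "L.\<rho> x < 1 / real (Suc k)")
        case True
        then have e: "s k x = 1 / real (Suc k)" unfolding s_def using False by (auto simp: max_def min_def)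
        show ?thesis unfolding e using True by (intro mult_nonpos_nonpos) (auto simp: ln_div)
      next
        case F: False
        then have "s k x = L.\<rho> x" unfolding s_def using False by (auto simp: max_def min_def)
        then show ?thesis by simp
      qed
    qed
    moreover have "0 \<le> s k x * ln (s k x) - s k x + 1"
      using ent_nonneg[of "s k x"] s_pos[of k x] by (simp add: ent_def)
    ultimately show ?thesis by (simp add: g_def algebra_simps)
  qed
  have g_int: "integrable M (g k)" for k
    unfolding g_def
    by (intro Bochner_Integration.integrable_add Bochner_Integration.integrable_diff int_s L.M.integrable_const
        L.integrable_rho_mult[of _ "ln (real (Suc k))"] lns) measurable
  have g_le: "(LINT x|M. g k x) \<le> K" for k
  proof (rule tendsto_upperbound)
    have "(\<lambda>n. LINT x|N n. ln (s k x)) \<longlonglongrightarrow> (LINT x|L. ln (s k x))"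
    proof (rule setwise_conv_bounded_integral[OF conv _ L.N.prob_space_axioms])
      show "sets (N n) = sets L" "prob_space (N n)" for n
        using ac[of n] L.sets_eq by (auto simp: ac_prob_def ac_prob_axioms_def)
      show "(\<lambda>x. ln (s k x)) \<in> borel_measurable L"
        unfolding measurable_cong_sets[OF L.sets_eq refl] by measurable
    qed (rule lns)
    then have "(\<lambda>n. (LINT x|N n. ln (s k x)) - (LINT x|M. s k x) + 1) \<longlonglongrightarrow> (LINT x|L. ln (s k x)) - (LINT x|M. s k x) + 1"
      by (intro tendsto_intros)
    also have "(LINT x|L. ln (s k x)) - (LINT x|M. s k x) + 1 = (LINT x|M. g k x)"
      unfolding g_def using int_s L.integrable_rho_mult[of "\<lambda>x. ln (s k x)" "ln (real (Suc k))", OF _ lns]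
      by (subst L.integral_density_rho) (auto simp: L.M.prob_space)
    finally show "(\<lambda>n. (LINT x|N n. ln (s k x)) - (LINT x|M. s k x) + 1) \<longlonglongrightarrow> (LINT x|M. g k x)" .
    show "eventually (\<lambda>n. (LINT x|N n. ln (s k x)) - (LINT x|M. s k x) + 1 \<le> K) sequentially"
      using K(1)
    proof eventually_elim
      fix n assume n: "Ent (N n) M \<le> ennreal K"
      interpret n: ac_prob M "N n" by (rule ac)
      let ?h = "\<lambda>x. n.\<rho> x * ln (s k x) - s k x + 1"
      have h_int: "integrable M ?h"
        by (intro Bochner_Integration.integrable_add Bochner_Integration.integrable_diff int_s L.M.integrable_const
          n.integrable_rho_mult[of _ "ln (real (Suc k))"] lns) measurable
      have "(LINT x|N n. ln (s k x)) - (LINT x|M. s k x) + 1 = (LINT x|M. ?h x)"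
        using int_s n.integrable_rho_mult[of "\<lambda>x. ln (s k x)" "ln (real (Suc k))", OF _ lns]
        by (subst n.integral_density_rho) (auto simp: L.M.prob_space)
      \<comment> \<open>\<open>?h\<close> may be negative, because \<open>s k\<close> truncates the
        density of \<open>L\<close> and not that of \<open>N n\<close>. Its positive part still lies
        below the entropy integrand.\<close>
      also have "\<dots> \<le> (LINT x|M. max 0 (?h x))"
        using h_int by (intro integral_mono integrable_max) auto
      also have "\<dots> \<le> K"
      proof -
        have "ennreal (LINT x|M. max 0 (?h x)) = (\<integral>\<^sup>+x. ennreal (max 0 (?h x)) \<partial>M)"
          using h_int by (intro nn_integral_eq_integral[symmetric] integrable_max) auto
        also have "\<dots> \<le> (\<integral>\<^sup>+x. ennreal (ent (n.\<rho> x)) \<partial>M)"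
          using ent_ge[OF n.rho_nonneg s_pos] ent_nonneg[OF n.rho_nonneg]
          by (intro nn_integral_mono ennreal_leI) auto
        also have "\<dots> \<le> ennreal K" using n by (simp add: n.Ent_eq)
        finally show ?thesis using K(2) by (simp add: ennreal_le_iff)
      qed
      finally show "(LINT x|N n. ln (s k x)) - (LINT x|M. s k x) + 1 \<le> K" .
    qed
  qed simp
  have lim: "(\<lambda>k. g k x) \<longlonglongrightarrow> ent (L.\<rho> x)" for x
  proof (cases "L.\<rho> x = 0")
    case True
    then have "s k x = 1 / real (Suc k)" for k unfolding s_def by (auto simp: max_def min_def)
    then have "g k x = - (1 / real (Suc k)) + 1" for k using True by (simp add: g_def)
    moreover have "(\<lambda>k. - (1 / real (Suc k)) + 1) \<longlonglongrightarrow> - 0 + 1"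
      by (intro tendsto_intros LIMSEQ_inverse_real_of_nat[unfolded inverse_eq_divide])
    ultimately show ?thesis using True by (simp add: ent_def)
  next
    case False
    then have pos: "0 < L.\<rho> x" using L.rho_nonneg[of x] by simp
    obtain n1 where n1: "L.\<rho> x < real n1" using reals_Archimedean2 by blast
    obtain n2 where n2: "1 / real (Suc n2) < L.\<rho> x" using nat_approx_posE[OF pos] by auto
    have "g k x = ent (L.\<rho> x)" if "max n1 n2 \<le> k" for k
    proof -
      have "1 / real (Suc k) \<le> 1 / real (Suc n2)" using that by (simp add: frac_le)
      moreover have "real n1 \<le> real (Suc k)" using that by simp
      ultimately have "s k x = L.\<rho> x" unfolding s_def using n1 n2 by (simp add: max_def min_def)
      then show ?thesis by (simp add: g_def ent_def)
    qed
    then have "eventually (\<lambda>k. g k x = ent (L.\<rho> x)) sequentially"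
      unfolding eventually_sequentially by blast
    then show ?thesis by (rule tendsto_eventually)
  qed
  have "Ent L M = (\<integral>\<^sup>+x. liminf (\<lambda>k. ennreal (g k x)) \<partial>M)"
    unfolding L.Ent_eq
    by (intro nn_integral_cong lim_imp_Liminf[symmetric] tendsto_ennrealI lim) simp
  also have "\<dots> \<le> liminf (\<lambda>k. \<integral>\<^sup>+x. ennreal (g k x) \<partial>M)"
    by (rule nn_integral_liminf) measurable
  also have "\<dots> \<le> ennreal K"
  proof -
    have "(\<integral>\<^sup>+x. ennreal (g k x) \<partial>M) \<le> ennreal K" for k
      using g_le[of k] g_nonneg by (subst nn_integral_eq_integral[OF g_int]) (auto intro: ennreal_leI)
    then show ?thesis by (intro Liminf_le) (auto)
  qed
  finally show ?thesis .
qed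

section \<open>Limits and shifts of Gaussian measures\<close>

lemma gaussian_char_inj:
  fixes m m' v v' :: real
  assumes eq: "\<And>t::real. exp (\<i> * (t * m) - v * t\<^sup>2 / 2) = exp (\<i> * (t * m') - v' * t\<^sup>2 / 2)"
  shows "m = m'" "v = v'"
proof -
  have "norm (exp (\<i> * (1 * m) - v * 1\<^sup>2 / 2)) = norm (exp (\<i> * (1 * m') - v' * 1\<^sup>2 / 2))"
    using eq[of 1] by simp
  then show v: "v = v'" by (simp add: norm_exp_eq_Re)
  show "m = m'"
  proof (rule ccontr)
    assume ne: "m \<noteq> m'"
    \<comment> \<open>At this frequency the two phases differ by pi, so the two sides would be
      nonzero and opposite.\<close>
    define t where "t = pi / (m - m')"
    have "\<i> * (t * m) - v * t\<^sup>2 / 2 = \<i> * complex_of_real pi + (\<i> * (t * m') - v * t\<^sup>2 / 2)"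
    proof -
      have "t * m = pi + t * m'" using ne by (simp add: t_def field_simps)
      then have "complex_of_real (t * m) = complex_of_real pi + complex_of_real (t * m')" by (simp only: of_real_add)
      then show ?thesis by (simp add: distrib_left del: of_real_mult)
    qed
    then have "exp (\<i> * (t * m') - v * t\<^sup>2 / 2) = exp (\<i> * complex_of_real pi) * exp (\<i> * (t * m') - v * t\<^sup>2 / 2)"
      using eq[of t] unfolding v by (simp only: exp_add)
    then show False by (simp add: exp_pi_i')
  qed
qed

lemma gaussian_realI_moments:
  assumes "real_distribution \<kappa>" "0 \<le> v" and eq: "\<And>t. char \<kappa> t = exp (\<i> * (t * m) - v * t\<^sup>2 / 2)"
  shows "gaussian_real \<kappa>" "(LINT x|\<kappa>. x) = m" "(LINT x|\<kappa>. (x - (LINT x|\<kappa>. x))\<^sup>2) = v"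
proof -
  show g: "gaussian_real \<kappa>" by (rule gaussian_realI[OF assms])
  show "(LINT x|\<kappa>. x) = m" "(LINT x|\<kappa>. (x - (LINT x|\<kappa>. x))\<^sup>2) = v"
    using gaussian_char_inj[of "LINT x|\<kappa>. x" "LINT x|\<kappa>. (x - (LINT x|\<kappa>. x))\<^sup>2" m v]
    unfolding gaussian_real_moments(5)[OF g, symmetric] eq by blast+
qed

text \<open>By Chebyshev, mass at most 1/4 lies two standard deviations or more from the mean. An
  interval of larger mass must therefore come within that distance of it.\<close>

lemma gaussian_real_mean_bound:
  assumes g: "gaussian_real \<kappa>" and R: "1 / 4 < measure \<kappa> {- R..R}"
    and V: "(LINT x|\<kappa>. (x - (LINT x|\<kappa>. x))\<^sup>2) \<le> V" "0 < V"
  shows "\<bar>LINT x|\<kappa>. x\<bar> \<le> R + 2 * sqrt V"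
proof (rule ccontr)
  let ?m = "LINT x|\<kappa>. x"
  note gm = gaussian_real_moments[OF g]
  interpret real_distribution \<kappa> by (rule gm)
  assume "\<not> ?thesis"
  then have "{- R..R} \<subseteq> {x \<in> space \<kappa>. 2 * sqrt V \<le> \<bar>x - ?m\<bar>}" by auto
  then have "measure \<kappa> {- R..R} \<le> measure \<kappa> {x \<in> space \<kappa>. 2 * sqrt V \<le> \<bar>x - ?m\<bar>}"
    by (intro finite_measure_mono) auto
  also have "\<dots> \<le> (LINT x|\<kappa>. (x - ?m)\<^sup>2) / (2 * sqrt V)\<^sup>2"
  proof (rule Chebyshev_inequality)
    show "(\<lambda>x. x) \<in> borel_measurable \<kappa>" by simp
    show "integrable \<kappa> (\<lambda>x. x\<^sup>2)" by (rule gm(3))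
    show "0 < 2 * sqrt V" using V by simp
  qed
  also have "\<dots> \<le> 1 / 4" using V by (simp add: power_mult_distrib)
  finally show False using R by simp
qed

text \<open>The modulus of a Gaussian characteristic function does not see the mean, so one
  frequency with nonzero limit determines the limit of the variances. The means are then bounded
  because the limit keeps mass on a bounded interval, and a convergent subsequence identifies the
  limiting characteristic function.\<close>

lemma gaussian_real_setwise_limit:
  assumes g: "\<And>n. gaussian_real (\<kappa> n)" and L: "real_distribution \<kappa>'" and conv: "setwise_conv \<kappa> \<kappa>'"
  shows "gaussian_real \<kappa>'"
    "(\<lambda>n. LINT x|\<kappa> n. (x - (LINT x|\<kappa> n. x))\<^sup>2) \<longlonglongrightarrow> (LINT x|\<kappa>'. (x - (LINT x|\<kappa>'. x))\<^sup>2)"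
    "\<exists>r. strict_mono r \<and> (\<lambda>n. LINT x|\<kappa> (r n). x) \<longlonglongrightarrow> (LINT x|\<kappa>'. x)"
proof -
  interpret L: real_distribution \<kappa>' by fact
  define m where "m n = (LINT x|\<kappa> n. x)" for n
  define v where "v n = (LINT x|\<kappa> n. (x - (LINT x|\<kappa> n. x))\<^sup>2)" for n
  note gm = gaussian_real_moments[OF g, folded v_def, folded m_def]
  have rd: "real_distribution (\<kappa> n)" for n by (rule gm)
  have sets: "sets (\<kappa> n) = sets borel" for n using rd[of n] by (simp add: real_distribution_def real_distribution_axioms_def)
  have "(\<lambda>n. char (distr (\<kappa> n) borel (\<lambda>x. x)) t) \<longlonglongrightarrow> char (distr \<kappa>' borel (\<lambda>x. x)) t" for t
    using rd by (intro setwise_conv_char[OF conv]) (auto simp: sets real_distribution_def L.prob_space_axioms)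
  then have conv_char: "(\<lambda>n. char (\<kappa> n) t) \<longlonglongrightarrow> char \<kappa>' t" for t
    by (simp add: distr_id2 sets)
  \<comment> \<open>The limiting characteristic function is continuous with value 1 at 0, so a
    nonzero frequency at which the logarithm below is continuous exists.\<close>
  have "eventually (\<lambda>t. char \<kappa>' t \<noteq> 0) (at 0)"
    using L.isCont_char[of 0] L.char_zero by (intro tendsto_imp_eventually_ne[of _ "char \<kappa>' 0"]) (auto simp: isCont_def)
  then obtain t where t: "t \<noteq> 0" "char \<kappa>' t \<noteq> 0"
    unfolding eventually_at by (metis dist_real_def diff_zero dense abs_of_pos UNIV_I less_irrefl)
  have nc: "norm (char (\<kappa> n) t) = exp (- v n * t\<^sup>2 / 2)" for n
    unfolding gm(5) by (simp add: norm_exp_eq_Re)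
  have "(\<lambda>n. ln (norm (char (\<kappa> n) t))) \<longlonglongrightarrow> ln (norm (char \<kappa>' t))"
    using t by (intro tendsto_intros conv_char) auto
  then have "(\<lambda>n. - v n * t\<^sup>2 / 2) \<longlonglongrightarrow> ln (norm (char \<kappa>' t))" unfolding nc by simp
  from tendsto_mult[OF this tendsto_const[of "- 2 / t\<^sup>2"]]
  have vl: "v \<longlonglongrightarrow> ln (norm (char \<kappa>' t)) * (- 2 / t\<^sup>2)" using t by simp
  define v' where "v' = ln (norm (char \<kappa>' t)) * (- 2 / t\<^sup>2)"
  have vl: "v \<longlonglongrightarrow> v'" using vl unfolding v'_def .
  have v': "0 \<le> v'" using LIMSEQ_le_const[OF vl] gm(4) by blast
  have "(\<lambda>n. measure \<kappa>' {- real n..real n}) \<longlonglongrightarrow> measure \<kappa>' (\<Union>n. {- real n..real n})"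
    by (intro L.finite_Lim_measure_incseq) (auto simp: incseq_def)
  also have "(\<Union>n. {- real n..real n}) = UNIV"
  proof -
    have "x \<in> (\<Union>n. {- real n..real n})" for x
    proof -
      obtain n where "\<bar>x\<bar> \<le> real n" using real_arch_simple by blast
      then show ?thesis by (intro UN_I[of n]) auto
    qed
    then show ?thesis by blast
  qed
  finally have "(\<lambda>n. measure \<kappa>' {- real n..real n}) \<longlonglongrightarrow> 1" using L.prob_space by simp
  then have "eventually (\<lambda>n. 1 / 4 < measure \<kappa>' {- real n..real n}) sequentially"
    by (rule order_tendstoD) simp
  then obtain R where R: "1 / 4 < measure \<kappa>' {- real R..real R}" by (auto simp: eventually_sequentially)
  have "eventually (\<lambda>n. 1 / 4 < measure (\<kappa> n) {- real R..real R}) sequentially"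
    using conv R unfolding setwise_conv_def by (intro order_tendstoD) auto
  moreover have "eventually (\<lambda>n. v n < v' + 1) sequentially" using vl by (rule order_tendstoD) simp
  ultimately have "eventually (\<lambda>n. \<bar>m n\<bar> \<le> real R + 2 * sqrt (v' + 1)) sequentially"
  proof eventually_elim
    case (elim n)
    then show ?case
      using v' unfolding m_def v_def by (intro gaussian_real_mean_bound[OF g]) auto
  qed
  then obtain n0 where n0: "\<And>n. n0 \<le> n \<Longrightarrow> \<bar>m n\<bar> \<le> real R + 2 * sqrt (v' + 1)"
    unfolding eventually_sequentially by blast
  define b where "b = real R + 2 * sqrt (v' + 1)"
  have "\<And>n. m (n + n0) \<in> {-b..b}"
    using n0 unfolding b_def[symmetric] by (simp add: abs_le_iff minus_le_iff)
  then obtain m' r where r: "strict_mono r" "((\<lambda>n. m (n + n0)) \<circ> r) \<longlonglongrightarrow> m'"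
    using compact_Icc[of "-b" b] compact_imp_seq_compact seq_compactE by metis
  define r' where "r' n = r n + n0" for n
  have r': "strict_mono r'" using r(1) by (simp add: r'_def strict_mono_def)
  have ml: "(\<lambda>n. m (r' n)) \<longlonglongrightarrow> m'" using r(2) by (simp add: o_def r'_def)
  have "char \<kappa>' t = exp (\<i> * (t * m') - v' * t\<^sup>2 / 2)" for t
  proof (rule LIMSEQ_unique)
    show "(\<lambda>n. char (\<kappa> (r' n)) t) \<longlonglongrightarrow> char \<kappa>' t"
      using LIMSEQ_subseq_LIMSEQ[OF conv_char r', of t] by (simp add: o_def)
    have "(\<lambda>n. v (r' n)) \<longlonglongrightarrow> v'" using LIMSEQ_subseq_LIMSEQ[OF vl r'] by (simp add: o_def)
    then show "(\<lambda>n. char (\<kappa> (r' n)) t) \<longlonglongrightarrow> exp (\<i> * (t * m') - v' * t\<^sup>2 / 2)"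
      unfolding gm(5) using ml by (intro tendsto_intros) auto
  qed
  note gi = gaussian_realI_moments[OF L v' this]
  show "gaussian_real \<kappa>'" by (rule gi)
  show "(\<lambda>n. LINT x|\<kappa> n. (x - (LINT x|\<kappa> n. x))\<^sup>2) \<longlonglongrightarrow> (LINT x|\<kappa>'. (x - (LINT x|\<kappa>'. x))\<^sup>2)"
    unfolding gi(3) using vl unfolding v_def[abs_def] .
  show "\<exists>r. strict_mono r \<and> (\<lambda>n. LINT x|\<kappa> (r n). x) \<longlonglongrightarrow> (LINT x|\<kappa>'. x)"
    unfolding gi(2) using r' ml by (auto simp: m_def)
qed

lemma gaussian_measureI: "gaussian \<nu> \<Longrightarrow> gaussian_measure \<nu>"
  by (simp add: gaussian_measure_def gaussian_measure_axioms_def gaussian_def)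

lemma setwise_conv_distr:
  fixes f :: "'a \<Rightarrow> 'b::topological_space"
  assumes conv: "setwise_conv N M" and sets: "\<And>n. sets (N n) = sets M" and f: "f \<in> borel_measurable M"
  shows "setwise_conv (\<lambda>n. distr (N n) borel f) (distr M borel f)"
proof -
  have fN: "f \<in> borel_measurable (N n)" for n
    unfolding measurable_cong_sets[OF sets[of n] refl] by (rule f)
  have sp: "space (N n) = space M" for n using sets_eq_imp_space_eq[OF sets] .
  show ?thesis
    using conv f fN unfolding setwise_conv_def by (auto simp: measure_distr sp)
qed

text \<open>Being Gaussian is a condition on each functional separately, so the result on the line
  suffices. The subsequence for the means may depend on \<open>h\<close>.\<close>

theorem gaussian_setwise_limit:
  fixes N :: "nat \<Rightarrow> 'h::{real_inner, polish_space} measure"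
  assumes g: "\<And>n. gaussian (N n)" and L: "prob_space L" "sets L = sets borel" and conv: "setwise_conv N L"
  shows "gaussian L"
    "(\<lambda>n. gcov (N n) h h) \<longlonglongrightarrow> gcov L h h"
    "\<exists>r. strict_mono r \<and> (\<lambda>n. gmean (N (r n)) h) \<longlonglongrightarrow> gmean L h"
proof -
  note [measurable_cong] = L(2)
  have sN: "sets (N n) = sets L" for n using g[of n] L by (simp add: gaussian_def)
  have *: "real_distribution (distr L borel f)" "setwise_conv (\<lambda>n. distr (N n) borel f) (distr L borel f)"
      "\<And>n. gaussian_real (distr (N n) borel f)"
    if f: "bounded_linear f" for f :: "'h \<Rightarrow> real"
  proof -
    have fm: "f \<in> borel_measurable L"
      unfolding measurable_cong_sets[OF L(2) refl]
      using linear_continuous_on[OF f] by (rule borel_measurable_continuous_onI)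
    show "real_distribution (distr L borel f)"
      using prob_space.prob_space_distr[OF L(1) fm] by (simp add: real_distribution_def real_distribution_axioms_def)
    show "setwise_conv (\<lambda>n. distr (N n) borel f) (distr L borel f)" by (rule setwise_conv_distr[OF conv sN fm])
    show "gaussian_real (distr (N n) borel f)" for n using g f by (simp add: gaussian_def)
  qed
  have "gaussian_real (distr L borel f)" if f: "bounded_linear f" for f :: "'h \<Rightarrow> real"
    by (rule gaussian_real_setwise_limit(1)[OF *(3)[OF f] *(1)[OF f] *(2)[OF f]])
  then show gL: "gaussian L" using L by (simp add: gaussian_def)
  interpret L: gaussian_measure L by (rule gaussian_measureI) fact
  interpret N: gaussian_measure "N n" for n by (rule gaussian_measureI) fact
  have f: "bounded_linear (\<lambda>x::'h. x \<bullet> h)" by (rule bounded_linear_inner_left)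
  note lim = gaussian_real_setwise_limit[OF *(3)[OF f] *(1)[OF f] *(2)[OF f]]
  show "(\<lambda>n. gcov (N n) h h) \<longlonglongrightarrow> gcov L h h"
    using lim(2) N.marginal_var L.marginal_var unfolding N.marginal_def L.marginal_def by simp
  show "\<exists>r. strict_mono r \<and> (\<lambda>n. gmean (N (r n)) h) \<longlonglongrightarrow> gmean L h"
    using lim(3) N.marginal_mean L.marginal_mean unfolding N.marginal_def L.marginal_def by simp
qed

lemma char_functional_distr_inner:
  fixes M :: "'h::{real_inner, polish_space} measure"
  assumes "sets M = sets borel"
  shows "char (distr M borel (\<lambda>x. x \<bullet> h)) 1 = char_functional M h"
proof -
  have "(\<lambda>x. x \<bullet> h) \<in> borel_measurable M"
    unfolding measurable_cong_sets[OF assms refl] by simp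
  then show ?thesis unfolding char_def char_functional_def by (subst integral_distr) auto
qed

section \<open>Shifts and the Cameron-Martin theorem\<close>

context gaussian_measure begin

lemma char_functional_shift:
  "char_functional (distr \<nu> borel (\<lambda>x. x + h)) k = exp (\<i> * (gmean \<nu> k + h \<bullet> k) - gcov \<nu> k k / 2)"
proof -
  have "char_functional (distr \<nu> borel (\<lambda>x. x + h)) k = (CLINT x|\<nu>. iexp (x \<bullet> k) * iexp (h \<bullet> k))"
    unfolding char_functional_def by (subst integral_distr) (auto simp: inner_add_left exp_add distrib_left)
  also have "\<dots> = char_functional \<nu> k * iexp (h \<bullet> k)"
    unfolding char_functional_def by simp
  finally show ?thesis
    by (simp add: char_functional_eq algebra_simps flip: exp_add)
qed

lemma prob_space_shift: "prob_space (distr \<nu> borel (\<lambda>x. x + h))"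
  by (rule prob_space_distr) measurable

text \<open>Cameron-Martin for shifts representing \<open>gcov \<nu> k\<close>: both sides have the
  same characteristic functional.\<close>

lemma shift_eq_tilt:
  assumes "\<And>y. h \<bullet> y = gcov \<nu> k y"
  shows "distr \<nu> borel (\<lambda>x. x + h) = tilt \<nu> k"
  using prob_space_shift[of h] prob_space_tilt[of k]
  by (intro char_functional_unique) (auto simp: char_functional_shift char_functional_tilt assms prob_space.finite_measure)

text \<open>A bound on the second moments of the densities gives uniform integrability, and by
  \<open>tilt_square\<close> that moment is the exponential of
  \<open>gcov \<nu> (k n) (k n)\<close>.\<close>

lemma uniformly_ac_tilt:
  assumes q: "\<And>n. gcov \<nu> (k n) (k n) \<le> q"
  shows "uniformly_ac \<nu> (\<lambda>n. tilt \<nu> (k n))"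
  unfolding uniformly_ac_def
proof (intro allI impI)
  fix e :: real assume e: "0 < e"
  \<comment> \<open>Splitting the density at height \<open>s\<close> leaves a second-moment term of
    at most exp q / s = e/2; the threshold e/(2 s) for \<open>measure \<nu> A\<close> takes care of
    the other half.\<close>
  define s where "s = 2 * exp q / e"
  have s: "0 < s" using e by (simp add: s_def)
  have "measure (tilt \<nu> (k n)) A < e" if A: "A \<in> sets \<nu>" "measure \<nu> A < e / (2 * s)" for A n
  proof -
    let ?w = "\<lambda>x. exp (x \<bullet> k n - gmean \<nu> (k n) - gcov \<nu> (k n) (k n) / 2)"
    note [measurable] = A(1)
    interpret T: prob_space "tilt \<nu> (k n)" by (rule prob_space_tilt)
    have ind: "integrable \<nu> (\<lambda>x. s * indicator A x :: real)"
      using A by (intro integrable_mult_right integrable_real_indicator) (auto simp: emeasure_eq_measure)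
    have bd: "?w x * indicator A x \<le> s * indicator A x + (?w x)\<^sup>2 / s" for x
    proof -
      have "w \<le> s + w\<^sup>2 / s" if "0 < w" for w
      proof (cases "w \<le> s")
        case False
        then have "w * s \<le> w * w" using that by (intro mult_left_mono) auto
        then show ?thesis using s by (simp add: field_simps power2_eq_square add_increasing)
      qed (use s in \<open>simp add: add_increasing2\<close>)
      then show ?thesis using s by (auto simp: indicator_def)
    qed
    have "emeasure (tilt \<nu> (k n)) A = (\<integral>\<^sup>+x. ennreal (?w x * indicator A x) \<partial>\<nu>)"
      unfolding tilt_def using A by (subst emeasure_density) (auto simp: ennreal_mult' ennreal_indicator)
    also have "\<dots> \<le> (\<integral>\<^sup>+x. ennreal (s * indicator A x + (?w x)\<^sup>2 / s) \<partial>\<nu>)"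
      using bd by (intro nn_integral_mono ennreal_leI)
    also have "\<dots> = ennreal (LINT x|\<nu>. s * indicator A x + (?w x)\<^sup>2 / s)"
      using s by (intro nn_integral_eq_integral Bochner_Integration.integrable_add ind integrable_divide_zero tilt_square(2)) auto
    also have "(LINT x|\<nu>. s * indicator A x + (?w x)\<^sup>2 / s) = s * measure \<nu> A + exp (gcov \<nu> (k n) (k n)) / s"
      using tilt_square[of "k n"] ind by simp
    finally have "measure (tilt \<nu> (k n)) A \<le> s * measure \<nu> A + exp (gcov \<nu> (k n) (k n)) / s"
      using s by (subst (asm) T.emeasure_eq_measure, subst (asm) ennreal_le_iff) auto
    also have "\<dots> < s * (e / (2 * s)) + exp q / s"
      using A(2) q[of n] s by (intro add_less_le_mono mult_strict_left_mono divide_right_mono) auto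
    also have "\<dots> = e" using e by (simp add: s_def)
    finally show ?thesis .
  qed
  then show "\<exists>d>0. \<forall>A\<in>sets \<nu>. measure \<nu> A < d \<longrightarrow> (\<forall>n. measure (tilt \<nu> (k n)) A < e)"
    using e s by (intro exI[of _ "e / (2 * s)"]) auto
qed

text \<open>The shift by \<open>h\<close> is a setwise limit of tilts, so the Cameron--Martin density is not needed.\<close>

theorem shift_absolutely_continuous:
  assumes h: "\<And>k. (h \<bullet> k)\<^sup>2 \<le> c * gcov \<nu> k k" and c: "0 \<le> c"
  shows "absolutely_continuous \<nu> (distr \<nu> borel (\<lambda>x. x + h))"
proof -
  have "\<exists>k. gcov \<nu> k k \<le> 4 * c + 2 * (1 / real (Suc n)) \<and> (\<forall>y. (gcov \<nu> k y - h \<bullet> y)\<^sup>2 \<le> 1 / real (Suc n) * gcov \<nu> y y)" for n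
    by (rule approximate_representation) (auto simp: inner_add_right h c)
  then obtain k where k: "\<And>n. gcov \<nu> (k n) (k n) \<le> 4 * c + 2 * (1 / real (Suc n))"
    "\<And>n y. (gcov \<nu> (k n) y - h \<bullet> y)\<^sup>2 \<le> 1 / real (Suc n) * gcov \<nu> y y" by metis
  have "gcov \<nu> (k n) (k n) \<le> 4 * c + 2" for n
  proof -
    have "1 / real (Suc n) \<le> 1" by simp
    then show ?thesis using k(1)[of n] by linarith
  qed
  from uniformly_ac_tilt[of k, OF this]
  obtain r L where r: "strict_mono r" and L: "prob_space L" "sets L = sets borel" "absolutely_continuous \<nu> L"
      "setwise_conv (\<lambda>n. tilt \<nu> (k (r n))) L"
    using setwise_compact[OF prob_space_axioms sets_eq prob_space_tilt sets_tilt, of k] by blast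
  note [measurable_cong] = L(2)
  have kl: "(\<lambda>n. gcov \<nu> (k n) y) \<longlonglongrightarrow> h \<bullet> y" for y
  proof -
    have "(\<lambda>n. 1 / real (Suc n) * gcov \<nu> y y) \<longlonglongrightarrow> 0 * gcov \<nu> y y"
      by (intro tendsto_mult tendsto_const LIMSEQ_inverse_real_of_nat[unfolded inverse_eq_divide])
    then have g0: "(\<lambda>n. 1 / real (Suc n) * gcov \<nu> y y) \<longlonglongrightarrow> 0" by (simp only: mult_zero_left)
    have "eventually (\<lambda>n. norm ((gcov \<nu> (k n) y - h \<bullet> y)\<^sup>2) \<le> 1 / real (Suc n) * gcov \<nu> y y) sequentially"
      by (intro always_eventually allI) (simp only: real_norm_def abs_power2 k(2))
    from Lim_null_comparison[OF this g0]
    have "(\<lambda>n. gcov \<nu> (k n) y - h \<bullet> y) \<longlonglongrightarrow> 0" by simp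
    then show ?thesis using LIM_zero_iff by blast
  qed
  \<comment> \<open>The means of the tilts converge to the shifted mean in every direction, and the
    covariance never changes; this identifies the setwise limit.\<close>
  have "char_functional L y = char_functional (distr \<nu> borel (\<lambda>x. x + h)) y" for y
  proof (rule LIMSEQ_unique)
    have "(\<lambda>n. char (distr (tilt \<nu> (k (r n))) borel (\<lambda>x. x \<bullet> y)) 1) \<longlonglongrightarrow> char (distr L borel (\<lambda>x. x \<bullet> y)) 1"
      by (rule setwise_conv_char[OF L(4) _ L(1) prob_space_tilt]) (auto simp: L(2))
    then show "(\<lambda>n. char_functional (tilt \<nu> (k (r n))) y) \<longlonglongrightarrow> char_functional L y"
      by (simp add: char_functional_distr_inner L(2))
    have "(\<lambda>n. gcov \<nu> (k (r n)) y) \<longlonglongrightarrow> h \<bullet> y"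
      using LIMSEQ_subseq_LIMSEQ[OF kl r, of y] by (simp add: o_def)
    then show "(\<lambda>n. char_functional (tilt \<nu> (k (r n))) y) \<longlonglongrightarrow> char_functional (distr \<nu> borel (\<lambda>x. x + h)) y"
      unfolding char_functional_tilt char_functional_shift by (intro tendsto_intros) auto
  qed
  then have "L = distr \<nu> borel (\<lambda>x. x + h)"
    using L prob_space_shift[of h] by (intro char_functional_unique) (auto simp: prob_space.finite_measure)
  then show ?thesis using L(3) by simp
qed

end

section \<open>The Feldman--Hajek dichotomy\<close>

text \<open>Where the density exceeds a large level, \<open>N\<close> has mass below 1/4; elsewhere
  the density is bounded by \<open>K\<close>. The value 1/4 is chosen to be small against the 3/4 of
  \<open>prob_inner_deviation\<close>.\<close>

lemma ac_prob_truncation: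
  assumes "ac_prob M N"
  shows "\<exists>K>0. \<forall>A\<in>sets M. measure N A \<le> 1 / 4 + K * measure M A"
proof -
  interpret ac_prob M N by fact
  note [measurable_cong] = sets_eq
  define S where "S n = {x \<in> space M. real n < \<rho> x}" for n
  have [measurable]: "S n \<in> sets M" for n unfolding S_def by measurable
  have "(\<lambda>n. measure N (S n)) \<longlonglongrightarrow> measure N (\<Inter>n. S n)"
    by (intro N.finite_Lim_measure_decseq) (auto simp: decseq_def S_def sets_eq)
  also have "(\<Inter>n. S n) = {}"
  proof -
    have "\<exists>n. x \<notin> S n" for x
      using real_arch_simple[of "\<rho> x"] by (auto simp: S_def not_less)
    then show ?thesis by blast
  qed
  finally have "eventually (\<lambda>n. measure N (S n) < 1 / 4) sequentially"
    by (intro order_tendstoD) auto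
  then obtain n where n: "measure N (S n) < 1 / 4" by (auto simp: eventually_sequentially)
  define K where "K = real n + 1"
  have "measure N A \<le> 1 / 4 + K * measure M A" if A[measurable]: "A \<in> sets M" for A
  proof -
    have le: "\<rho> x \<le> K" if "x \<in> A - S n" for x
      using that sets.sets_into_space[OF A] by (auto simp: S_def K_def)
    have "emeasure N (A - S n) = (\<integral>\<^sup>+x. ennreal (\<rho> x) * indicator (A - S n) x \<partial>M)"
      by (subst density_rho[symmetric]) (simp add: emeasure_density)
    also have "\<dots> \<le> (\<integral>\<^sup>+x. ennreal K * indicator A x \<partial>M)"
      by (intro nn_integral_mono) (auto simp: indicator_def intro!: ennreal_leI le)
    also have "\<dots> = ennreal (K * measure M A)"
      by (simp add: nn_integral_cmult_indicator M.emeasure_eq_measure K_def ennreal_mult)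
    finally have 1: "measure N (A - S n) \<le> K * measure M A"
      by (subst (asm) N.emeasure_eq_measure, subst (asm) ennreal_le_iff) (auto simp: K_def)
    have "measure N A \<le> measure N (S n \<union> (A - S n))"
      by (intro N.finite_measure_mono) (auto simp: sets_eq)
    also have "\<dots> \<le> measure N (S n) + measure N (A - S n)"
      by (intro measure_Un_le) (auto simp: sets_eq)
    finally show ?thesis using 1 n by linarith
  qed
  then show ?thesis by (intro exI[of _ K]) (auto simp: K_def)
qed

lemma normal_interval_le:
  assumes "0 < \<sigma>" "0 < a"
  shows "measure (density lborel (normal_density m \<sigma>)) {y. \<bar>y - c\<bar> < a} \<le> a / \<sigma>"
proof -
  interpret prob_space "density lborel (normal_density m \<sigma>)" by (rule prob_space_normal_density) fact
  \<comment> \<open>Since sqrt(2 pi) is at least 2, the density is at most 1/(2 \<sigma>), and the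
    interval has length 2 a.\<close>
  have nd: "normal_density m \<sigma> y \<le> 1 / (2 * \<sigma>)" for y
  proof -
    have "2 \<le> sqrt (2 * pi)" using pi_gt3 by (intro real_le_rsqrt) simp
    then have "2 * \<sigma> \<le> sqrt (2 * pi * \<sigma>\<^sup>2)" using assms by (simp add: real_sqrt_mult)
    then have "1 / sqrt (2 * pi * \<sigma>\<^sup>2) \<le> 1 / (2 * \<sigma>)" using assms by (intro divide_left_mono) auto
    moreover have "exp (- (y - m)\<^sup>2 / (2 * \<sigma>\<^sup>2)) \<le> 1" by simp
    ultimately have "1 / sqrt (2 * pi * \<sigma>\<^sup>2) * exp (- (y - m)\<^sup>2 / (2 * \<sigma>\<^sup>2)) \<le> 1 / (2 * \<sigma>) * 1"
      using assms by (intro mult_mono) auto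
    then show ?thesis by (simp add: normal_density_def)
  qed
  have I: "{y. \<bar>y - c\<bar> < a} = {c - a<..<c + a}" by auto
  have "emeasure (density lborel (normal_density m \<sigma>)) {y. \<bar>y - c\<bar> < a} =
     (\<integral>\<^sup>+y. ennreal (normal_density m \<sigma> y) * indicator {c - a<..<c + a} y \<partial>lborel)"
    unfolding I by (subst emeasure_density) auto
  also have "\<dots> \<le> (\<integral>\<^sup>+y. ennreal (1 / (2 * \<sigma>)) * indicator {c - a<..<c + a} y \<partial>lborel)"
    using nd by (intro nn_integral_mono mult_right_mono ennreal_leI) auto
  also have "\<dots> = ennreal (1 / (2 * \<sigma>)) * ennreal (2 * a)"
    using assms by (subst nn_integral_cmult_indicator) auto
  also have "\<dots> = ennreal (a / \<sigma>)" using assms by (simp flip: ennreal_mult)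
  finally show ?thesis
    using assms by (subst (asm) emeasure_eq_measure, subst (asm) ennreal_le_iff) auto
qed

lemma (in gaussian_measure) prob_inner_deviation:
  assumes "4 * gcov \<nu> k k \<le> a\<^sup>2" "0 < a"
  shows "3 / 4 \<le> prob {x. \<bar>x \<bullet> k - gmean \<nu> k\<bar> < a}"
proof -
  have "prob {x \<in> space \<nu>. a \<le> \<bar>x \<bullet> k - expectation (\<lambda>x. x \<bullet> k)\<bar>} \<le> variance (\<lambda>x. x \<bullet> k) / a\<^sup>2"
    by (rule Chebyshev_inequality) (auto intro: integrable_inner_square assms)
  then have "prob {x. a \<le> \<bar>x \<bullet> k - gmean \<nu> k\<bar>} \<le> gcov \<nu> k k / a\<^sup>2"
    by (simp add: gmean_def gcov_def power2_eq_square)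
  also have "\<dots> \<le> 1 / 4" using assms by (simp add: field_simps)
  also have "{x. a \<le> \<bar>x \<bullet> k - gmean \<nu> k\<bar>} = space \<nu> - {x. \<bar>x \<bullet> k - gmean \<nu> k\<bar> < a}" by auto
  finally show ?thesis by (subst (asm) prob_compl) auto
qed

lemma (in gaussian_measure) marginal_normal:
  assumes "0 < gcov \<nu> k k"
  shows "distr \<nu> borel (\<lambda>x. x \<bullet> k) = density lborel (normal_density (gmean \<nu> k) (sqrt (gcov \<nu> k k)))"
  using marginal(7)[OF assms] unfolding marginal_def .

text \<open>If \<nu> had far smaller variance than \<mu> in some direction, a thin slab about its
  mean would have \<nu>-mass at least 3/4 but little \<mu>-mass, against
  \<open>ac_prob_truncation\<close>.\<close>

lemma ac_gaussian_variance_bound: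
  fixes \<mu> \<nu> :: "'h::{real_inner, polish_space} measure"
  assumes g: "gaussian \<mu>" "gaussian \<nu>" and ac: "absolutely_continuous \<mu> \<nu>"
  shows "\<exists>c\<ge>0. \<forall>k. gcov \<mu> k k \<le> c * gcov \<nu> k k"
proof -
  interpret M: gaussian_measure \<mu> by (rule gaussian_measureI) fact
  interpret N: gaussian_measure \<nu> by (rule gaussian_measureI) fact
  have "ac_prob \<mu> \<nu>"
    using ac M.prob_space_axioms N.prob_space_axioms by (simp add: ac_prob_def ac_prob_axioms_def)
  then obtain K where K: "0 < K" "\<And>A. A \<in> sets borel \<Longrightarrow> measure \<nu> A \<le> 1 / 4 + K * measure \<mu> A"
    using ac_prob_truncation by force
  have "gcov \<mu> k k \<le> 64 * K\<^sup>2 * gcov \<nu> k k" for k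
  proof (rule ccontr)
    assume n: "\<not> ?thesis"
    then have pos: "0 < gcov \<mu> k k" using K N.nonneg[of k] by (simp add: not_le le_less_trans[rotated])
    \<comment> \<open>This half-width gives the slab \<mu>-mass at most 1/(4 K), hence \<nu>-mass at
      most 1/2. Chebyshev asks for \<open>a\<^sup>2\<close> to be at least four variances of \<nu>;
      with the square of 4 K this makes the constant 64 K^2.\<close>
    define a where "a = sqrt (gcov \<mu> k k) / (4 * K)"
    have a: "0 < a" using pos K by (simp add: a_def)
    have "a\<^sup>2 = gcov \<mu> k k / (16 * K\<^sup>2)" using pos by (simp add: a_def power_divide power_mult_distrib)
    moreover have "4 * gcov \<nu> k k * (16 * K\<^sup>2) \<le> gcov \<mu> k k" using n by (simp add: mult_ac not_le)
    ultimately have "4 * gcov \<nu> k k \<le> a\<^sup>2" using K by (simp add: pos_le_divide_eq)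
    then have "3 / 4 \<le> measure \<nu> {x. \<bar>x \<bullet> k - gmean \<nu> k\<bar> < a}" using a by (rule N.prob_inner_deviation)
    also have "\<dots> \<le> 1 / 4 + K * measure \<mu> {x. \<bar>x \<bullet> k - gmean \<nu> k\<bar> < a}"
      by (rule K) simp
    also have "measure \<mu> {x. \<bar>x \<bullet> k - gmean \<nu> k\<bar> < a} = measure (distr \<mu> borel (\<lambda>x. x \<bullet> k)) {y. \<bar>y - gmean \<nu> k\<bar> < a}"
      by (subst measure_distr) (auto simp: vimage_def)
    also have "\<dots> \<le> a / sqrt (gcov \<mu> k k)"
      unfolding M.marginal_normal[OF pos] using pos a by (intro normal_interval_le) auto
    also have "\<dots> = 1 / (4 * K)" using pos by (simp add: a_def)
    finally show False using K by simp
  qed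
  then show ?thesis by (intro exI[of _ "64 * K\<^sup>2"]) auto
qed

lemma nn_integral_gaussian_exp:
  fixes q c :: real
  assumes q: "0 < q"
  shows "(\<integral>\<^sup>+t. ennreal (exp (t * c - t\<^sup>2 * q / 2)) \<partial>lborel) = ennreal (sqrt (2 * pi / q) * exp (c\<^sup>2 / (2 * q)))"
proof -
  have "exp (t * c - t\<^sup>2 * q / 2) = (sqrt (2 * pi / q) * exp (c\<^sup>2 / (2 * q))) * normal_density (c / q) (1 / sqrt q) t" for t
  proof -
    have "t * c - t\<^sup>2 * q / 2 = c\<^sup>2 / (2 * q) + - (t - c / q)\<^sup>2 / (2 * (1 / sqrt q)\<^sup>2)"
      using q by (simp add: field_simps power2_eq_square)
    moreover have "sqrt (2 * pi / q) * (1 / sqrt (2 * pi * (1 / sqrt q)\<^sup>2)) = 1"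
      using q by (simp add: power_divide)
    ultimately show ?thesis
      unfolding normal_density_def by (simp only: exp_add) (simp add: mult_ac)
  qed
  then have "(\<integral>\<^sup>+t. ennreal (exp (t * c - t\<^sup>2 * q / 2)) \<partial>lborel) =
     (\<integral>\<^sup>+t. ennreal (sqrt (2 * pi / q) * exp (c\<^sup>2 / (2 * q))) * ennreal (normal_density (c / q) (1 / sqrt q) t) \<partial>lborel)"
    using q by (simp add: ennreal_mult)
  also have "\<dots> = ennreal (sqrt (2 * pi / q) * exp (c\<^sup>2 / (2 * q))) * (\<integral>\<^sup>+t. ennreal (normal_density (c / q) (1 / sqrt q) t) \<partial>lborel)"
    by (rule nn_integral_cmult) simp
  also have "(\<integral>\<^sup>+t. ennreal (normal_density (c / q) (1 / sqrt q) t) \<partial>lborel) = 1"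
    using q by (subst nn_integral_eq_integral) auto
  finally show ?thesis by simp
qed

section \<open>Shift-invariant sets and the zero-one law\<close>

context gaussian_measure begin

text \<open>Averaging the Cameron--Martin formula over all shifts in one direction makes \<open>B\<close>
  independent of the corresponding functional.\<close>

lemma shift_invariant_independent:
  assumes B[measurable]: "B \<in> sets borel" and q: "0 < gcov \<nu> k k" and h: "\<And>y. h \<bullet> y = gcov \<nu> k y"
    and inv: "\<And>t. AE x in \<nu>. x \<in> B \<longleftrightarrow> x + t *\<^sub>R h \<in> B"
    and [measurable]: "u \<in> borel_measurable borel"
  shows "(\<integral>\<^sup>+x. indicator B x * u (x \<bullet> k) \<partial>\<nu>) = emeasure \<nu> B * (\<integral>\<^sup>+x. u (x \<bullet> k) \<partial>\<nu>)"
proof -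
  let ?q = "gcov \<nu> k k" and ?m = "gmean \<nu> k"
  let ?\<phi> = "normal_density ?m (sqrt ?q)"
  interpret L: pair_sigma_finite \<nu> "lborel :: real measure" ..
  have hk: "h \<bullet> k = ?q" by (simp add: h)
  \<comment> \<open>Weighting by the marginal density turns the Lebesgue integral of
    \<open>v\<close> into the expectation of \<open>u (x \<bullet> k)\<close>. The integral over all
    shifts is evaluated twice: directly by an affine substitution in \<open>t\<close>, and through
    \<open>shift\<close>.\<close>
  define v where "v y = ennreal (?\<phi> y) * u y" for y
  have [measurable]: "v \<in> borel_measurable borel" unfolding v_def by measurable
  have shift: "(\<integral>\<^sup>+x. indicator B x * v (x \<bullet> k + t * ?q) \<partial>\<nu>) =
      (\<integral>\<^sup>+x. indicator B x * v (x \<bullet> k) * ennreal (exp (t * (x \<bullet> k - ?m) - t\<^sup>2 * ?q / 2)) \<partial>\<nu>)" for t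
  proof -
    have "(\<integral>\<^sup>+x. indicator B x * v (x \<bullet> k + t * ?q) \<partial>\<nu>) =
       (\<integral>\<^sup>+x. indicator B (x + t *\<^sub>R h) * v ((x + t *\<^sub>R h) \<bullet> k) \<partial>\<nu>)"
      using inv[of t] by (intro nn_integral_cong_AE) (auto simp: indicator_def inner_add_left hk)
    also have "\<dots> = (\<integral>\<^sup>+x. indicator B x * v (x \<bullet> k) \<partial>distr \<nu> borel (\<lambda>x. x + t *\<^sub>R h))"
      by (subst nn_integral_distr) auto
    also have "distr \<nu> borel (\<lambda>x. x + t *\<^sub>R h) = tilt \<nu> (t *\<^sub>R k)"
      by (rule shift_eq_tilt) (simp add: h scale)
    also have "(\<integral>\<^sup>+x. indicator B x * v (x \<bullet> k) \<partial>tilt \<nu> (t *\<^sub>R k)) =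
       (\<integral>\<^sup>+x. indicator B x * v (x \<bullet> k) * ennreal (exp (t * (x \<bullet> k - ?m) - t\<^sup>2 * ?q / 2)) \<partial>\<nu>)"
      unfolding tilt_def
      by (subst nn_integral_density)
         (auto simp: gmean_scale scale scale2 mult_ac power2_eq_square right_diff_distrib intro!: nn_integral_cong)
    finally show ?thesis .
  qed
  have "(\<integral>\<^sup>+t. (\<integral>\<^sup>+x. indicator B x * v (x \<bullet> k + t * ?q) \<partial>\<nu>) \<partial>lborel) =
     (\<integral>\<^sup>+x. (\<integral>\<^sup>+t. indicator B x * v (x \<bullet> k + t * ?q) \<partial>lborel) \<partial>\<nu>)"
    by (rule L.Fubini') measurable
  also have "\<dots> = (\<integral>\<^sup>+x. indicator B x * ((\<integral>\<^sup>+y. v y \<partial>lborel) / ennreal ?q) \<partial>\<nu>)"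
  proof (intro nn_integral_cong)
    fix x :: 'h
    have "(\<integral>\<^sup>+y. v y \<partial>lborel) = ennreal ?q * (\<integral>\<^sup>+t. v (x \<bullet> k + ?q * t) \<partial>lborel)"
      using nn_integral_real_affine[of v ?q "x \<bullet> k"] q by simp
    then have "(\<integral>\<^sup>+t. v (x \<bullet> k + t * ?q) \<partial>lborel) = (\<integral>\<^sup>+y. v y \<partial>lborel) / ennreal ?q"
      using q by (simp add: mult.commute[of ?q] mult.commute[of "ennreal ?q"] ennreal_mult_divide_eq)
    then show "(\<integral>\<^sup>+t. indicator B x * v (x \<bullet> k + t * ?q) \<partial>lborel) = indicator B x * ((\<integral>\<^sup>+y. v y \<partial>lborel) / ennreal ?q)"
      by (subst nn_integral_cmult) auto
  qed
  also have "\<dots> = emeasure \<nu> B * ((\<integral>\<^sup>+y. v y \<partial>lborel) / ennreal ?q)"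
    by (subst nn_integral_multc) auto
  also have "(\<integral>\<^sup>+y. v y \<partial>lborel) = (\<integral>\<^sup>+x. u (x \<bullet> k) \<partial>\<nu>)"
  proof -
    have "(\<integral>\<^sup>+x. u (x \<bullet> k) \<partial>\<nu>) = (\<integral>\<^sup>+y. u y \<partial>distr \<nu> borel (\<lambda>x. x \<bullet> k))"
      by (subst nn_integral_distr) auto
    also have "\<dots> = (\<integral>\<^sup>+y. v y \<partial>lborel)"
      unfolding marginal_normal[OF q] v_def by (subst nn_integral_density) auto
    finally show ?thesis by simp
  qed
  finally have lhs: "(\<integral>\<^sup>+t. (\<integral>\<^sup>+x. indicator B x * v (x \<bullet> k + t * ?q) \<partial>\<nu>) \<partial>lborel) =
     emeasure \<nu> B * ((\<integral>\<^sup>+x. u (x \<bullet> k) \<partial>\<nu>) / ennreal ?q)" .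
  have "(\<integral>\<^sup>+t. (\<integral>\<^sup>+x. indicator B x * v (x \<bullet> k + t * ?q) \<partial>\<nu>) \<partial>lborel) =
     (\<integral>\<^sup>+t. (\<integral>\<^sup>+x. indicator B x * v (x \<bullet> k) * ennreal (exp (t * (x \<bullet> k - ?m) - t\<^sup>2 * ?q / 2)) \<partial>\<nu>) \<partial>lborel)"
    unfolding shift ..
  also have "\<dots> = (\<integral>\<^sup>+x. (\<integral>\<^sup>+t. indicator B x * v (x \<bullet> k) * ennreal (exp (t * (x \<bullet> k - ?m) - t\<^sup>2 * ?q / 2)) \<partial>lborel) \<partial>\<nu>)"
    by (rule L.Fubini') measurable
  also have "\<dots> = (\<integral>\<^sup>+x. indicator B x * u (x \<bullet> k) / ennreal ?q \<partial>\<nu>)"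
  proof (intro nn_integral_cong)
    fix x :: 'h
    let ?y = "x \<bullet> k"
    \<comment> \<open>Integrating the Cameron-Martin factor over \<open>t\<close> yields the
      reciprocal of the marginal density up to 1/q, so only \<open>u\<close> remains. The same 1/q
      arises from the affine substitution.\<close>
    have "?\<phi> ?y * (sqrt (2 * pi / ?q) * exp ((?y - ?m)\<^sup>2 / (2 * ?q))) = 1 / ?q"
    proof -
      have "exp (- (?y - ?m)\<^sup>2 / (2 * ?q)) * exp ((?y - ?m)\<^sup>2 / (2 * ?q)) = 1" by (simp flip: exp_add)
      moreover have "1 / sqrt (2 * pi * ?q) * sqrt (2 * pi / ?q) = 1 / ?q"
        using q by (simp add: real_sqrt_mult real_sqrt_divide)
      ultimately have "(1 / sqrt (2 * pi * ?q) * sqrt (2 * pi / ?q)) *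
          (exp (- (?y - ?m)\<^sup>2 / (2 * ?q)) * exp ((?y - ?m)\<^sup>2 / (2 * ?q))) = 1 / ?q" by (simp only: mult_1_right)
      then show ?thesis using q by (simp add: normal_density_def mult_ac)
    qed
    moreover have "ennreal (?\<phi> ?y) * ennreal (sqrt (2 * pi / ?q) * exp ((?y - ?m)\<^sup>2 / (2 * ?q))) =
       ennreal (?\<phi> ?y * (sqrt (2 * pi / ?q) * exp ((?y - ?m)\<^sup>2 / (2 * ?q))))"
      using q by (intro ennreal_mult[symmetric]) auto
    ultimately have w: "ennreal (?\<phi> ?y) * ennreal (sqrt (2 * pi / ?q) * exp ((?y - ?m)\<^sup>2 / (2 * ?q))) = ennreal (1 / ?q)"
      by simp
    have "(\<integral>\<^sup>+t. indicator B x * v ?y * ennreal (exp (t * (?y - ?m) - t\<^sup>2 * ?q / 2)) \<partial>lborel) =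
      indicator B x * v ?y * ennreal (sqrt (2 * pi / ?q) * exp ((?y - ?m)\<^sup>2 / (2 * ?q)))"
      by (subst nn_integral_cmult) (auto simp: nn_integral_gaussian_exp[OF q])
    also have "\<dots> = indicator B x * u ?y * (ennreal (?\<phi> ?y) * ennreal (sqrt (2 * pi / ?q) * exp ((?y - ?m)\<^sup>2 / (2 * ?q))))"
      by (simp add: v_def mult_ac)
    also have "\<dots> = indicator B x * u ?y / ennreal ?q"
      unfolding w using q by (simp add: divide_ennreal_def inverse_ennreal inverse_eq_divide)
    finally show "(\<integral>\<^sup>+t. indicator B x * v ?y * ennreal (exp (t * (?y - ?m) - t\<^sup>2 * ?q / 2)) \<partial>lborel) = indicator B x * u ?y / ennreal ?q" .
  qed
  also have "\<dots> = (\<integral>\<^sup>+x. indicator B x * u (x \<bullet> k) \<partial>\<nu>) / ennreal ?q"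
    by (rule nn_integral_divide) measurable
  finally have "(\<integral>\<^sup>+x. indicator B x * u (x \<bullet> k) \<partial>\<nu>) / ennreal ?q = emeasure \<nu> B * (\<integral>\<^sup>+x. u (x \<bullet> k) \<partial>\<nu>) / ennreal ?q"
    using lhs by (simp add: ennreal_times_divide)
  then have "(\<integral>\<^sup>+x. indicator B x * u (x \<bullet> k) \<partial>\<nu>) / ennreal ?q * ennreal ?q = emeasure \<nu> B * (\<integral>\<^sup>+x. u (x \<bullet> k) \<partial>\<nu>) / ennreal ?q * ennreal ?q"
    by simp
  then show ?thesis using q by (simp add: ennreal_divide_times)
qed

text \<open>Independence of \<open>B\<close> from each single functional is enough: \<nu> restricted
  to \<open>B\<close> and \<nu> scaled by its mass on \<open>B\<close> then have equal laws under
  every functional, hence equal characteristic functionals. The two measures coincide, and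
  evaluating them on the complement of \<open>B\<close> gives the alternative.\<close>

theorem shift_invariant_zero_one:
  assumes B[measurable]: "B \<in> sets borel" and pos: "\<And>k. k \<noteq> 0 \<Longrightarrow> 0 < gcov \<nu> k k"
    and h: "\<And>k y. h k \<bullet> y = gcov \<nu> k y"
    and inv: "\<And>k. AE x in \<nu>. x \<in> B \<longleftrightarrow> x + h k \<in> B"
  shows "prob B = 0 \<or> prob B = 1"
proof -
  have ind: "(\<integral>\<^sup>+x. indicator B x * u (x \<bullet> k) \<partial>\<nu>) = emeasure \<nu> B * (\<integral>\<^sup>+x. u (x \<bullet> k) \<partial>\<nu>)"
    if [measurable]: "u \<in> borel_measurable borel" for u :: "real \<Rightarrow> ennreal" and k
  proof (cases "k = 0")
    case True
    then show ?thesis by (simp add: nn_integral_multc emeasure_space_1[simplified])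
  next
    case False
    have "t *\<^sub>R h k = h (t *\<^sub>R k)" for t
    proof -
      have "(t *\<^sub>R h k - h (t *\<^sub>R k)) \<bullet> y = 0" for y by (simp add: inner_diff_left h scale)
      from this[of "t *\<^sub>R h k - h (t *\<^sub>R k)"] show ?thesis by simp
    qed
    then show ?thesis using inv by (intro shift_invariant_independent[OF B pos[OF False] h]) auto
  qed
  let ?M = "density \<nu> (indicator B)" and ?N = "density \<nu> (\<lambda>_. emeasure \<nu> B)"
  have "?M = ?N"
  proof (rule char_functional_unique)
    show "finite_measure ?M" by (rule finite_measureI) (simp add: emeasure_density)
    show "finite_measure ?N" by (rule finite_measureI) (simp add: emeasure_density ennreal_mult_eq_top_iff)
    show "char_functional ?M k = char_functional ?N k" for k
    proof -
      have "distr ?M borel (\<lambda>x. x \<bullet> k) = distr ?N borel (\<lambda>x. x \<bullet> k)"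
      proof (rule measure_eqI)
        fix A assume "A \<in> sets (distr ?M borel (\<lambda>x. x \<bullet> k))"
        then have [measurable]: "A \<in> sets borel" by simp
        have "(\<integral>\<^sup>+x. indicator B x * indicator A (x \<bullet> k) \<partial>\<nu>) = emeasure \<nu> B * (\<integral>\<^sup>+x. indicator A (x \<bullet> k) \<partial>\<nu>)"
          by (rule ind) measurable
        moreover have "indicator A (x \<bullet> k) = (indicator ((\<lambda>x. x \<bullet> k) -` A) x :: ennreal)" for x
          by (simp add: indicator_def)
        moreover have "(\<lambda>x. x \<bullet> k) -` A \<in> sets borel"
          using measurable_sets[of "\<lambda>x. x \<bullet> k" borel borel A] by simp
        ultimately show "emeasure (distr ?M borel (\<lambda>x. x \<bullet> k)) A = emeasure (distr ?N borel (\<lambda>x. x \<bullet> k)) A"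
          by (simp add: emeasure_distr emeasure_density nn_integral_cmult)
      qed simp
      then show ?thesis by (metis char_functional_distr_inner sets_density sets_eq)
    qed
  qed simp_all
  then have "emeasure ?M (UNIV - B) = emeasure ?N (UNIV - B)" by simp
  moreover have "emeasure ?M (UNIV - B) = 0"
  proof -
    have "emeasure ?M (UNIV - B) = (\<integral>\<^sup>+x. indicator B x * indicator (UNIV - B) x \<partial>\<nu>)"
      by (rule emeasure_density) (use sets.Diff[OF _ B, of UNIV] in auto)
    also have "\<dots> = (\<integral>\<^sup>+x. 0 \<partial>\<nu>)" by (intro nn_integral_cong) (simp add: indicator_def)
    finally show ?thesis by simp
  qed
  moreover have "emeasure ?N (UNIV - B) = emeasure \<nu> B * emeasure \<nu> (UNIV - B)"
    by (simp add: emeasure_density nn_integral_cmult_indicator)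
  ultimately have "emeasure \<nu> B = 0 \<or> emeasure \<nu> (UNIV - B) = 0" by simp
  then show ?thesis
    using prob_compl[of B] by (auto simp: emeasure_eq_measure)
qed

end

section \<open>From absolute continuity to equivalence\<close>

theorem feldman_hajek:
  fixes \<mu> \<nu> :: "'h::{real_inner, polish_space} measure"
  assumes g: "gaussian \<mu>" "gaussian \<nu>" and ac: "absolutely_continuous \<mu> \<nu>"
    and pos: "\<And>k. k \<noteq> 0 \<Longrightarrow> 0 < gcov \<mu> k k"
    and h: "\<And>k y. h k \<bullet> y = gcov \<mu> k y"
  shows "absolutely_continuous \<nu> \<mu>"
proof -
  interpret M: gaussian_measure \<mu> by (rule gaussian_measureI) fact
  interpret N: gaussian_measure \<nu> by (rule gaussian_measureI) fact
  interpret A: ac_prob \<mu> \<nu>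
    using ac M.prob_space_axioms N.prob_space_axioms by (simp add: ac_prob_def ac_prob_axioms_def)
  obtain c where c: "0 \<le> c" "\<And>k. gcov \<mu> k k \<le> c * gcov \<nu> k k"
    using ac_gaussian_variance_bound[OF g ac] by blast
  define B where "B = {x. 0 < A.\<rho> x}"
  have rho[measurable]: "A.\<rho> \<in> borel_measurable borel"
    using A.rho_measurable unfolding measurable_cong_sets[OF M.sets_eq refl] .
  have B[measurable]: "B \<in> sets borel" unfolding B_def by measurable
  have AE_N: "(AE x in \<nu>. P x) \<longleftrightarrow> (AE x in \<mu>. x \<in> B \<longrightarrow> P x)" for P
    by (subst A.density_rho[symmetric], subst AE_density) (auto simp: B_def)
  \<comment> \<open>Cauchy-Schwarz for \<mu> and the variance comparison bound the functional of
    \<open>h k\<close> by the covariance of \<nu>, so shifting \<nu> by \<open>h k\<close> stays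
    absolutely continuous. Since \<nu> lives on \<open>B\<close>, almost every point of
    \<open>B\<close> is carried back into \<open>B\<close>.\<close>
  have fwd: "AE x in \<mu>. x \<in> B \<longrightarrow> x + h k \<in> B" for k
  proof -
    have "absolutely_continuous \<nu> (distr \<nu> borel (\<lambda>x. x + h k))"
    proof (rule N.shift_absolutely_continuous)
      show "(h k \<bullet> y)\<^sup>2 \<le> (gcov \<mu> k k * c) * gcov \<nu> y y" for y
      proof -
        have "(h k \<bullet> y)\<^sup>2 \<le> gcov \<mu> k k * gcov \<mu> y y" unfolding h by (rule M.cauchy_schwarz)
        also have "\<dots> \<le> gcov \<mu> k k * (c * gcov \<nu> y y)" by (intro mult_left_mono c M.nonneg)
        finally show ?thesis by (simp add: mult.assoc)
      qed
      show "0 \<le> gcov \<mu> k k * c" by (intro mult_nonneg_nonneg c M.nonneg)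
    qed
    moreover have "AE x in \<nu>. x \<in> B" unfolding AE_N by simp
    ultimately have "AE x in distr \<nu> borel (\<lambda>x. x + h k). x \<in> B"
      by (rule absolutely_continuous_AE[rotated]) simp
    then have "AE x in \<nu>. x + h k \<in> B"
      by (subst (asm) AE_distr_iff) auto
    then show ?thesis unfolding AE_N .
  qed
  \<comment> \<open>The converse implication is \<open>fwd\<close> for \<open>- k\<close> at the
    shifted point. Moving its exceptional null set is harmless, as the shifted \<mu> is a tilt of
    \<mu>.\<close>
  have inv: "AE x in \<mu>. x \<in> B \<longleftrightarrow> x + h k \<in> B" for k
  proof -
    have hm: "h (- k) = - h k"
    proof -
      have "(h (- k) + h k) \<bullet> y = 0" for y using M.scale[of "-1" k y] by (simp add: inner_add_left h)
      from this[of "h (- k) + h k"] show ?thesis by (simp add: eq_neg_iff_add_eq_0)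
    qed
    have "absolutely_continuous \<mu> (tilt \<mu> k)"
      unfolding tilt_def by (rule absolutely_continuousI_density) measurable
    then have "absolutely_continuous \<mu> (distr \<mu> borel (\<lambda>x. x + h k))"
      using M.shift_eq_tilt[of "h k" k] h by simp
    moreover have "AE x in \<mu>. x \<in> B \<longrightarrow> x + h (- k) \<in> B" by (rule fwd)
    ultimately have "AE x in distr \<mu> borel (\<lambda>x. x + h k). x \<in> B \<longrightarrow> x + h (- k) \<in> B"
      by (rule absolutely_continuous_AE[rotated]) simp
    then have "AE x in \<mu>. x + h k \<in> B \<longrightarrow> x + h k + h (- k) \<in> B"
      by (subst (asm) AE_distr_iff) auto
    with fwd[of k] show ?thesis by eventually_elim (auto simp: hm)
  qed
  have "measure \<mu> B \<noteq> 0"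
  proof
    assume "measure \<mu> B = 0"
    then have "B \<in> null_sets \<mu>" by (simp add: null_sets_def M.emeasure_eq_measure)
    then have "B \<in> null_sets \<nu>" using ac by (auto simp: absolutely_continuous_def)
    then have "AE x in \<nu>. x \<notin> B" by (rule AE_not_in)
    moreover have "AE x in \<nu>. x \<in> B" unfolding AE_N by simp
    ultimately have "AE x in \<nu>. False" by eventually_elim simp
    then show False by (simp add: N.AE_False)
  qed
  then have "measure \<mu> B = 1" using M.shift_invariant_zero_one[OF B pos h inv] by blast
  then have AE_B: "AE x in \<mu>. x \<in> B" by (simp add: M.prob_eq_1)
  show ?thesis unfolding absolutely_continuous_def
  proof
    fix S assume S: "S \<in> null_sets \<nu>"
    then have "AE x in \<nu>. x \<notin> S" by (rule AE_not_in)
    then have "AE x in \<mu>. x \<in> B \<longrightarrow> x \<notin> S" unfolding AE_N .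
    with AE_B have "AE x in \<mu>. x \<notin> S" by eventually_elim simp
    then show "S \<in> null_sets \<mu>" using S by (subst AE_iff_null_sets) (auto simp: null_sets_def)
  qed
qed

section \<open>Existence of minimisers\<close>

lemma KL_infinite: "\<not> absolutely_continuous \<mu> \<nu> \<Longrightarrow> KL \<nu> \<mu> = \<infinity>"
  by (simp add: KL_def)

lemma KL_nonneg:
  assumes "prob_space \<mu>" "prob_space \<nu>" "sets \<nu> = sets \<mu>"
  shows "0 \<le> KL \<nu> \<mu>"
proof (cases "absolutely_continuous \<mu> \<nu>")
  case True
  then interpret ac_prob \<mu> \<nu> using assms by (simp add: ac_prob_def ac_prob_axioms_def)
  show ?thesis by (simp add: KL_eq_Ent)
qed (simp add: KL_infinite)

text \<open>The direct method. Closedness is demanded only for limits absolutely continuous with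
  respect to \<mu>, as compactness supplies them; this makes the class of Gaussians equivalent to
  \<open>\<mu>\<^sub>0\<close> admissible.\<close>

theorem KL_minimiser_exists:
  fixes \<mu> :: "'a::polish_space measure"
  assumes \<mu>: "prob_space \<mu>" "sets \<mu> = sets borel"
    and A: "\<And>\<nu>. \<nu> \<in> \<A> \<Longrightarrow> prob_space \<nu> \<and> sets \<nu> = sets borel"
    and closed: "\<And>N L. (\<And>n. N n \<in> \<A>) \<Longrightarrow> setwise_conv N L \<Longrightarrow> prob_space L \<Longrightarrow> sets L = sets borel \<Longrightarrow>
      absolutely_continuous \<mu> L \<Longrightarrow> L \<in> \<A>"
    and fin: "\<exists>\<nu>\<in>\<A>. KL \<nu> \<mu> < \<infinity>"
  shows "\<exists>\<nu>. is_arg_min (\<lambda>\<nu>. KL \<nu> \<mu>) (\<lambda>\<nu>. \<nu> \<in> \<A>) \<nu>"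
proof -
  let ?S = "(\<lambda>\<nu>. KL \<nu> \<mu>) ` \<A>"
  have "0 \<le> Inf ?S" using A \<mu> by (intro INF_greatest KL_nonneg) auto
  moreover have "Inf ?S < \<infinity>"
  proof -
    obtain \<nu> where "\<nu> \<in> \<A>" "KL \<nu> \<mu> < \<infinity>" using fin by blast
    then show ?thesis by (intro le_less_trans[OF INF_lower]) auto
  qed
  ultimately obtain i where i: "Inf ?S = ereal i" "0 \<le> i" by (cases "Inf ?S") auto
  have "?S \<noteq> {}" using fin by auto
  from Inf_as_limit[OF this] obtain u where u: "\<And>n. u n \<in> ?S" "u \<longlonglongrightarrow> ereal i" unfolding i by blast
  then obtain N where N: "\<And>n. N n \<in> \<A>" "\<And>n. u n = KL (N n) \<mu>" by (auto simp: image_iff) metis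
  have ev: "eventually (\<lambda>n. KL (N n) \<mu> < ereal c) sequentially" if "i < c" for c
    using order_tendstoD(2)[OF u(2), of "ereal c"] that unfolding N(2) by simp
  obtain n0 where n0: "\<And>n. n0 \<le> n \<Longrightarrow> KL (N n) \<mu> < ereal (i + 1)"
    using ev[of "i + 1"] by (auto simp: eventually_sequentially)
  \<comment> \<open>The discarded terms may have infinite divergence. From \<open>n0\<close> on it
    is below i + 1, so every \<open>N' n\<close> has a density and the entropy bound is
    uniform.\<close>
  define N' where "N' n = N (n + n0)" for n
  have N'A: "N' n \<in> \<A>" for n using N by (simp add: N'_def)
  have ac: "ac_prob \<mu> (N' n)" for n
  proof -
    have "KL (N' n) \<mu> \<noteq> \<infinity>" using n0[of "n + n0"] by (auto simp: N'_def)
    then have "absolutely_continuous \<mu> (N' n)" using KL_infinite by blast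
    then show ?thesis using A[OF N'A[of n]] \<mu> by (simp add: ac_prob_def ac_prob_axioms_def)
  qed
  have Ent_le: "Ent \<nu> \<mu> \<le> ennreal c" if "ac_prob \<mu> \<nu>" "KL \<nu> \<mu> < ereal c" "0 \<le> c" for \<nu> c
    using that(2,3) unfolding ac_prob.KL_eq_Ent[OF that(1)] by (simp add: less_eq_ennreal.rep_eq less_imp_le)
  have "uniformly_ac \<mu> N'"
  proof (rule uniformly_ac_if_bounded_Ent[OF ac])
    show "Ent (N' n) \<mu> \<le> ennreal (i + 1)" for n
      using n0[of "n + n0"] i by (intro Ent_le ac) (auto simp: N'_def)
    show "0 \<le> i + 1" using i by simp
  qed
  then obtain r L where r: "strict_mono r" and L: "prob_space L" "sets L = sets borel" "absolutely_continuous \<mu> L"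
      "setwise_conv (\<lambda>n. N' (r n)) L"
    using setwise_compact[OF \<mu>, of N'] A[OF N'A] by blast
  have LA: "L \<in> \<A>" using closed[of "\<lambda>n. N' (r n)", OF N'A L(4,1,2,3)] .
  have acL: "ac_prob \<mu> L" using L \<mu> by (simp add: ac_prob_def ac_prob_axioms_def)
  have "KL L \<mu> \<le> ereal i"
  proof (rule ereal_le_epsilon2)
    fix e :: real assume e: "0 < e"
    have "eventually (\<lambda>n. KL (N (n + n0)) \<mu> < ereal (i + e)) sequentially"
      using ev[of "i + e"] e by (subst eventually_sequentially_seg) auto
    then have "eventually (\<lambda>n. KL (N' (r n)) \<mu> < ereal (i + e)) sequentially"
      using eventually_subseq[OF r] unfolding N'_def by blast
    then have "eventually (\<lambda>n. Ent (N' (r n)) \<mu> \<le> ennreal (i + e)) sequentially"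
    proof eventually_elim
      case (elim n)
      then show ?case using i e by (intro Ent_le ac) auto
    qed
    then have "Ent L \<mu> \<le> ennreal (i + e)"
      using i e by (intro Ent_lower_semicontinuous[OF ac acL L(4)]) auto
    then show "KL L \<mu> \<le> ereal i + ereal e"
      unfolding ac_prob.KL_eq_Ent[OF acL] using i e by (simp add: less_eq_ennreal.rep_eq del: ennreal_plus)
  qed
  then have "KL L \<mu> \<le> KL \<nu> \<mu>" if "\<nu> \<in> \<A>" for \<nu>
    using INF_lower[OF that, of "\<lambda>\<nu>. KL \<nu> \<mu>"] i by simp
  then show ?thesis using LA by (intro exI[of _ L]) (auto simp: is_arg_min_def not_less)
qed

section \<open>Closedness of the classes with fixed covariance or fixed mean\<close>

context gaussian_measure begin

lemma has_mean_iff: "has_mean \<nu> m \<longleftrightarrow> (\<forall>h. gmean \<nu> h = m \<bullet> h)"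
  using integrable_inner by (auto simp: has_mean_def gmean_def)

lemma has_covariance_iff:
  "has_covariance \<nu> C \<longleftrightarrow> (\<exists>m. has_mean \<nu> m) \<and> (\<forall>h k. gcov \<nu> h k = C h \<bullet> k)"
proof -
  have "integrable \<nu> (\<lambda>x. ((x - m) \<bullet> h) * ((x - m) \<bullet> k)) \<and> (LINT x|\<nu>. ((x - m) \<bullet> h) * ((x - m) \<bullet> k)) = gcov \<nu> h k"
    if "has_mean \<nu> m" for m h k
    using that integrable_centered[of h "m \<bullet> h" k "m \<bullet> k"] 
    by (simp add: has_mean_iff gcov_def inner_diff_left)
  then show ?thesis unfolding has_covariance_def by auto
qed

text \<open>\<open>has_covariance\<close> includes the existence of a mean vector, which a setwise
  limit has to be given. A ball of mass above 1/4 and the variance bound make the mean functional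
  bounded by a multiple of the norm, so Riesz applies.\<close>

lemma has_mean_if_bounded_covariance:
  assumes c: "\<And>h. gcov \<nu> h h \<le> c * (norm h)\<^sup>2" "0 \<le> c"
  shows "\<exists>m. has_mean \<nu> m"
proof -
  have "(\<lambda>n. measure \<nu> (cball 0 (real n))) \<longlonglongrightarrow> measure \<nu> (\<Union>n. cball 0 (real n))"
    by (intro finite_Lim_measure_incseq) (auto simp: incseq_def)
  also have "(\<Union>n. cball 0 (real n)) = (UNIV :: 'h set)"
  proof -
    have "x \<in> (\<Union>n. cball 0 (real n))" for x :: 'h
    proof -
      obtain n where "norm x \<le> real n" using real_arch_simple by blast
      then show ?thesis by (intro UN_I[of n]) auto
    qed
    then show ?thesis by blast
  qed
  finally have "(\<lambda>n. measure \<nu> (cball 0 (real n))) \<longlonglongrightarrow> 1" using prob_space by simp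
  then have "eventually (\<lambda>n. 1 / 4 < measure \<nu> (cball 0 (real n))) sequentially"
    by (rule order_tendstoD) simp
  then obtain R where R: "1 / 4 < measure \<nu> (cball 0 (real R))" by (auto simp: eventually_sequentially)
  have "\<bar>gmean \<nu> h\<bar> \<le> (real R + 2 * sqrt (c + 1)) * norm h" for h
  proof (cases "h = 0")
    case True
    then show ?thesis using gmean_scale[of 0 h] by simp
  next
    case False
    have "cball 0 (real R) \<subseteq> {x. \<bar>x \<bullet> h\<bar> \<le> real R * norm h}"
    proof
      fix x :: 'h assume "x \<in> cball 0 (real R)"
      then have "norm x * norm h \<le> real R * norm h" by (intro mult_right_mono) auto
      then show "x \<in> {x. \<bar>x \<bullet> h\<bar> \<le> real R * norm h}"
        using Cauchy_Schwarz_ineq2[of x h] by simp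
    qed
    then have "measure \<nu> (cball 0 (real R)) \<le> measure \<nu> {x. \<bar>x \<bullet> h\<bar> \<le> real R * norm h}"
      by (intro finite_measure_mono) auto
    also have "{x. \<bar>x \<bullet> h\<bar> \<le> real R * norm h} = (\<lambda>x. x \<bullet> h) -` {- (real R * norm h)..real R * norm h} \<inter> space \<nu>"
      by auto
    also have "measure \<nu> \<dots> = measure (marginal h) {- (real R * norm h)..real R * norm h}"
      unfolding marginal_def by (subst measure_distr) auto
    finally have "1 / 4 < measure (marginal h) {- (real R * norm h)..real R * norm h}" using R by simp
    \<comment> \<open>Replacing c by c + 1 keeps the variance bound positive when c is 0.\<close>
    moreover have "gcov \<nu> h h \<le> (c + 1) * (norm h)\<^sup>2"
      using c(1)[of h] by (simp add: distrib_right add_increasing2)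
    moreover have "0 < (c + 1) * (norm h)\<^sup>2" using c(2) False by simp
    ultimately have "\<bar>gmean \<nu> h\<bar> \<le> real R * norm h + 2 * sqrt ((c + 1) * (norm h)\<^sup>2)"
      using gaussian_real_mean_bound[OF gaussian_marginal[of h], where R = "real R * norm h" and V = "(c + 1) * (norm h)\<^sup>2"]
      unfolding marginal_var unfolding marginal_mean by blast
    also have "sqrt ((c + 1) * (norm h)\<^sup>2) = sqrt (c + 1) * norm h" by (simp only: real_sqrt_mult real_sqrt_abs abs_norm_cancel)
    finally show ?thesis by (simp add: distrib_right mult.assoc)
  qed
  then obtain m where "\<forall>h. gmean \<nu> h = m \<bullet> h"
    using riesz_representation[of "gmean \<nu>"] gmean_add gmean_scale by blast
  then show ?thesis by (auto simp: has_mean_iff)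
qed

end

text \<open>Convergence of variances fixes the diagonal of the limiting covariance form, and
  polarisation with the symmetry of \<open>C\<close> fixes the rest. Boundedness of \<open>C\<close>
  yields the mean vector.\<close>

lemma setwise_limit_has_covariance:
  fixes N :: "nat \<Rightarrow> 'h::{real_inner, polish_space} measure"
  assumes g: "\<And>n. gaussian (N n)" and L: "prob_space L" "sets L = sets borel" and conv: "setwise_conv N L"
    and C: "covariance_operator C" and cov: "\<And>n. has_covariance (N n) C"
  shows "has_covariance L C"
proof -
  interpret N: gaussian_measure "N n" for n by (rule gaussian_measureI) fact
  interpret L: gaussian_measure L by (intro gaussian_measureI gaussian_setwise_limit(1)[OF g L conv])
  have bl: "bounded_linear C" and sym: "C h \<bullet> k = h \<bullet> C k" for h k
    using C by (auto simp: covariance_operator_def)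
  have diag: "gcov L h h = C h \<bullet> h" for h
    using LIMSEQ_unique[OF gaussian_setwise_limit(2)[OF g L conv, of h], of "C h \<bullet> h"] cov N.has_covariance_iff
    by simp
  have "gcov L h k = C h \<bullet> k" for h k
  proof -
    have "gcov L (h + k) (h + k) = gcov L h h + 2 * gcov L h k + gcov L k k"
      using L.expand[of h 1 k] by simp
    moreover have "C (h + k) \<bullet> (h + k) = C h \<bullet> h + 2 * (C h \<bullet> k) + C k \<bullet> k"
      using sym[of k h] by (simp add: linear_add[OF bounded_linear.linear[OF bl]] inner_add_left inner_add_right inner_commute)
    ultimately show ?thesis by (simp add: diag)
  qed
  moreover have "\<exists>m. has_mean L m"
  proof -
    obtain c where c: "\<And>h. norm (C h) \<le> norm h * c" "0 \<le> c"
      using bounded_linear.nonneg_bounded[OF bl] by blast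
    have "gcov L h h \<le> c * (norm h)\<^sup>2" for h
    proof -
      have "C h \<bullet> h \<le> norm (C h) * norm h" by (rule norm_cauchy_schwarz)
      also have "\<dots> \<le> (norm h * c) * norm h" by (intro mult_right_mono c) simp
      finally show ?thesis by (simp add: diag power2_eq_square mult_ac)
    qed
    then show ?thesis using c(2) by (rule L.has_mean_if_bounded_covariance)
  qed
  ultimately show ?thesis by (simp add: L.has_covariance_iff)
qed

lemma setwise_limit_has_mean:
  fixes N :: "nat \<Rightarrow> 'h::{real_inner, polish_space} measure"
  assumes g: "\<And>n. gaussian (N n)" and L: "prob_space L" "sets L = sets borel" and conv: "setwise_conv N L"
    and mean: "\<And>n. has_mean (N n) m"
  shows "has_mean L m"
proof -
  interpret N: gaussian_measure "N n" for n by (rule gaussian_measureI) fact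
  interpret L: gaussian_measure L by (intro gaussian_measureI gaussian_setwise_limit(1)[OF g L conv])
  have "gmean L h = m \<bullet> h" for h
  proof -
    obtain r where "(\<lambda>n. gmean (N (r n)) h) \<longlonglongrightarrow> gmean L h"
      using gaussian_setwise_limit(3)[OF g L conv] by blast
    then show ?thesis using mean N.has_mean_iff LIMSEQ_unique[of "\<lambda>n. gmean (N (r n)) h" "gmean L h" "m \<bullet> h"] by simp
  qed
  then show ?thesis by (simp add: L.has_mean_iff)
qed

lemma prob_space_density_normalised:
  fixes f :: "'a \<Rightarrow> real"
  assumes "prob_space M" and f: "integrable M f" "\<And>x. 0 \<le> f x" and pos: "\<not> (AE x in M. f x = 0)"
  shows "prob_space (density M (\<lambda>x. ennreal (f x / (LINT x|M. f x))))"
proof (rule prob_spaceI)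
  have "(LINT x|M. f x) \<noteq> 0" using integral_nonneg_eq_0_iff_AE[OF f(1)] f(2) pos by simp
  moreover have "0 \<le> (LINT x|M. f x)" using f(2) by simp
  ultimately show "emeasure (density M (\<lambda>x. ennreal (f x / (LINT x|M. f x)))) (space (density M (\<lambda>x. ennreal (f x / (LINT x|M. f x))))) = 1"
    using f borel_measurable_integrable[OF f(1)]
    by (simp add: emeasure_density nn_integral_eq_integral cong: nn_integral_cong)
qed

theorem theorem3p1:
  fixes \<mu>\<^sub>0 \<mu> :: "'h::{real_inner, polish_space} measure"
    and m\<^sub>0 :: 'h and C\<^sub>0 :: "'h \<Rightarrow> 'h"
    and X :: "'h set" and N :: "'h \<Rightarrow> real"
    and \<Phi> :: "'h \<Rightarrow> real" and Z :: real
    and \<A> :: "'h measure set"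
  assumes C\<^sub>0: "covariance_operator C\<^sub>0" "strictly_positive C\<^sub>0"
    and \<mu>\<^sub>0: "is_normal \<mu>\<^sub>0 m\<^sub>0 C\<^sub>0"
    and X: "separable_Banach_embedded X N" "X \<in> sets borel" "emeasure \<mu>\<^sub>0 X = 1"
    and \<Phi>: "continuous_map (norm_topology X N) euclideanreal \<Phi>"
      "set_integrable \<mu>\<^sub>0 X (\<lambda>x. exp (- \<Phi> x))"
    and Z: "Z = (LINT x:X|\<mu>\<^sub>0. exp (- \<Phi> x))"
    and \<mu>: "\<mu> = density \<mu>\<^sub>0 (\<lambda>x. ennreal (indicator X x * (exp (- \<Phi> x) / Z)))"
    and \<A>: "\<A> = {\<nu>. gaussian \<nu>} \<or>
        \<A> = {\<nu>. gaussian \<nu> \<and> equivalent_measures \<nu> \<mu>\<^sub>0} \<or>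
        (\<exists>C. covariance_operator C \<and> \<A> = {\<nu>. gaussian \<nu> \<and> has_covariance \<nu> C}) \<or>
        (\<exists>m. \<A> = {\<nu>. gaussian \<nu> \<and> has_mean \<nu> m})"
    and finite_KL: "\<exists>\<nu>\<in>\<A>. KL \<nu> \<mu> < \<infinity>"
  shows "(\<exists>\<nu>. is_arg_min (\<lambda>\<nu>. KL \<nu> \<mu>) (\<lambda>\<nu>. \<nu> \<in> \<A>) \<nu>) \<and>
    (\<forall>\<nu>. is_arg_min (\<lambda>\<nu>. KL \<nu> \<mu>) (\<lambda>\<nu>. \<nu> \<in> \<A>) \<nu> \<longrightarrow> equivalent_measures \<nu> \<mu>\<^sub>0)"
proof -
  have g0: "gaussian \<mu>\<^sub>0" using \<mu>\<^sub>0 by (simp add: is_normal_def)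
  interpret G: gaussian_measure \<mu>\<^sub>0 by (rule gaussian_measureI) fact
  have cov0: "gcov \<mu>\<^sub>0 h k = C\<^sub>0 h \<bullet> k" for h k
    using \<mu>\<^sub>0 by (simp add: is_normal_def G.has_covariance_iff)
  have ac_equiv: "equivalent_measures \<nu> \<mu>\<^sub>0" if "gaussian \<nu>" "absolutely_continuous \<mu>\<^sub>0 \<nu>" for \<nu>
    unfolding equivalent_measures_def
  proof
    show "absolutely_continuous \<nu> \<mu>\<^sub>0"
    proof (rule feldman_hajek[OF g0 that])
      show "0 < gcov \<mu>\<^sub>0 k k" if "k \<noteq> 0" for k
        using C\<^sub>0(2) that by (simp add: cov0 strictly_positive_def)
      show "C\<^sub>0 k \<bullet> y = gcov \<mu>\<^sub>0 k y" for k y by (simp add: cov0)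
    qed
  qed fact
  let ?f = "\<lambda>x. indicator X x * exp (- \<Phi> x)"
  have f: "integrable \<mu>\<^sub>0 ?f" using \<Phi>(2) by (simp add: set_integrable_def)
  have Zf: "Z = (LINT x|\<mu>\<^sub>0. ?f x)" unfolding Z by (simp add: set_lebesgue_integral_def)
  have \<mu>f: "\<mu> = density \<mu>\<^sub>0 (\<lambda>x. ennreal (?f x / (LINT x|\<mu>\<^sub>0. ?f x)))"
    unfolding \<mu> Zf by simp
  have "prob_space \<mu>"
    unfolding \<mu>f
  proof (rule prob_space_density_normalised[OF G.prob_space_axioms f])
    \<comment> \<open>The exponential is positive on \<open>X\<close>, which carries
      \<open>\<mu>\<^sub>0\<close>, so the normalising constant is positive; division by zero would
      turn \<mu> into the null measure.\<close>
    show "\<not> (AE x in \<mu>\<^sub>0. ?f x = 0)"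
    proof
      assume "AE x in \<mu>\<^sub>0. ?f x = 0"
      moreover have "AE x in \<mu>\<^sub>0. x \<in> X"
        using X(2,3) by (intro G.AE_prob_1) (simp add: measure_def)
      ultimately have "AE x in \<mu>\<^sub>0. False" by eventually_elim simp
      then show False by (simp add: G.AE_False)
    qed
  qed simp
  have sets\<mu>: "sets \<mu> = sets borel" unfolding \<mu> by simp
  have "absolutely_continuous \<mu>\<^sub>0 \<mu>"
    unfolding \<mu>f by (intro absolutely_continuousI_density measurable_compose[OF _ measurable_ennreal]
      borel_measurable_divide borel_measurable_integrable[OF f] borel_measurable_const)
  \<comment> \<open>\<mu> itself need not be Gaussian, so the dichotomy is applied relative to
    \<open>\<mu>\<^sub>0\<close>.\<close>
  then have ac_trans: "absolutely_continuous \<mu>\<^sub>0 \<nu>" if "absolutely_continuous \<mu> \<nu>" for \<nu>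
    using that by (auto simp: absolutely_continuous_def)
  have gA: "gaussian \<nu>" if "\<nu> \<in> \<A>" for \<nu>
    using \<A> that by auto
  have closed: "L \<in> \<A>"
    if N: "\<And>n. N n \<in> \<A>" and conv: "setwise_conv N L" and L: "prob_space L" "sets L = sets borel" and ac: "absolutely_continuous \<mu> L"
    for N L
  proof -
    have gN: "gaussian (N n)" for n using gA N by blast
    have gL: "gaussian L" by (rule gaussian_setwise_limit(1)[OF gN L conv])
    consider "\<A> = {\<nu>. gaussian \<nu>}"
      | "\<A> = {\<nu>. gaussian \<nu> \<and> equivalent_measures \<nu> \<mu>\<^sub>0}"
      | C where "covariance_operator C" "\<A> = {\<nu>. gaussian \<nu> \<and> has_covariance \<nu> C}"
      | m where "\<A> = {\<nu>. gaussian \<nu> \<and> has_mean \<nu> m}"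
      using \<A> by blast
    then show ?thesis
    proof cases
      \<comment> \<open>For general measures a limit could lose its mass on a set charged by
        \<open>\<mu>\<^sub>0\<close>; Gaussianity of \<open>L\<close> excludes this through
        \<open>ac_equiv\<close>.\<close>
      case 2
      then show ?thesis using gL ac_equiv[OF gL ac_trans[OF ac]] by simp
    next
      case 3
      then have "has_covariance L C" using N by (intro setwise_limit_has_covariance[OF gN L conv]) auto
      then show ?thesis using gL 3 by simp
    next
      case 4
      then have "has_mean L m" using N by (intro setwise_limit_has_mean[OF gN L conv]) auto
      then show ?thesis using gL 4 by simp
    qed (use gL in simp)
  qed
  have "\<exists>\<nu>. is_arg_min (\<lambda>\<nu>. KL \<nu> \<mu>) (\<lambda>\<nu>. \<nu> \<in> \<A>) \<nu>"
    by (rule KL_minimiser_exists[OF \<open>prob_space \<mu>\<close> sets\<mu> _ closed finite_KL])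
       (use gA in \<open>auto simp: gaussian_def\<close>)
  moreover have "equivalent_measures \<nu> \<mu>\<^sub>0" if \<nu>: "is_arg_min (\<lambda>\<nu>. KL \<nu> \<mu>) (\<lambda>\<nu>. \<nu> \<in> \<A>) \<nu>" for \<nu>
  proof -
    \<comment> \<open>A minimiser does no worse than the competitor of finite divergence, and finite
      divergence forces absolute continuity.\<close>
    have "KL \<nu> \<mu> < \<infinity>" using \<nu> finite_KL by (auto simp: is_arg_min_def not_less)
    then have "absolutely_continuous \<mu> \<nu>" using KL_infinite[of \<mu> \<nu>] by auto
    moreover have "gaussian \<nu>" using \<nu> gA by (simp add: is_arg_min_def)
    ultimately show ?thesis using ac_equiv ac_trans by blast
  qed
  ultimately show ?thesis by blast
qed

end
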